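(* The sequence of formal power series $\varphi_n(s;x|q,t)$ $(n=1,2,\ldots)$ satisfies the following recurrence relation by Jackson integral transformations: $$\varphi_{n+1}(s;x|q,t)=\left(\frac{(q/t;q)_\infty}{(1-q)(q;q)_\infty}\right)^{n}\prod_{i=1}^n\frac{(ts_{n+1}/s_i;q)_\infty}{(qs_{n+1}/ts_i;q)_\infty}\int_{tx_1}^\infty\!\cdots\!\int_{tx_n}^\infty K_\lambda(x;y)\,\varphi_n(s;y|q,t)\,\frac{d_qy_1}{y_1}\cdots\frac{d_qy_n}{y_n},$$ where on the left $x=(x_1,\ldots,x_{n+1})$, $s=(s_1,\ldots,s_{n+1})$, and $\varphi_n(s;y|q,t)$ is in the variables $(s_1,\ldots,s_n)$, $y=(y_1,\ldots,y_n)$.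
   Context: Fix $q,t\in\mathbb{C}^*$ with $|q|<1$; $(z;q)_\infty=\prod_{k\ge0}(1-q^kz)$, $(z;q)_k=(z;q)_\infty/(q^kz;q)_\infty$. The Jackson integral is $\int_a^\infty f(z)\frac{d_qz}{z}=(1-q)\sum_{k=0}^\infty f(q^{-k-1}a)$. The kernel is $$K_\lambda(x;y)=\prod_{i=1}^n\frac{(tx_i/y_i;q)_\infty}{(x_i/y_i;q)_\infty}\prod_{1\le i<j\le n+1}\frac{(tx_j/y_i;q)_\infty}{(x_j/y_i;q)_\infty}\prod_{1\le i<j\le n}\frac{(qy_j/x_i;q)_\infty}{(qy_j/tx_i;q)_\infty}$$ $$\times\prod_{1\le i<j\le n}\frac{(y_j/y_i;q)_\infty}{(ty_j/y_i;q)_\infty}\frac{(qy_j/ty_i;q)_\infty}{(qy_j/y_i;q)_\infty}\prod_{i=1}^n(qy_i/tx_i)^{\lambda_i-\lambda_{n+1}+(n-i)\beta},$$ where $t=q^\beta$ and $\lambda=(\lambda_1,\ldots,\lambda_{n+1})$ are complex parameters such that $s_i=t^{n+1-i}q^{\lambda_i}$ $(1\le i\le n+1)$. At the points $y_i=q^{-\nu_i-1}tx_i$ $(\nu\in\mathbb{N}^n)$ of the Jackson integral, the last product equals $\prod_i(ts_{n+1}/s_i)^{\nu_i}$, and every term is regarded as a formal power series in the ratios $x_{i+1}/x_i$, $s_{i+1}/s_i$ $(1\le i\le n)$. $M_n$ is the set of strictly upper triangular $n\times n$ matrices with entries in $\mathbb{N}=\{0,1,\ldots\}$, and $$\varphi_n(x;s|q,t)=\prod_{1\le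 i<j\le n}\frac{(qs_j/s_i;q)_\infty}{(qs_j/ts_i;q)_\infty}\sum_{\theta\in M_n}c_n(\theta;s|q,t)\prod_{1\le i<j\le n}(x_j/x_i)^{\theta_{ij}},$$ $$c_n(\theta;s|q,t)=\prod_{k=2}^{n}\prod_{1\le i<j\le k}\frac{(q^{\sum_{a>k}(\theta_{i,a}-\theta_{j,a})}ts_j/s_i;q)_{\theta_{i,k}}}{(q^{\sum_{a>k}(\theta_{i,a}-\theta_{j,a})}qs_j/s_i;q)_{\theta_{i,k}}}\cdot\prod_{k=2}^{n}\prod_{1\le i\le j<k}\frac{(q^{-\theta_{j,k}+\sum_{a>k}(\theta_{i,a}-\theta_{j,a})}qs_j/ts_i;q)_{\theta_{i,k}}}{(q^{-\theta_{j,k}+\sum_{a>k}(\theta_{i,a}-\theta_{j,a})}s_j/s_i;q)_{\theta_{i,k}}}$$ with $\sum_{a>k}=\sum_{a=k+1}^n$, regarded as a formal power series in $(x_2/x_1,\ldots,x_n/x_{n-1};s_2/s_1,\ldots,s_n/s_{n-1})$; $\varphi_n(s;x|q,t)$ is obtained by exchanging $x$ and $s$ (and $\varphi_1=1$).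
   Formalization: The formal statement assumes t is not one of q, q^2, q^3, …; for those t the kernel denominator (x_i/y_i;q)_∞ vanishes at points of the Jackson integral while (q/t;q)_∞ = 0, so the displayed right-hand side is undefined. *)

theory Defs
  imports "HOL-Analysis.Analysis" "HOL-Library.Poly_Mapping"
begin

section \<open>Multivariate formal power series\<close>

text \<open>
  Formal power series in a set of commuting variables indexed by the type \<^typ>\<open>'v\<close>: arbitrary
  functions from exponent vectors (finitely supported, of type \<open>'v \<Rightarrow>\<^sub>0 nat\<close>) to coefficients.
\<close>

typedef ('v, 'a) mfps = "UNIV :: (('v \<Rightarrow>\<^sub>0 nat) \<Rightarrow> 'a) set"
  morphisms mfps_coeff Abs_mfps by simp

setup_lifting type_definition_mfps

lemma mfps_eqI: "(\<And>m. mfps_coeff f m = mfps_coeff g m) \<Longrightarrow> f = g"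
  by (simp add: mfps_coeff_inject[symmetric] fun_eq_iff)

lemma surj_mfps_coeff: "surj mfps_coeff"
  by (metis Abs_mfps_inverse UNIV_I surjI)

lemma finite_add_decomp: "finite {(a, b). a + b = (m :: 'v \<Rightarrow>\<^sub>0 nat)}"
proof -
  let ?P = "Pi\<^sub>E (Poly_Mapping.keys m) (\<lambda>v. {..Poly_Mapping.lookup m v})"
  let ?r = "\<lambda>a. restrict (Poly_Mapping.lookup a) (Poly_Mapping.keys m)"
  let ?A = "{a. \<exists>b. a + b = m}"
  have le: "Poly_Mapping.lookup a v \<le> Poly_Mapping.lookup m v" if "a \<in> ?A" for a v
    using that by (auto simp: lookup_add)
  have "inj_on ?r ?A"
  proof (rule inj_onI)
    fix a b assume a: "a \<in> ?A" and b: "b \<in> ?A" and eq: "?r a = ?r b"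
    show "a = b"
    proof (rule poly_mapping_eqI)
      fix v
      show "Poly_Mapping.lookup a v = Poly_Mapping.lookup b v"
      proof (cases "v \<in> Poly_Mapping.keys m")
        case True
        then show ?thesis using fun_cong[OF eq, of v] by simp
      next
        case False
        then show ?thesis using le[OF a, of v] le[OF b, of v] by (simp add: in_keys_iff)
      qed
    qed
  qed
  moreover have "?r ` ?A \<subseteq> ?P"
    using le by (auto simp: PiE_def)
  moreover have "finite ?P" by (intro finite_PiE) auto
  ultimately have fin: "finite ?A" by (meson finite_imageD finite_subset)
  have "{(a, b). a + b = m} \<subseteq> ?A \<times> ?A"
  proof safe
    fix a b :: "'v \<Rightarrow>\<^sub>0 nat"
    show "\<exists>c. a + c = a + b" by blast
    show "\<exists>c. b + c = a + b" using add.commute by blast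
  qed
  then show ?thesis using fin by (meson finite_SigmaI finite_subset)
qed

instantiation mfps :: (type, comm_ring_1) comm_ring_1
begin

lift_definition zero_mfps :: "('a, 'b) mfps" is "\<lambda>m. 0" .
lift_definition one_mfps :: "('a, 'b) mfps" is "\<lambda>m. if m = 0 then 1 else 0" .
lift_definition plus_mfps :: "('a, 'b) mfps \<Rightarrow> ('a, 'b) mfps \<Rightarrow> ('a, 'b) mfps"
  is "\<lambda>f g m. f m + g m" .
lift_definition minus_mfps :: "('a, 'b) mfps \<Rightarrow> ('a, 'b) mfps \<Rightarrow> ('a, 'b) mfps"
  is "\<lambda>f g m. f m - g m" .
lift_definition uminus_mfps :: "('a, 'b) mfps \<Rightarrow> ('a, 'b) mfps"
  is "\<lambda>f m. - f m" .
lift_definition times_mfps :: "('a, 'b) mfps \<Rightarrow> ('a, 'b) mfps \<Rightarrow> ('a, 'b) mfps"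
  is "\<lambda>f g m. \<Sum>(a, b) | a + b = m. f a * g b" .

instance
proof
  fix f g h :: "('a, 'b) mfps"
  show "f + g + h = f + (g + h)" by transfer (simp add: add.assoc)
  show "f + g = g + f" by transfer (simp add: add.commute)
  show "0 + f = f" by transfer simp
  show "- f + f = 0" by transfer simp
  show "f - g = f + - g" by transfer simp
  show "(0 :: ('a, 'b) mfps) \<noteq> 1"
    by transfer (auto simp: fun_eq_iff intro!: exI[of _ 0])
  show "(f + g) * h = f * h + g * h"
    by transfer (simp add: distrib_right sum.distrib case_prod_unfold)
  show "f * g = g * f"
  proof (transfer, rule ext)
    fix f g :: "('a \<Rightarrow>\<^sub>0 nat) \<Rightarrow> 'b" and m
    show "(\<Sum>(a, b) | a + b = m. f a * g b) = (\<Sum>(a, b) | a + b = m. g a * f b)"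
      by (rule sum.reindex_bij_witness[of _ prod.swap prod.swap]) (auto simp: add.commute mult.commute)
  qed
  show "1 * f = f"
  proof (transfer, rule ext)
    fix f :: "('a \<Rightarrow>\<^sub>0 nat) \<Rightarrow> 'b" and m
    have "(\<Sum>(a, b) | a + b = m. (if a = 0 then 1 else 0) * f b)
        = (\<Sum>(a, b) \<in> {(0 :: 'a \<Rightarrow>\<^sub>0 nat, m)}. (if a = 0 then 1 else 0) * f b)"
      using finite_add_decomp[of m] by (intro sum.mono_neutral_right) (auto split: if_splits)
    then show "(\<Sum>(a, b) | a + b = m. (if a = 0 then 1 else 0) * f b) = f m" by simp
  qed
  show "f * g * h = f * (g * h)"
  proof (transfer, rule ext)
    fix f g h :: "('a \<Rightarrow>\<^sub>0 nat) \<Rightarrow> 'b" and m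
    let ?D = "\<lambda>m :: 'a \<Rightarrow>\<^sub>0 nat. {(a, b). a + b = m}"
    have "(\<Sum>(p, c) \<in> ?D m. (\<Sum>(a, b) \<in> ?D p. f a * g b) * h c)
        = (\<Sum>x \<in> ?D m. \<Sum>y \<in> ?D (fst x). f (fst y) * g (snd y) * h (snd x))"
      by (simp add: sum_distrib_right case_prod_unfold)
    also have "\<dots> = (\<Sum>(x, y) \<in> (SIGMA x : ?D m. ?D (fst x)). f (fst y) * g (snd y) * h (snd x))"
      by (rule sum.Sigma) (auto intro: finite_add_decomp)
    also have "\<dots> = (\<Sum>(x, y) \<in> (SIGMA x : ?D m. ?D (snd x)). f (fst x) * (g (fst y) * h (snd y)))"
      by (rule sum.reindex_bij_witness
            [of _ "\<lambda>((a, r), (b, c)). ((a + b, c), (a, b))" "\<lambda>((p, c), (a, b)). ((a, b + c), (b, c))"])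
         (auto simp: add.assoc mult.assoc)
    also have "\<dots> = (\<Sum>x \<in> ?D m. \<Sum>y \<in> ?D (snd x). f (fst x) * (g (fst y) * h (snd y)))"
      by (rule sum.Sigma[symmetric]) (auto intro: finite_add_decomp)
    also have "\<dots> = (\<Sum>(a, r) \<in> ?D m. f a * (\<Sum>(b, c) \<in> ?D r. g b * h c))"
      by (simp add: sum_distrib_left case_prod_unfold)
    finally show "(\<Sum>(p, c) | p + c = m. (\<Sum>(a, b) | a + b = p. f a * g b) * h c)
        = (\<Sum>(a, r) | a + r = m. f a * (\<Sum>(b, c) | b + c = r. g b * h c))" .
  qed
qed

end

text \<open>Reciprocals of units; as usual in HOL, a non-unit gets the dummy reciprocal 0.\<close>

instantiation mfps :: (type, comm_ring_1) inverse
begin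

definition inverse_mfps :: "('a, 'b) mfps \<Rightarrow> ('a, 'b) mfps"
  where "inverse_mfps f = (if \<exists>g. f * g = 1 then THE g. f * g = 1 else 0)"
definition divide_mfps :: "('a, 'b) mfps \<Rightarrow> ('a, 'b) mfps \<Rightarrow> ('a, 'b) mfps"
  where "divide_mfps f g = f * inverse g"

instance ..

end

lemma mfps_inverse_unique:
  fixes f g :: "('v, 'a :: comm_ring_1) mfps"
  assumes "f * g = 1"
  shows "inverse f = g"
proof -
  have uniq: "g' = g" if "f * g' = 1" for g'
  proof -
    have "g' = (f * g) * g'" using assms by simp
    also have "\<dots> = (f * g') * g" by (simp only: mult.assoc mult.commute[of g g'])
    finally show ?thesis using that by simp
  qed
  have "(THE g'. f * g' = 1) = g"
    by (rule the_equality) (rule assms, erule uniq)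
  moreover have "\<exists>g'. f * g' = 1" using assms by (rule exI)
  ultimately show ?thesis by (simp add: inverse_mfps_def)
qed

text \<open>
  The topology of coefficientwise convergence. With complex coefficients it gives a meaning to the
  infinite products \<open>(z; q)\<^sub>\<infinity>\<close>, whose coefficients are convergent series in \<open>q\<close>; formally convergent
  families (each monomial occurring in finitely many members) converge in it to their formal sum.
\<close>

instantiation mfps :: (type, topological_space) topological_space
begin

definition open_mfps :: "('a, 'b) mfps set \<Rightarrow> bool"
  where "open U \<longleftrightarrow> open (mfps_coeff ` U)"

instance
proof
  have inj: "inj mfps_coeff" by (simp add: inj_def mfps_coeff_inject)
  show "open (UNIV :: ('a, 'b) mfps set)" by (simp add: open_mfps_def surj_mfps_coeff)
  show "open (S \<inter> T)" if "open S" "open T" for S T :: "('a, 'b) mfps set"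
    using that by (simp add: open_mfps_def image_Int[OF inj] open_Int)
  show "open (\<Union>K)" if "\<forall>S\<in>K. open S" for K :: "('a, 'b) mfps set set"
    using that by (auto simp: open_mfps_def image_Union)
qed

end

lemma tendsto_mfps_iff:
  "(f \<longlongrightarrow> L) F \<longleftrightarrow> (\<forall>m. ((\<lambda>x. mfps_coeff (f x) m) \<longlongrightarrow> mfps_coeff L m) F)"
proof -
  have "(f \<longlongrightarrow> L) F \<longleftrightarrow> ((\<lambda>x. mfps_coeff (f x)) \<longlongrightarrow> mfps_coeff L) F"
  proof -
    have *: "mfps_coeff ` (mfps_coeff -` S) = S" for S :: "(('b \<Rightarrow>\<^sub>0 nat) \<Rightarrow> 'c) set"
      by (rule surj_image_vimage_eq[OF surj_mfps_coeff])
    have open_vim: "open (mfps_coeff -` S)" if "open S" for S :: "(('b \<Rightarrow>\<^sub>0 nat) \<Rightarrow> 'c) set"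
      using that by (simp only: open_mfps_def *)
    have mem: "mfps_coeff x \<in> mfps_coeff ` U \<longleftrightarrow> x \<in> U" for x :: "('b, 'c) mfps" and U
      by (auto simp: mfps_coeff_inject)
    show ?thesis
    proof
      assume L: "(f \<longlongrightarrow> L) F"
      show "((\<lambda>x. mfps_coeff (f x)) \<longlongrightarrow> mfps_coeff L) F"
      proof (rule topological_tendstoI)
        fix S assume "open S" "mfps_coeff L \<in> S"
        then have "eventually (\<lambda>x. f x \<in> mfps_coeff -` S) F"
          using topological_tendstoD[OF L open_vim] by simp
        then show "eventually (\<lambda>x. mfps_coeff (f x) \<in> S) F" by simp
      qed
    next
      assume L: "((\<lambda>x. mfps_coeff (f x)) \<longlongrightarrow> mfps_coeff L) F"
      show "(f \<longlongrightarrow> L) F"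
      proof (rule topological_tendstoI)
        fix U assume "open U" "L \<in> U"
        then have "eventually (\<lambda>x. mfps_coeff (f x) \<in> mfps_coeff ` U) F"
          using topological_tendstoD[OF L, of "mfps_coeff ` U"] by (simp add: open_mfps_def)
        then show "eventually (\<lambda>x. f x \<in> U) F" by (simp add: mem)
      qed
    qed
  qed
  also have "\<dots> \<longleftrightarrow> (\<forall>m. ((\<lambda>x. mfps_coeff (f x) m) \<longlongrightarrow> mfps_coeff L m) F)"
    using limitin_componentwise[of "\<lambda>_. euclidean" UNIV "\<lambda>x. mfps_coeff (f x)" "mfps_coeff L" F]
    by (simp add: euclidean_product_topology)
  finally show ?thesis .
qed

instance mfps :: (type, t2_space) t2_space
proof
  fix f g :: "('a, 'b) mfps"
  assume "f \<noteq> g"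
  then obtain m where "mfps_coeff f m \<noteq> mfps_coeff g m" using mfps_eqI by blast
  then obtain U V where UV: "open U" "open V" "mfps_coeff f m \<in> U" "mfps_coeff g m \<in> V" "U \<inter> V = {}"
    by (meson hausdorff)
  have op: "open ((\<lambda>h. mfps_coeff h m) -` W)" if "open W" for W :: "'b set"
  proof -
    have "mfps_coeff ` ((\<lambda>h :: ('a, 'b) mfps. mfps_coeff h m) -` W) = (\<lambda>c. c m) -` W"
      using surj_image_vimage_eq[OF surj_mfps_coeff, of "(\<lambda>c. c m) -` W"]
      by (simp add: vimage_def)
    then show ?thesis
      using open_vimage[OF that continuous_on_product_coordinates] by (simp add: open_mfps_def)
  qed
  show "\<exists>U V. open U \<and> open V \<and> f \<in> U \<and> g \<in> V \<and> U \<inter> V = {}"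
    by (rule exI[of _ "(\<lambda>h. mfps_coeff h m) -` U"], rule exI[of _ "(\<lambda>h. mfps_coeff h m) -` V"])
       (use UV op in auto)
qed

lift_definition mfps_const :: "'a \<Rightarrow> ('v, 'a :: zero) mfps" is "\<lambda>c m. if m = 0 then c else 0" .

lift_definition mfps_var :: "'v \<Rightarrow> ('v, 'a :: zero_neq_one) mfps"
  is "\<lambda>v m. if m = Poly_Mapping.single v 1 then 1 else 0" .


section \<open>The ratio variables\<close>

text \<open>\<open>XVar i\<close> stands for \<open>x\<^bsub>i+1\<^esub> / x\<^sub>i\<close>, and \<open>SVar i\<close> for \<open>s\<^bsub>i+1\<^esub> / s\<^sub>i\<close>.\<close>

datatype ratio_var = XVar nat | SVar nat

type_synonym series = "(ratio_var, complex) mfps"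

text \<open>
  Only the ratios \<open>z\<^sub>j / z\<^sub>i\<close> with \<open>i \<le> j\<close> of a vector \<open>z\<close> are formal power series. Accordingly a
  vector argument is represented by the function \<open>r\<close> sending \<open>i \<le> j\<close> to \<open>r i j = z\<^sub>j / z\<^sub>i\<close>.
\<close>

definition x_ratio :: "nat \<Rightarrow> nat \<Rightarrow> series"
  where "x_ratio i j = (\<Prod>a = i..<j. mfps_var (XVar a))"

definition s_ratio :: "nat \<Rightarrow> nat \<Rightarrow> series"
  where "s_ratio i j = (\<Prod>a = i..<j. mfps_var (SVar a))"

text \<open>
  For \<open>c \<in> (\<complex>\<^sup>*)\<^sup>n\<close> the point \<open>y = (c\<^sub>1 x\<^sub>1, \<dots>, c\<^sub>n x\<^sub>n)\<close>: the ratios \<open>y\<^sub>j / y\<^sub>i\<close>, \<open>x\<^sub>j / y\<^sub>i\<close>, \<open>y\<^sub>j / x\<^sub>i\<close>.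
\<close>

definition y_ratio :: "(nat \<Rightarrow> complex) \<Rightarrow> nat \<Rightarrow> nat \<Rightarrow> series"
  where "y_ratio c i j = mfps_const (c j / c i) * x_ratio i j"

definition x_over_y :: "(nat \<Rightarrow> complex) \<Rightarrow> nat \<Rightarrow> nat \<Rightarrow> series"
  where "x_over_y c j i = mfps_const (1 / c i) * x_ratio i j"

definition y_over_x :: "(nat \<Rightarrow> complex) \<Rightarrow> nat \<Rightarrow> nat \<Rightarrow> series"
  where "y_over_x c j i = mfps_const (c j) * x_ratio i j"


section \<open>The series \<open>\<phi>\<^sub>n\<close>\<close>

definition qpoch_inf :: "series \<Rightarrow> complex \<Rightarrow> series"
  where "qpoch_inf z q = prodinf (\<lambda>k. 1 - mfps_const (q ^ k) * z)"

text \<open>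
  \<open>(z; q)\<^sub>k\<close> as the finite product to which \<open>(z; q)\<^sub>\<infinity> / (q\<^sup>k z; q)\<^sub>\<infinity>\<close> reduces. The quotient itself is
  \<open>0 / 0\<close> for \<open>z = q\<^bsup>-k\<^esup>\<close>, which occurs in the denominators (\<open>i = j\<close>) of \<open>c\<^sub>n\<close>.
\<close>

definition qpoch :: "series \<Rightarrow> complex \<Rightarrow> nat \<Rightarrow> series"
  where "qpoch z q k = (\<Prod>i<k. 1 - mfps_const (q ^ i) * z)"

text \<open>\<open>M\<^sub>n\<close>, with matrices extended by zero outside the index range.\<close>

definition strict_upper :: "nat \<Rightarrow> (nat \<Rightarrow> nat \<Rightarrow> nat) set"
  where "strict_upper n = {\<theta>. \<forall>i j. \<not> (1 \<le> i \<and> i < j \<and> j \<le> n) \<longrightarrow> \<theta> i j = 0}"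

definition tail_diff :: "nat \<Rightarrow> (nat \<Rightarrow> nat \<Rightarrow> nat) \<Rightarrow> nat \<Rightarrow> nat \<Rightarrow> nat \<Rightarrow> int"
  where "tail_diff n \<theta> k i j = (\<Sum>a = k+1..n. int (\<theta> i a) - int (\<theta> j a))"

text \<open>\<open>c\<^sub>n(\<theta>; s | q, t)\<close>, where \<open>r i j = s\<^sub>j / s\<^sub>i\<close>.\<close>

definition c_coeff ::
    "complex \<Rightarrow> complex \<Rightarrow> nat \<Rightarrow> (nat \<Rightarrow> nat \<Rightarrow> nat) \<Rightarrow> (nat \<Rightarrow> nat \<Rightarrow> series) \<Rightarrow> series"
  where "c_coeff q t n \<theta> r =
    (\<Prod>k = 2..n. \<Prod>(i, j) \<in> {(i, j). 1 \<le> i \<and> i < j \<and> j \<le> k}.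
        qpoch (mfps_const (q powi tail_diff n \<theta> k i j * t) * r i j) q (\<theta> i k) /
        qpoch (mfps_const (q powi tail_diff n \<theta> k i j * q) * r i j) q (\<theta> i k)) *
    (\<Prod>k = 2..n. \<Prod>(i, j) \<in> {(i, j). 1 \<le> i \<and> i \<le> j \<and> j < k}.
        qpoch (mfps_const (q powi (- int (\<theta> j k) + tail_diff n \<theta> k i j) * q / t) * r i j) q (\<theta> i k) /
        qpoch (mfps_const (q powi (- int (\<theta> j k) + tail_diff n \<theta> k i j)) * r i j) q (\<theta> i k))"

text \<open>
  \<open>\<phi>\<^sub>n(x; s | q, t)\<close>, where \<open>xr i j = x\<^sub>j / x\<^sub>i\<close> and \<open>sr i j = s\<^sub>j / s\<^sub>i\<close>. Hence \<open>\<phi>\<^sub>n(s; x | q, t)\<close> is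
  \<open>phi n s_ratio x_ratio q t\<close>, and \<open>\<phi>\<^sub>n(s; y | q, t)\<close> at \<open>y\<^sub>i = c\<^sub>i x\<^sub>i\<close> is \<open>phi n s_ratio (y_ratio c) q t\<close>.
\<close>

definition phi ::
    "nat \<Rightarrow> (nat \<Rightarrow> nat \<Rightarrow> series) \<Rightarrow> (nat \<Rightarrow> nat \<Rightarrow> series) \<Rightarrow> complex \<Rightarrow> complex \<Rightarrow> series"
  where "phi n xr sr q t =
    (\<Prod>(i, j) \<in> {(i, j). 1 \<le> i \<and> i < j \<and> j \<le> n}.
        qpoch_inf (mfps_const q * sr i j) q / qpoch_inf (mfps_const (q / t) * sr i j) q) *
    infsum (\<lambda>\<theta>. c_coeff q t n \<theta> sr *
        (\<Prod>(i, j) \<in> {(i, j). 1 \<le> i \<and> i < j \<and> j \<le> n}. xr i j ^ \<theta> i j)) (strict_upper n)"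


section \<open>The kernel and the Jackson integral\<close>

text \<open>
  Write \<open>E\<^sub>i = \<lambda>\<^sub>i - \<lambda>\<^bsub>n+1\<^esub> + (n - i) \<beta>\<close>. With \<open>t = q\<^sup>\<beta>\<close> and \<open>s\<^sub>i = t\<^bsup>n+1-i\<^esup> q\<^bsup>\<lambda>\<^sub>i\<^esup>\<close> one has
  \<open>q\<^bsup>-E\<^sub>i\<^esup> = t s\<^bsub>n+1\<^esub> / s\<^sub>i\<close>, so that \<open>u\<^bsup>E\<^sub>i\<^esup>\<close> is the series \<open>(t s\<^bsub>n+1\<^esub> / s\<^sub>i)\<^sup>k\<close> at \<open>u = q\<^bsup>-k\<^esup>\<close>. The points
  \<open>y\<^sub>i = q\<^bsup>-k-1\<^esup> t x\<^sub>i\<close> of the Jackson integral are those where \<open>u = q y\<^sub>i / (t x\<^sub>i)\<close> has this form;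
  \<open>k\<close> is unique because \<open>0 < |q| < 1\<close>.
\<close>

definition lambda_power :: "complex \<Rightarrow> complex \<Rightarrow> nat \<Rightarrow> nat \<Rightarrow> complex \<Rightarrow> series"
  where "lambda_power q t n i u =
    (mfps_const t * s_ratio i (n + 1)) ^ (THE k :: nat. u = q powi (- int k))"

text \<open>
  \<open>K\<^sub>\<lambda>(x; y)\<close> at \<open>y\<^sub>i = c\<^sub>i x\<^sub>i\<close>. At \<open>c\<^sub>i = q\<^bsup>-\<nu>\<^sub>i-1\<^esup> t\<close> the denominators \<open>(x\<^sub>i / y\<^sub>i; q)\<^sub>\<infinity>\<close> are the constants
  \<open>(q\<^bsup>\<nu>\<^sub>i+1\<^esup> / t; q)\<^sub>\<infinity>\<close>; none of them vanishes for any \<open>\<nu>\<close> iff \<open>t\<close> is not one of \<open>q, q\<^sup>2, \<dots>\<close>.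
  All other denominators have constant term 1.
\<close>

definition K_kernel :: "complex \<Rightarrow> complex \<Rightarrow> nat \<Rightarrow> (nat \<Rightarrow> complex) \<Rightarrow> series"
  where "K_kernel q t n c =
    (\<Prod>i = 1..n. qpoch_inf (mfps_const t * x_over_y c i i) q / qpoch_inf (x_over_y c i i) q) *
    (\<Prod>(i, j) \<in> {(i, j). 1 \<le> i \<and> i < j \<and> j \<le> n + 1}.
        qpoch_inf (mfps_const t * x_over_y c j i) q / qpoch_inf (x_over_y c j i) q) *
    (\<Prod>(i, j) \<in> {(i, j). 1 \<le> i \<and> i < j \<and> j \<le> n}.
        qpoch_inf (mfps_const q * y_over_x c j i) q / qpoch_inf (mfps_const (q / t) * y_over_x c j i) q) *
    (\<Prod>(i, j) \<in> {(i, j). 1 \<le> i \<and> i < j \<and> j \<le> n}.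
        (qpoch_inf (y_ratio c i j) q / qpoch_inf (mfps_const t * y_ratio c i j) q) *
        (qpoch_inf (mfps_const (q / t) * y_ratio c i j) q / qpoch_inf (mfps_const q * y_ratio c i j) q)) *
    (\<Prod>i = 1..n. lambda_power q t n i (q * c i / t))"

text \<open>
  \<open>\<integral>\<^bsub>a\<^sub>1 x\<^sub>1\<^esub>\<^sup>\<infinity> \<cdots> \<integral>\<^bsub>a\<^sub>n x\<^sub>n\<^esub>\<^sup>\<infinity> f(y) d\<^sub>qy\<^sub>1/y\<^sub>1 \<cdots> d\<^sub>qy\<^sub>n/y\<^sub>n\<close> as the sum over \<open>\<nu> \<in> \<nat>\<^sup>n\<close> of the values at
  \<open>y\<^sub>i = q\<^bsup>-\<nu>\<^sub>i-1\<^esup> a\<^sub>i x\<^sub>i\<close>, where \<open>f c\<close> is the value of the integrand at \<open>y\<^sub>i = c\<^sub>i x\<^sub>i\<close>.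
\<close>

definition jackson_integral ::
    "complex \<Rightarrow> nat \<Rightarrow> (nat \<Rightarrow> complex) \<Rightarrow> ((nat \<Rightarrow> complex) \<Rightarrow> series) \<Rightarrow> series"
  where "jackson_integral q n a f =
    mfps_const (1 - q) ^ n *
    infsum (\<lambda>\<nu>. f (\<lambda>i. q powi (- int (\<nu> i) - 1) * a i)) {\<nu> :: nat \<Rightarrow> nat. \<forall>i. i \<notin> {1..n} \<longrightarrow> \<nu> i = 0}"

end

theory Submission
  imports Defs "HOL-Computational_Algebra.Polynomial_Factorial"
begin

text \<open>
  Writing \<open>f\<^sub>n(x; s | q, t)\<close> for the sum over \<open>\<theta>\<close> in \<open>\<phi>\<^sub>n\<close>, the last column of \<open>\<theta>\<close> gives
  \<open>f\<^bsub>n+1\<^esub>(x; s) = \<Sum>\<^sub>\<nu> d\<^sub>n(\<nu>; s) \<Prod>\<^sub>i (x\<^bsub>n+1\<^esub> / x\<^sub>i)\<^bsup>\<nu>\<^sub>i\<^esup> f\<^sub>n(x; q\<^bsup>-\<nu>\<^esup> s)\<close>. The Jackson integral is this recurrence with \<open>q / t\<close>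
  in place of \<open>t\<close>, so the theorem amounts to the symmetry
  \<open>f\<^sub>n(x; s | q, t) = \<Prod>\<^bsub>i<j\<^esub> (t x\<^sub>j / x\<^sub>i; q)\<^sub>\<infinity> / (q x\<^sub>j / t x\<^sub>i; q)\<^sub>\<infinity> f\<^sub>n(x; s | q, q / t)\<close>.

  By the recurrence and induction on \<open>n\<close>, \<open>f\<^sub>n\<close> satisfies a difference equation in the variables \<open>s\<close>,
  \<open>\<Sum>\<^sub>i x\<^sub>i \<Prod>\<^bsub>j<i\<^esub> b(s\<^sub>i / s\<^sub>j) f(s\<^sub>1, \<dots>, q s\<^sub>i, \<dots>, s\<^sub>n) = (\<Sum>\<^sub>i x\<^sub>i) f(s)\<close> with
  \<open>b(z) = (1 - t z) (1 - q z / t) / ((1 - z) (1 - q z))\<close>; the induction step is a partial fraction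
  identity. The equation is invariant under \<open>t \<leftrightarrow> q / t\<close>, and its solutions in power series are determined
  up to a factor free of \<open>s\<close>. That factor is found by letting all \<open>s\<^bsub>i+1\<^esub> / s\<^sub>i\<close> tend to zero, where
  \<open>f\<^sub>n\<close> becomes a product of \<open>q\<close>-binomial series.

  In \<open>\<phi>\<^bsub>n+1\<^esub>(s; x)\<close> the roles of \<open>x\<close> and \<open>s\<close> are exchanged: the difference equation shifts the \<open>x\<^sub>i\<close>.
\<close>

section \<open>The source identity\<close>

text \<open>The symmetry cannot be read off term by term: the product relating the two sums mixes
  the matrices \<theta>, whereas \<open>b\<close> is visibly unchanged when \<open>t\<close> and
  \<open>q / t\<close> are exchanged. This is why a difference equation is used. The dual parameter
  itself comes from the integral: there x_i / y_i = q^\<nu>_i q / t, so the quotients of infinite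
  products in the kernel collapse to the finite products of a last column with \<open>q / t\<close>
  for \<open>t\<close>. In the ratios y_j / y_i the factor t / q cancels, so they are the ratios of
  q^-\<nu> x, and one kernel quotient in y_j / y_i cancels the prefactor of \<phi>_n.

  The formal setting shapes the rest. Only ratios with i \<le> j are series, so shifting a variable
  is expressed through points c_i x_i with complex c_i. The partial fraction identity, however,
  needs genuine points and division. It is proved over an abstract field and applied in the field of
  fractions of the series ring, which therefore has to be an integral domain in spite of its
  infinitely many variables.\<close>

definition index_pairs :: "nat \<Rightarrow> (nat \<times> nat) set"
  where "index_pairs n = {(i, j). 1 \<le> i \<and> i < j \<and> j \<le> n}"

lemma finite_index_pairs [simp]: "finite (index_pairs n)"
  by (rule finite_subset[of _ "{1..n} \<times> {1..n}"]) (auto simp: index_pairs_def)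

text \<open>Each index other than \<open>k\<close> forms exactly one pair with \<open>k\<close>;
  this lets a factor attached to a single index be moved into the product over pairs.\<close>

lemma prod_index_pairs_through:
  fixes g :: "nat \<Rightarrow> 'a::comm_monoid_mult"
  assumes k: "k \<in> {1..n}"
  shows "(\<Prod>(i, j)\<in>index_pairs n. if i = k then g j else if j = k then g i else 1) =
    (\<Prod>j\<in>{1..n} - {k}. g j)"
proof -
  let ?h = "\<lambda>(i, j). if i = k then g j else if j = k then g i else 1"
  have "(\<Prod>p\<in>index_pairs n. ?h p) = (\<Prod>p\<in>{p \<in> index_pairs n. fst p = k \<or> snd p = k}. ?h p)"
    by (rule prod.mono_neutral_right) (auto split: if_splits)
  also have "\<dots> = (\<Prod>j\<in>{1..n} - {k}. g j)"
    by (rule prod.reindex_bij_witness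
        [of _ "\<lambda>j. if j < k then (j, k) else (k, j)" "\<lambda>(i, j). if i = k then j else i"])
       (use k in \<open>auto simp: index_pairs_def split: if_splits\<close>)
  finally show ?thesis by (simp add: case_prod_unfold)
qed

text \<open>Changing the variable \<open>k\<close> touches only the pairs through \<open>k\<close>.
  Pairs are ordered, so the two positions of \<open>k\<close> react differently; the extra factors
  \<open>b j\<close> for \<open>j < k\<close> make up for this, and what remains is one
  \<open>g j\<close> for every other index.\<close>

lemma prod_index_pairs_update:
  fixes f f' :: "nat \<Rightarrow> nat \<Rightarrow> 'a::comm_monoid_mult"
  assumes k: "k \<in> {1..n}"
    and other: "\<And>i j. 1 \<le> i \<Longrightarrow> i < j \<Longrightarrow> j \<le> n \<Longrightarrow> i \<noteq> k \<Longrightarrow> j \<noteq> k \<Longrightarrow> f' i j = f i j"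
    and after: "\<And>j. k < j \<Longrightarrow> j \<le> n \<Longrightarrow> f' k j = g j * f k j"
    and before: "\<And>j. 1 \<le> j \<Longrightarrow> j < k \<Longrightarrow> b j * f' j k = g j * f j k"
  shows "(\<Prod>j = 1..<k. b j) * (\<Prod>(i, j)\<in>index_pairs n. f' i j) =
    (\<Prod>j\<in>{1..n} - {k}. g j) * (\<Prod>(i, j)\<in>index_pairs n. f i j)"
proof -
  let ?b = "\<lambda>j. if j < k then b j else 1"
  have "(\<Prod>j = 1..<k. b j) = (\<Prod>j\<in>{1..n} - {k}. ?b j)"
    using k by (intro prod.mono_neutral_cong_left) auto
  also have "\<dots> = (\<Prod>(i, j)\<in>index_pairs n. if i = k then ?b j else if j = k then ?b i else 1)"
    by (rule prod_index_pairs_through[OF k, symmetric])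
  finally have "(\<Prod>j = 1..<k. b j) * (\<Prod>(i, j)\<in>index_pairs n. f' i j) =
      (\<Prod>p\<in>index_pairs n. (case p of (i, j) \<Rightarrow> if i = k then ?b j else if j = k then ?b i else 1) *
        (case p of (i, j) \<Rightarrow> f' i j))"
    by (simp add: prod.distrib)
  also have "\<dots> = (\<Prod>p\<in>index_pairs n. (case p of (i, j) \<Rightarrow> if i = k then g j else if j = k then g i else 1) *
        (case p of (i, j) \<Rightarrow> f i j))"
    by (rule prod.cong) (use other after before in \<open>auto simp: index_pairs_def\<close>)
  also have "\<dots> = (\<Prod>j\<in>{1..n} - {k}. g j) * (\<Prod>(i, j)\<in>index_pairs n. f i j)"
    by (simp only: prod.distrib prod_index_pairs_through[OF k])
  finally show ?thesis .
qed

section \<open>Partial fractions by interpolation\<close>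

lemma degree_prod_linear:
  assumes "finite A"
  shows "degree (\<Prod>b\<in>A. [:1, - v b:] :: 'a::field poly) \<le> card A"
proof -
  have "degree (\<Prod>b\<in>A. [:1, - v b:] :: 'a poly) \<le> (\<Sum>b\<in>A. 1)"
    by (intro order.trans[OF degree_prod_sum_le] assms sum_mono) simp
  then show ?thesis by simp
qed

lemma coeff_prod_linear:
  assumes "finite A"
  shows "Polynomial.coeff (\<Prod>b\<in>A. [:1, - v b:] :: 'a::field poly) (card A) = (\<Prod>b\<in>A. - v b)"
  using assms
proof (induction A)
  case (insert a A)
  then have "Polynomial.coeff (\<Prod>b\<in>A. [:1, - v b:]) (Suc (card A)) = 0"
    using degree_prod_linear[of A v] by (intro coeff_eq_0) simp
  with insert show ?case by simp
qed simp

text \<open>Lagrange interpolation at \<open>1 / u a\<close> of the difference of the two products, evaluated at zero.\<close>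

lemma partial_fractions_at_zero:
  fixes u v :: "'i \<Rightarrow> 'a::field"
  assumes fin: "finite A" and inj: "inj_on u A" and nz: "\<And>a. a \<in> A \<Longrightarrow> u a \<noteq> 0"
  shows "(\<Sum>a\<in>A. (1 - v a / u a) * (\<Prod>b\<in>A - {a}. (1 - v b / u a) / (1 - u b / u a))) =
    1 - (\<Prod>a\<in>A. v a / u a)"
proof (cases "A = {}")
  case False
  then have card_pos: "card A > 0" using fin by (simp add: card_gt_0_iff)
  \<comment> \<open>The scalar makes the coefficients of degree \<open>card A\<close> cancel, so
    \<open>p\<close> has degree below the number of nodes; at a node 1 / u a the subtracted product
    vanishes.\<close>
  define p where "p = (\<Prod>b\<in>A. [:1, - v b:]) - smult (\<Prod>a\<in>A. v a / u a) (\<Prod>b\<in>A. [:1, - u b:])"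
  define l where "l = (\<lambda>a. smult (poly p (1 / u a)) (\<Prod>b\<in>A - {a}. smult (1 / (1 - u b / u a)) [:1, - u b:]))"
  have p_eval: "poly p x = (\<Prod>b\<in>A. 1 - v b * x) - (\<Prod>a\<in>A. v a / u a) * (\<Prod>b\<in>A. 1 - u b * x)" for x
    by (simp add: p_def poly_prod mult.commute)
  have l_eval: "poly (l a) x = poly p (1 / u a) * (\<Prod>b\<in>A - {a}. (1 - u b * x) / (1 - u b / u a))" for a x
    by (simp add: l_def poly_prod mult.commute diff_divide_distrib right_diff_distrib)
  have sep: "1 - u b / u a \<noteq> 0" if "a \<in> A" "b \<in> A" "a \<noteq> b" for a b
    using that nz inj by (auto simp: inj_on_def)
  have val: "poly p (1 / u a) = (\<Prod>b\<in>A. 1 - v b / u a)" if "a \<in> A" for a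
  proof -
    have "(\<Prod>b\<in>A. 1 - u b * (1 / u a)) = 0"
      using that fin nz by (intro prod_zero) auto
    then show ?thesis by (simp add: p_eval)
  qed
  have deg_l: "degree (l a) < card A" if "a \<in> A" for a
  proof -
    have "degree (smult c [:1, d:]) \<le> 1" for c d :: 'a
      by (rule order.trans[OF degree_smult_le]) simp
    then have "degree (l a) \<le> (\<Sum>b\<in>A - {a}. 1)"
      unfolding l_def
      by (intro order.trans[OF degree_smult_le] order.trans[OF degree_prod_sum_le] sum_mono)
         (use fin in \<open>auto simp only: o_def finite_Diff\<close>)
    also have "\<dots> < card A" using card_Diff1_less[OF fin that] by simp
    finally show ?thesis .
  qed
  have deg_p: "degree p < card A"
  proof -
    have "Polynomial.coeff (\<Prod>b\<in>A. [:1, - v b:]) (card A) =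
        (\<Prod>a\<in>A. v a / u a) * Polynomial.coeff (\<Prod>b\<in>A. [:1, - u b:]) (card A)"
      using nz by (simp add: coeff_prod_linear[OF fin] flip: prod.distrib)
    then have "Polynomial.coeff p (card A) = 0" by (simp add: p_def)
    moreover have "degree p \<le> card A"
      unfolding p_def by (intro degree_diff_le order.trans[OF degree_smult_le] degree_prod_linear fin)
    moreover have "p = 0" if "degree p = card A"
      using that calculation(1) leading_coeff_0_iff by metis
    ultimately show ?thesis
      using card_pos by (cases "degree p = card A") auto
  qed
  have "p = (\<Sum>a\<in>A. l a)"
  proof (rule poly_eqI_degree[where A = "(\<lambda>a. 1 / u a) ` A"])
    have card: "card ((\<lambda>a. 1 / u a) ` A) = card A"
      using inj nz by (intro card_image) (auto simp: inj_on_def)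
    show "degree p < card ((\<lambda>a. 1 / u a) ` A)" using deg_p card by simp
    have "degree (\<Sum>a\<in>A. l a) \<le> card A - 1"
      using deg_l by (intro degree_sum_le fin) fastforce
    then show "degree (\<Sum>a\<in>A. l a) < card ((\<lambda>a. 1 / u a) ` A)"
      using card card_pos by simp
    fix x assume "x \<in> (\<lambda>a. 1 / u a) ` A"
    then obtain c where c: "c \<in> A" "x = 1 / u c" by auto
    have "poly (l a) x = (if a = c then poly p x else 0)" if "a \<in> A" for a
    proof (cases "a = c")
      case True
      have "(\<Prod>b\<in>A - {c}. (1 - u b * x) / (1 - u b / u c)) = 1"
        using c sep by (intro prod.neutral) auto
      then show ?thesis using True c by (simp add: l_eval)
    next
      case False
      then have "(\<Prod>b\<in>A - {a}. (1 - u b * x) / (1 - u b / u a)) = 0"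
        using c nz fin by (intro prod_zero) auto
      then show ?thesis using False c by (simp add: l_eval)
    qed
    then show "poly p x = poly (\<Sum>a\<in>A. l a) x"
      using c fin by (simp add: poly_sum)
  qed
  then have "poly p 0 = poly (\<Sum>a\<in>A. l a) 0" by (rule arg_cong)
  also have "\<dots> = (\<Sum>a\<in>A. (1 - v a / u a) * (\<Prod>b\<in>A - {a}. (1 - v b / u a) / (1 - u b / u a)))"
    unfolding poly_sum by (rule sum.cong) (simp_all add: l_eval val prod.remove[OF fin] prod_dividef)
  finally show ?thesis by (simp add: p_eval)
qed simp

section \<open>Finite q-shifted factorials and generic points of a field\<close>

definition fin_qpoch :: "'a::comm_ring_1 \<Rightarrow> 'a \<Rightarrow> nat \<Rightarrow> 'a"
  where "fin_qpoch q z k = (\<Prod>i<k. 1 - q ^ i * z)"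

lemma fin_qpoch_0 [simp]: "fin_qpoch q z 0 = 1"
  by (simp add: fin_qpoch_def)

lemma fin_qpoch_Suc: "fin_qpoch q z (Suc k) = fin_qpoch q z k * (1 - q ^ k * z)"
  by (simp add: fin_qpoch_def)

lemma fin_qpoch_Suc_shift: "fin_qpoch q z (Suc k) = (1 - z) * fin_qpoch q (q * z) k"
  by (simp add: fin_qpoch_def prod.lessThan_Suc_shift mult.assoc power_commutes del: prod.lessThan_Suc)
    (simp add: mult.left_commute)

lemma fin_qpoch_shift: "(1 - z) * fin_qpoch q (q * z) k = fin_qpoch q z k * (1 - q ^ k * z)"
  using fin_qpoch_Suc_shift[of q z k] fin_qpoch_Suc[of q z k] by simp

text \<open>An abstract field, because it is interpreted twice: by the complex numbers for the
  diagonal factors, and by the field of fractions of the series ring for everything that involves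
  the variables.\<close>

locale qt_field =
  fixes q t :: "'a::field"
  assumes q_nz: "q \<noteq> 0" and t_nz: "t \<noteq> 0"
    and q_not_root: "\<And>m::int. m \<noteq> 0 \<Longrightarrow> q powi m \<noteq> 1"
begin

abbreviation qp :: "'a \<Rightarrow> nat \<Rightarrow> 'a" where "qp \<equiv> fin_qpoch q"

text \<open>Genericity: no factor 1 - q^m z with integer m vanishes, so the denominators met below
  are non-zero and stay so under shifts by powers of \<open>q\<close>.\<close>

definition gen :: "'a \<Rightarrow> bool"
  where "gen z \<longleftrightarrow> z \<noteq> 0 \<and> (\<forall>m::int. q powi m * z \<noteq> 1)"

lemma genD: "gen z \<Longrightarrow> q powi m * z \<noteq> 1" "gen z \<Longrightarrow> z \<noteq> 0"
  by (auto simp: gen_def)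

lemma gen_powi: "gen z \<Longrightarrow> gen (q powi m * z)"
  unfolding gen_def using q_nz by (auto simp: power_int_add[symmetric] mult.assoc[symmetric])

lemma gen_power: "gen z \<Longrightarrow> gen (q ^ k * z)"
  using gen_powi[of z "int k"] by simp

lemma gen_mult_q: "gen z \<Longrightarrow> gen (q * z)"
  using gen_powi[of z 1] by simp

lemma gen_divide_q: "gen z \<Longrightarrow> gen (z / q)"
  using gen_powi[of z "-1"] by (simp add: power_int_minus field_simps)

lemma gen_inverse: "gen z \<Longrightarrow> gen (inverse z)"
  unfolding gen_def
proof safe
  fix m :: int
  assume z: "z \<noteq> 0" "\<forall>m. q powi m * z \<noteq> 1" and "q powi m * inverse z = 1"
  then have "q powi m = z" by (simp add: field_simps)
  then have "q powi (- m) * z = 1" using z q_nz by (auto simp: power_int_minus)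
  with z show False by blast
qed simp

lemma gen_neq_1: "gen z \<Longrightarrow> 1 - z \<noteq> 0"
  using genD(1)[of z 0] by auto

lemma gen_neq_one: "gen z \<Longrightarrow> z \<noteq> 1"
  using genD(1)[of z 0] by auto

lemma powi_neg_Suc: "q powi (- int (Suc b)) = q powi (- int b) / q"
proof -
  have "- int (Suc b) = - int b - 1" by simp
  then show ?thesis using q_nz by (simp only: power_int_diff power_int_1_right simp_thms)
qed

lemma qp_nz: "gen z \<Longrightarrow> qp z k \<noteq> 0"
  using genD(1)[of z "int _"] by (auto simp: fin_qpoch_def)

section \<open>Reaction of the factors of a column to shifts\<close>

definition bfac :: "'a \<Rightarrow> 'a"
  where "bfac z = ((1 - t * z) * (1 - q / t * z)) / ((1 - z) * (1 - q * z))"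

text \<open>With \<open>a\<close> = \<nu>_i, \<open>b\<close> = \<nu>_j and \<open>z\<close> = s_j /
  s_i, this is the share of a pair i < j \<le> n in the last column. A pair with j = n + 1 has only
  the first quotient (\<open>lastfac\<close>), a pair i = j only the second
  (\<open>diagfac\<close>).\<close>

definition pairfac :: "nat \<Rightarrow> nat \<Rightarrow> 'a \<Rightarrow> 'a"
  where "pairfac a b z = (qp (t * z) a / qp (q * z) a) *
    (qp (q powi (- int b) * q / t * z) a / qp (q powi (- int b) * z) a)"

definition lastfac :: "nat \<Rightarrow> 'a \<Rightarrow> 'a"
  where "lastfac a z = qp (t * z) a / qp (q * z) a"

definition diagfac :: "nat \<Rightarrow> 'a"
  where "diagfac a = qp (q powi (- int a) * q / t) a / qp (q powi (- int a)) a"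

text \<open>
  The zeros and poles of the rational function of \<open>z\<close> whose partial fraction expansion yields the source
  identity: \<open>s_fac z s\<^sub>j\<close> for \<open>j \<le> n + 1\<close> and \<open>sig_fac z \<sigma>\<^sub>j\<close> for \<open>j \<le> n\<close>, where \<open>\<sigma>\<^sub>j = q\<^bsup>-\<nu>\<^sub>j\<^esup> s\<^sub>j\<close>.
\<close>

definition s_fac :: "'a \<Rightarrow> 'a \<Rightarrow> 'a"
  where "s_fac z s = (1 - q * z / (t * s)) / (1 - z / s)"

definition sig_fac :: "'a \<Rightarrow> 'a \<Rightarrow> 'a"
  where "sig_fac z s = (1 - t * z / s) / (1 - q * z / s)"

text \<open>Here s_i and \<nu>_i rise together, i being the first index of the pair: both quotients
  gain one factor at the front. Passing to reciprocal arguments costs q / t in one and t / q in the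
  other, and these constants cancel.\<close>

lemma pairfac_shift_first:
  assumes "gen z"
  shows "pairfac (Suc a) b (z / q) =
    s_fac 1 z * sig_fac 1 (q powi (- int b) * z) * pairfac a b z"
proof -
  define w where "w = q powi (- int b) * z"
  have w: "gen w" using gen_powi[OF assms] by (simp add: w_def)
  have "w / q \<noteq> 1" "w \<noteq> 0" "z \<noteq> 1" "z \<noteq> 0"
    using w assms gen_neq_1[OF gen_divide_q[OF w]] gen_neq_1[OF assms] by (auto simp: gen_def)
  then have wq: "w \<noteq> q" by auto
  have "pairfac (Suc a) b (z / q) = (1 - t * z / q) / (1 - z) * ((1 - w / t) / (1 - w / q)) * pairfac a b z"
    using q_nz by (simp add: pairfac_def fin_qpoch_Suc_shift w_def mult_ac)
  also have "(1 - t * z / q) / (1 - z) * ((1 - w / t) / (1 - w / q)) = s_fac 1 z * sig_fac 1 w"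
    using \<open>w \<noteq> 0\<close> \<open>z \<noteq> 1\<close> \<open>z \<noteq> 0\<close> wq q_nz t_nz unfolding s_fac_def sig_fac_def
    by (simp add: divide_simps) algebra
  finally show ?thesis by (simp add: w_def)
qed

lemma lastfac_shift_second:
  assumes "gen z"
  shows "bfac z * lastfac a (q * z) = s_fac z 1 * sig_fac (q ^ a * z) 1 * lastfac a z"
proof -
  have nz: "qp (q * z) a \<noteq> 0" "qp (q * (q * z)) a \<noteq> 0" "1 - q * z \<noteq> 0" "1 - q * (q ^ a * z) \<noteq> 0" "1 - z \<noteq> 0"
    using assms by (auto intro!: qp_nz gen_neq_1 gen_mult_q gen_power simp del: right_minus_eq)
  have s1: "(1 - t * z) * qp (t * (q * z)) a = qp (t * z) a * (1 - t * (q ^ a * z))"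
    using fin_qpoch_shift[of "t * z" q a] by (simp add: mult_ac)
  have s2: "(1 - q * z) * qp (q * (q * z)) a = qp (q * z) a * (1 - q * (q ^ a * z))"
    using fin_qpoch_shift[of "q * z" q a] by (simp add: mult_ac)
  have "bfac z * lastfac a (q * z) =
      (1 - q / t * z) / (1 - z) * (((1 - t * z) * qp (t * (q * z)) a) / ((1 - q * z) * qp (q * (q * z)) a))"
    by (simp add: bfac_def lastfac_def mult_ac)
  also have "\<dots> = s_fac z 1 * sig_fac (q ^ a * z) 1 * lastfac a z"
    unfolding s1 s2 by (simp add: s_fac_def sig_fac_def lastfac_def mult_ac)
  finally show ?thesis .
qed

text \<open>Now the second index is shifted: \<open>q * z\<close> together with \<open>Suc b\<close>
  leaves q^-b z unchanged, hence the second quotient too, and only the first one needs the help of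
  \<open>bfac\<close>.\<close>

lemma pairfac_shift_second:
  assumes "gen z"
  shows "bfac z * pairfac a (Suc b) (q * z) = s_fac z 1 * sig_fac (q ^ a * z) 1 * pairfac a b z"
proof -
  have e: "q powi (- int (Suc b)) * (q * z) = q powi (- int b) * z"
    "q powi (- int (Suc b)) * q / t * (q * z) = q powi (- int b) * q / t * z"
    using q_nz unfolding powi_neg_Suc by simp_all
  show ?thesis
    unfolding pairfac_def e lastfac_def[symmetric]
    using lastfac_shift_second[OF assms, of a] by (simp add: mult.assoc[symmetric])
qed

lemma pairfac_Suc_first:
  assumes "gen z"
  shows "pairfac (Suc a) b z = s_fac 1 (q * (q ^ a * z)) * sig_fac 1 (q * (q ^ a * (q powi (- int b) * z))) * pairfac a b z"
proof -
  define y w where "y = q ^ a * z" and "w = q ^ a * (q powi (- int b) * z)"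
  have g: "gen y" "gen w" "gen (q * y)" using assms by (auto simp: y_def w_def intro!: gen_power gen_powi gen_mult_q)
  have nz: "y \<noteq> 0" "w \<noteq> 0" "q * y \<noteq> 1" "w \<noteq> 1"
    using g by (simp_all add: genD gen_neq_one)
  have "pairfac (Suc a) b z = (1 - t * y) / (1 - q * y) * ((1 - q / t * w) / (1 - w)) * pairfac a b z"
    by (simp add: pairfac_def fin_qpoch_Suc y_def w_def mult_ac)
  also have "(1 - t * y) / (1 - q * y) * ((1 - q / t * w) / (1 - w)) = s_fac 1 (q * y) * sig_fac 1 (q * w)"
    using nz q_nz t_nz unfolding s_fac_def sig_fac_def by (simp add: divide_simps) algebra
  finally show ?thesis by (simp add: y_def w_def)
qed

text \<open>Only \<nu>_j rises, so the first quotient is untouched. The argument q^a u is a ratio of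
  shifted points, which is where \<open>bprod\<close> evaluates \<open>bfac\<close> after the
  shift.\<close>

lemma pairfac_Suc_second:
  assumes "gen z" and u: "u = q powi (- int (Suc b)) * z"
  shows "bfac (q ^ a * u) * pairfac a (Suc b) z = s_fac u 1 * sig_fac (q ^ a * u) 1 * pairfac a b z"
proof -
  have g: "gen u" using assms by (auto intro: gen_powi)
  have nz: "1 - u \<noteq> 0" "qp u a \<noteq> 0" "qp (q * u) a \<noteq> 0" "1 - q ^ a * u \<noteq> 0" "1 - q * (q ^ a * u) \<noteq> 0"
    using g by (auto intro!: qp_nz gen_neq_1 gen_mult_q gen_power simp del: right_minus_eq)
  have e: "q powi (- int b) * z = q * u" "q powi (- int b) * q / t * z = q * (q / t * u)"
     "q powi (- int (Suc b)) * q / t * z = q / t * u"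
    using q_nz unfolding u powi_neg_Suc by simp_all
  have s1: "(1 - q / t * u) * qp (q * (q / t * u)) a = qp (q / t * u) a * (1 - q / t * (q ^ a * u))"
    using fin_qpoch_shift[of "q / t * u" q a] by (simp add: mult_ac)
  have s2: "(1 - u) * qp (q * u) a = qp u a * (1 - q ^ a * u)"
    using fin_qpoch_shift[of "u" q a] by (simp add: mult_ac)
  have "bfac (q ^ a * u) * (qp (q / t * u) a / qp u a) =
    (1 - t * (q ^ a * u)) / (1 - q * (q ^ a * u)) * ((qp (q / t * u) a * (1 - q / t * (q ^ a * u))) / (qp u a * (1 - q ^ a * u)))"
    by (simp add: bfac_def mult_ac)
  also have "\<dots> = s_fac u 1 * sig_fac (q ^ a * u) 1 * (qp (q * (q / t * u)) a / qp (q * u) a)"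
    unfolding s1[symmetric] s2[symmetric] by (simp add: s_fac_def sig_fac_def mult_ac)
  finally have "bfac (q ^ a * u) * (qp (q / t * u) a / qp u a) =
    s_fac u 1 * sig_fac (q ^ a * u) 1 * (qp (q * (q / t * u)) a / qp (q * u) a)" .
  from arg_cong[OF this, of "\<lambda>x. (qp (t * z) a / qp (q * z) a) * x"] show ?thesis
    unfolding pairfac_def e u[symmetric] by (simp only: mult_ac)
qed

text \<open>For b = 0 the pair factor is the product of \<open>bfac (q ^ i * z)\<close> over i < a,
  so the identity exchanges one end of that product for the other.\<close>

lemma pairfac_zero_second:
  assumes "gen z"
  shows "bfac z * pairfac a 0 (q * z) = pairfac a 0 z * bfac (q ^ a * z)"
proof -
  have nz: "1 - z \<noteq> 0" "qp z a \<noteq> 0" "qp (q * z) a \<noteq> 0" "qp (q * (q * z)) a \<noteq> 0" "1 - q ^ a * z \<noteq> 0" "1 - q * (q ^ a * z) \<noteq> 0" "1 - q * z \<noteq> 0"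
    using assms by (auto intro!: qp_nz gen_neq_1 gen_mult_q gen_power simp del: right_minus_eq)
  have "bfac z * pairfac a 0 (q * z) = ((1 - t * z) * qp (q * (t * z)) a) * ((1 - q / t * z) * qp (q * (q / t * z)) a) /
     (((1 - z) * qp (q * z) a) * ((1 - q * z) * qp (q * (q * z)) a))"
    by (simp add: pairfac_def bfac_def mult_ac)
  also have "\<dots> = pairfac a 0 z * bfac (q ^ a * z)"
    unfolding fin_qpoch_shift by (simp add: pairfac_def bfac_def mult_ac)
  finally show ?thesis .
qed

text \<open>With a single quotient the constant from inverting the argument survives; it meets its
  inverse in the second form of \<open>diagfac_Suc\<close>.\<close>

lemma lastfac_shift_first:
  assumes "gen z"
  shows "lastfac (Suc a) (z / q) = t / q * s_fac 1 z * lastfac a z"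
proof -
  have "1 - z \<noteq> 0" "z \<noteq> 0" using assms gen_neq_1 by (auto simp: gen_def)
  then have "t / q * s_fac 1 z = (1 - t * z / q) / (1 - z)"
    unfolding s_fac_def using q_nz t_nz by (simp add: divide_simps) algebra
  then show ?thesis using q_nz by (simp add: lastfac_def fin_qpoch_Suc_shift mult_ac)
qed

lemma lastfac_Suc:
  assumes "gen z"
  shows "lastfac (Suc a) z = t / q * s_fac 1 (q * (q ^ a * z)) * lastfac a z"
proof -
  define y where "y = q ^ a * z"
  have g: "gen y" "gen (q * y)" using assms by (auto simp: y_def intro!: gen_power gen_mult_q)
  have nz: "y \<noteq> 0" "q * y \<noteq> 1" using g by (simp_all add: genD gen_neq_one)
  then have "t / q * s_fac 1 (q * y) = (1 - t * y) / (1 - q * y)"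
    unfolding s_fac_def using q_nz t_nz by (simp add: divide_simps) algebra
  then show ?thesis by (simp add: lastfac_def fin_qpoch_Suc y_def mult_ac)
qed

text \<open>Two expressions for one factor: the first suits the pole \<sigma>_i / q, the second the
  pole s_i. They agree because q^-a q^a = 1.\<close>

lemma diagfac_Suc:
  "diagfac (Suc a) = s_fac (q powi (- int a) / q) 1 * diagfac a"
  "diagfac (Suc a) = q / t * sig_fac (q ^ a) 1 * diagfac a"
proof -
  define w where "w = q powi (- int a)"
  have w: "w * q ^ a = 1" "w \<noteq> 0" using q_nz by (simp_all add: w_def power_int_minus)
  have "w / q \<noteq> 1"
    using q_not_root[of "- int a - 1"] q_nz by (simp add: w_def power_int_diff)
  then have wq: "w \<noteq> q" using q_nz by auto
  have w': "q powi (- int (Suc a)) = w / q" unfolding w_def by (rule powi_neg_Suc)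
  have e: "diagfac (Suc a) = (1 - w / t) / (1 - w / q) * diagfac a"
    using q_nz unfolding diagfac_def w' by (simp add: fin_qpoch_Suc_shift mult.commute[of w] flip: w_def)
  show "diagfac (Suc a) = s_fac (q powi (- int a) / q) 1 * diagfac a"
    unfolding e using q_nz by (simp add: s_fac_def mult.commute[of t q] flip: w_def)
  have "q * q ^ a \<noteq> 1"
    using q_not_root[of "int (Suc a)"] unfolding power_int_of_nat by simp
  moreover have key: "(t - w) * (1 - q * q ^ a) = (1 - t * q ^ a) * (q - w)"
  proof -
    have "(t - w) * (1 - q * q ^ a) - (1 - t * q ^ a) * (q - w) = (t - q) * (1 - w * q ^ a)"
      by (simp add: algebra_simps)
    then show ?thesis using w by simp
  qed
  ultimately have "(1 - w / t) / (1 - w / q) = q / t * sig_fac (q ^ a) 1"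
    unfolding sig_fac_def using wq w q_nz t_nz key by (simp add: divide_simps)
  then show "diagfac (Suc a) = q / t * sig_fac (q ^ a) 1 * diagfac a" unfolding e by simp
qed

text \<open>
  The factor of \<open>c\<^bsub>n+1\<^esub>(\<theta>; s)\<close> with \<open>k = n + 1\<close> and \<open>\<nu>\<^sub>i = \<theta>\<^bsub>i,n+1\<^esub>\<close>, at a point \<open>s\<close> of a field.
\<close>

definition step_fac :: "nat \<Rightarrow> (nat \<Rightarrow> nat) \<Rightarrow> (nat \<Rightarrow> 'a) \<Rightarrow> 'a"
  where "step_fac n \<nu> s = (\<Prod>i = 1..n. diagfac (\<nu> i) * lastfac (\<nu> i) (s (Suc n) / s i)) *
    (\<Prod>(i, j)\<in>index_pairs n. pairfac (\<nu> i) (\<nu> j) (s j / s i))"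

definition bprod :: "(nat \<Rightarrow> 'a) \<Rightarrow> nat \<Rightarrow> 'a"
  where "bprod s i = (\<Prod>j = 1..<i. bfac (s i / s j))"

definition shifted :: "(nat \<Rightarrow> nat) \<Rightarrow> (nat \<Rightarrow> 'a) \<Rightarrow> nat \<Rightarrow> 'a"
  where "shifted \<nu> s j = q powi (- int (\<nu> j)) * s j"

lemma s_fac_scale: "c \<noteq> 0 \<Longrightarrow> s_fac (c * z) (c * s) = s_fac z s"
  and sig_fac_scale: "c \<noteq> 0 \<Longrightarrow> sig_fac (c * z) (c * s) = sig_fac z s"
  by (simp_all add: s_fac_def sig_fac_def mult.left_commute)

lemma s_fac_ratio: "s \<noteq> 0 \<Longrightarrow> s_fac (z / s) 1 = s_fac z s" "z \<noteq> 0 \<Longrightarrow> s_fac 1 (s / z) = s_fac z s"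
  using s_fac_scale[of s "z / s" 1] s_fac_scale[of z 1 "s / z"] by simp_all

lemma sig_fac_ratio: "s \<noteq> 0 \<Longrightarrow> sig_fac (z / s) 1 = sig_fac z s" "z \<noteq> 0 \<Longrightarrow> sig_fac 1 (s / z) = sig_fac z s"
  using sig_fac_scale[of s "z / s" 1] sig_fac_scale[of z 1 "s / z"] by simp_all

lemma s_fac_cong: "z / s = z' / s' \<Longrightarrow> s_fac z s = s_fac z' s'"
  and sig_fac_cong: "z / s = z' / s' \<Longrightarrow> sig_fac z s = sig_fac z' s'"
proof -
  have "s_fac z s = (1 - q / t * (z / s)) / (1 - z / s)" "sig_fac z s = (1 - t * (z / s)) / (1 - q * (z / s))" for z s
    by (simp_all add: s_fac_def sig_fac_def)
  then show "z / s = z' / s' \<Longrightarrow> s_fac z s = s_fac z' s'" "z / s = z' / s' \<Longrightarrow> sig_fac z s = sig_fac z' s'"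
    by (simp_all only:)
qed

lemma sig_fac_shift: "sig_fac z (q powi (- int a) * s) = sig_fac (q ^ a * z) s"
  by (rule sig_fac_cong) (use q_nz in \<open>simp add: power_int_minus field_simps\<close>)

lemma ratio_shifted: "q ^ \<nu> j * (z / s j) = z / shifted \<nu> s j"
    "q powi (- int (\<nu> j)) * (s j / z) = shifted \<nu> s j / z"
  using q_nz by (simp_all add: shifted_def power_int_minus divide_simps)

section \<open>The residues and their sum\<close>

context
  fixes n :: nat and s :: "nat \<Rightarrow> 'a" and \<nu> :: "nat \<Rightarrow> nat"
  assumes s_nz: "\<And>i. i \<in> {1..Suc n} \<Longrightarrow> s i \<noteq> 0"
    and s_gen: "\<And>i j. i \<in> {1..Suc n} \<Longrightarrow> j \<in> {1..Suc n} \<Longrightarrow> i \<noteq> j \<Longrightarrow> gen (s i / s j)"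
begin

abbreviation \<sigma> :: "nat \<Rightarrow> 'a" where "\<sigma> \<equiv> shifted \<nu> s"

lemma \<sigma>_nz: "i \<in> {1..Suc n} \<Longrightarrow> \<sigma> i \<noteq> 0"
  using s_nz q_nz by (simp add: shifted_def)

text \<open>Up to a constant common to all i, the last factor is the residue at z = s_i, with
  respect to dz / z, of the product of all \<open>s_fac z (s j)\<close> and
  \<open>sig_fac z (\<sigma> j)\<close>.\<close>

lemma bprod_step_fac_shift:
  assumes i: "i \<in> {1..n}"
  shows "bprod s i * step_fac n (\<nu>(i := Suc (\<nu> i))) (s(i := q * s i)) =
    step_fac n \<nu> s * ((\<Prod>j\<in>{1..Suc n} - {i}. s_fac (s i) (s j)) * (\<Prod>j\<in>{1..n}. sig_fac (s i) (\<sigma> j)))"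
proof -
  let ?\<nu> = "\<nu>(i := Suc (\<nu> i))" and ?s = "s(i := q * s i)"
  have nz: "s j \<noteq> 0" "\<sigma> j \<noteq> 0" if "j \<in> {1..Suc n}" for j
    using s_nz[OF that] \<sigma>_nz[OF that] by auto
  have pairs: "bprod s i * (\<Prod>(i, j)\<in>index_pairs n. pairfac (?\<nu> i) (?\<nu> j) (?s j / ?s i)) =
    (\<Prod>j\<in>{1..n} - {i}. s_fac (s i) (s j) * sig_fac (s i) (\<sigma> j)) *
    (\<Prod>(i, j)\<in>index_pairs n. pairfac (\<nu> i) (\<nu> j) (s j / s i))"
    unfolding bprod_def
  proof (rule prod_index_pairs_update[OF i])
    fix j assume "i < j" "j \<le> n"
    then show "pairfac (?\<nu> i) (?\<nu> j) (?s j / ?s i) = s_fac (s i) (s j) * sig_fac (s i) (\<sigma> j) * pairfac (\<nu> i) (\<nu> j) (s j / s i)"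
      using i pairfac_shift_first[OF s_gen[of j i], of "\<nu> i" "\<nu> j"] nz[of i]
      by (simp add: shifted_def sig_fac_shift s_fac_ratio sig_fac_ratio mult.commute[of q])
  next
    fix j assume "1 \<le> j" "j < i"
    then show "bfac (s i / s j) * pairfac (?\<nu> j) (?\<nu> i) (?s i / ?s j) = s_fac (s i) (s j) * sig_fac (s i) (\<sigma> j) * pairfac (\<nu> j) (\<nu> i) (s i / s j)"
      using i pairfac_shift_second[OF s_gen[of i j], of "\<nu> j" "\<nu> i"] nz[of j]
      by (simp add: shifted_def sig_fac_shift s_fac_ratio sig_fac_ratio)
  qed auto
  have "diagfac (?\<nu> i) * lastfac (?\<nu> i) (?s (Suc n) / ?s i) =
      (q / t * sig_fac (q ^ \<nu> i) 1) * (t / q * s_fac 1 (s (Suc n) / s i)) * (diagfac (\<nu> i) * lastfac (\<nu> i) (s (Suc n) / s i))"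
    using i lastfac_shift_first[OF s_gen[of "Suc n" i], of "\<nu> i"]
    by (simp add: diagfac_Suc(2) mult.commute[of q] del: sig_fac_def)
  also have "(q / t * sig_fac (q ^ \<nu> i) 1) * (t / q * s_fac 1 (s (Suc n) / s i)) = s_fac (s i) (s (Suc n)) * sig_fac (s i) (\<sigma> i)"
    using i nz[of i] q_nz t_nz ratio_shifted(1)[of \<nu> i "s i" s] by (simp add: s_fac_ratio sig_fac_ratio)
  finally have at_i: "diagfac (?\<nu> i) * lastfac (?\<nu> i) (?s (Suc n) / ?s i) =
    s_fac (s i) (s (Suc n)) * sig_fac (s i) (\<sigma> i) * (diagfac (\<nu> i) * lastfac (\<nu> i) (s (Suc n) / s i))" .
  have rest: "(\<Prod>j\<in>{1..n} - {i}. diagfac (?\<nu> j) * lastfac (?\<nu> j) (?s (Suc n) / ?s j)) =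
    (\<Prod>j\<in>{1..n} - {i}. diagfac (\<nu> j) * lastfac (\<nu> j) (s (Suc n) / s j))"
    using i by (intro prod.cong) auto
  have single: "(\<Prod>j = 1..n. diagfac (?\<nu> j) * lastfac (?\<nu> j) (?s (Suc n) / ?s j)) =
    s_fac (s i) (s (Suc n)) * sig_fac (s i) (\<sigma> i) * (\<Prod>j = 1..n. diagfac (\<nu> j) * lastfac (\<nu> j) (s (Suc n) / s j))"
    unfolding prod.remove[OF finite_atLeastAtMost i] at_i rest by (simp only: mult.assoc)
  have split1: "(\<Prod>j\<in>{1..Suc n} - {i}. s_fac (s i) (s j)) = s_fac (s i) (s (Suc n)) * (\<Prod>j\<in>{1..n} - {i}. s_fac (s i) (s j))"
  proof -
    have "{1..Suc n} - {i} = insert (Suc n) ({1..n} - {i})" using i by auto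
    then show ?thesis by simp
  qed
  have split2: "(\<Prod>j\<in>{1..n}. sig_fac (s i) (\<sigma> j)) = sig_fac (s i) (\<sigma> i) * (\<Prod>j\<in>{1..n} - {i}. sig_fac (s i) (\<sigma> j))"
    by (rule prod.remove[OF finite_atLeastAtMost i])
  have "bprod s i * step_fac n ?\<nu> ?s = (\<Prod>j = 1..n. diagfac (?\<nu> j) * lastfac (?\<nu> j) (?s (Suc n) / ?s j)) *
      (bprod s i * (\<Prod>(i, j)\<in>index_pairs n. pairfac (?\<nu> i) (?\<nu> j) (?s j / ?s i)))"
    unfolding step_fac_def by (simp only: mult_ac)
  then show ?thesis
    unfolding pairs single split1 split2 step_fac_def by (simp only: prod.distrib mult_ac)
qed

lemma bprod_step_fac_shift_last:
  "bprod s (Suc n) * step_fac n \<nu> (s(Suc n := q * s (Suc n))) =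
    step_fac n \<nu> s * ((\<Prod>j\<in>{1..Suc n} - {Suc n}. s_fac (s (Suc n)) (s j)) * (\<Prod>j\<in>{1..n}. sig_fac (s (Suc n)) (\<sigma> j)))"
proof -
  let ?s = "s(Suc n := q * s (Suc n))"
  have "bprod s (Suc n) * (\<Prod>j = 1..n. diagfac (\<nu> j) * lastfac (\<nu> j) (?s (Suc n) / ?s j)) =
      (\<Prod>j = 1..n. bfac (s (Suc n) / s j) * (diagfac (\<nu> j) * lastfac (\<nu> j) (?s (Suc n) / ?s j)))"
    by (simp add: bprod_def prod.distrib atLeastLessThanSuc_atLeastAtMost)
  also have "\<dots> = (\<Prod>j = 1..n. s_fac (s (Suc n)) (s j) * sig_fac (s (Suc n)) (\<sigma> j) * (diagfac (\<nu> j) * lastfac (\<nu> j) (s (Suc n) / s j)))"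
  proof (rule prod.cong)
    fix j assume j: "j \<in> {1..n}"
    then show "bfac (s (Suc n) / s j) * (diagfac (\<nu> j) * lastfac (\<nu> j) (?s (Suc n) / ?s j)) =
      s_fac (s (Suc n)) (s j) * sig_fac (s (Suc n)) (\<sigma> j) * (diagfac (\<nu> j) * lastfac (\<nu> j) (s (Suc n) / s j))"
      using lastfac_shift_second[OF s_gen[of "Suc n" j], of "\<nu> j"] s_nz[of j] \<sigma>_nz[of j]
      by (simp add: shifted_def sig_fac_shift s_fac_ratio sig_fac_ratio mult.left_commute[of "bfac _"] mult.left_commute[of "diagfac _"])
  qed simp
  finally have 1: "bprod s (Suc n) * (\<Prod>j = 1..n. diagfac (\<nu> j) * lastfac (\<nu> j) (?s (Suc n) / ?s j)) =
    (\<Prod>j = 1..n. s_fac (s (Suc n)) (s j)) * (\<Prod>j = 1..n. sig_fac (s (Suc n)) (\<sigma> j)) * (\<Prod>j = 1..n. diagfac (\<nu> j) * lastfac (\<nu> j) (s (Suc n) / s j))"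
    by (simp add: prod.distrib)
  have 2: "(\<Prod>(i, j)\<in>index_pairs n. pairfac (\<nu> i) (\<nu> j) (?s j / ?s i)) = (\<Prod>(i, j)\<in>index_pairs n. pairfac (\<nu> i) (\<nu> j) (s j / s i))"
    by (rule prod.cong) (auto simp: index_pairs_def)
  have 3: "{1..Suc n} - {Suc n} = {1..n}" by auto
  have "bprod s (Suc n) * step_fac n \<nu> ?s =
      (bprod s (Suc n) * (\<Prod>j = 1..n. diagfac (\<nu> j) * lastfac (\<nu> j) (?s (Suc n) / ?s j))) *
      (\<Prod>(i, j)\<in>index_pairs n. pairfac (\<nu> i) (\<nu> j) (?s j / ?s i))"
    unfolding step_fac_def by (simp only: mult_ac)
  then show ?thesis unfolding 1 2 3 step_fac_def by (simp only: mult_ac)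
qed

text \<open>This is the residue at the pole z = \<sigma>_i / q. There the numerator is 1 - t / q =
  -(t / q) (1 - q / t), which explains both the factor t / q and the minus sign in the source
  identity.\<close>

lemma step_fac_bprod_shifted:
  assumes i: "i \<in> {1..n}"
  shows "step_fac n (\<nu>(i := Suc (\<nu> i))) s * bprod (shifted (\<nu>(i := Suc (\<nu> i))) s) i =
    step_fac n \<nu> s * (t / q * ((\<Prod>j\<in>{1..Suc n}. s_fac (\<sigma> i / q) (s j)) * (\<Prod>j\<in>{1..n} - {i}. sig_fac (\<sigma> i / q) (\<sigma> j))))"
proof -
  let ?\<nu> = "\<nu>(i := Suc (\<nu> i))" and ?z = "\<sigma> i / q"
  have nz: "s j \<noteq> 0" "\<sigma> j \<noteq> 0" if "j \<in> {1..Suc n}" for j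
    using s_nz[OF that] \<sigma>_nz[OF that] by auto
  have new: "shifted ?\<nu> s i = ?z" by (simp only: shifted_def fun_upd_same powi_neg_Suc) simp
  have old: "shifted ?\<nu> s j = \<sigma> j" if "j \<noteq> i" for j using that by (simp add: shifted_def)
  have "bprod (shifted ?\<nu> s) i = (\<Prod>j = 1..<i. bfac (?z / \<sigma> j))"
    unfolding bprod_def new by (rule prod.cong) (auto simp: old)
  then have "bprod (shifted ?\<nu> s) i * (\<Prod>(i, j)\<in>index_pairs n. pairfac (?\<nu> i) (?\<nu> j) (s j / s i)) =
    (\<Prod>j = 1..<i. bfac (?z / \<sigma> j)) * (\<Prod>(i, j)\<in>index_pairs n. pairfac (?\<nu> i) (?\<nu> j) (s j / s i))"
    by simp
  also have "\<dots> = (\<Prod>j\<in>{1..n} - {i}. s_fac ?z (s j) * sig_fac ?z (\<sigma> j)) *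
    (\<Prod>(i, j)\<in>index_pairs n. pairfac (\<nu> i) (\<nu> j) (s j / s i))"
  proof (rule prod_index_pairs_update[OF i])
    fix j assume j: "i < j" "j \<le> n"
    have "s_fac 1 (q * (q ^ \<nu> i * (s j / s i))) = s_fac ?z (s j)"
      by (rule s_fac_cong) (use i j nz q_nz in \<open>simp add: shifted_def power_int_minus field_simps\<close>)
    moreover have "sig_fac 1 (q * (q ^ \<nu> i * (q powi (- int (\<nu> j)) * (s j / s i)))) = sig_fac ?z (\<sigma> j)"
      by (rule sig_fac_cong) (use i j nz q_nz in \<open>simp add: shifted_def power_int_minus field_simps\<close>)
    ultimately show "pairfac (?\<nu> i) (?\<nu> j) (s j / s i) = s_fac ?z (s j) * sig_fac ?z (\<sigma> j) * pairfac (\<nu> i) (\<nu> j) (s j / s i)"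
      using i j pairfac_Suc_first[OF s_gen[of j i], of "\<nu> i" "\<nu> j"] by simp
  next
    fix j assume j: "1 \<le> j" "j < i"
    define u where "u = q powi (- int (Suc (\<nu> i))) * (s i / s j)"
    have "q ^ \<nu> j * u = ?z / \<sigma> j" "u = ?z / s j"
      unfolding u_def powi_neg_Suc using i j nz q_nz by (simp_all add: shifted_def power_int_minus field_simps)
    moreover have "s_fac ?z (s j) = s_fac (?z / s j) 1" "sig_fac ?z (\<sigma> j) = sig_fac (?z / \<sigma> j) 1"
      by (rule s_fac_ratio(1)[symmetric] sig_fac_ratio(1)[symmetric], use i j nz in simp)+
    ultimately show "bfac (?z / \<sigma> j) * pairfac (?\<nu> j) (?\<nu> i) (s i / s j) = s_fac ?z (s j) * sig_fac ?z (\<sigma> j) * pairfac (\<nu> j) (\<nu> i) (s i / s j)"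
      using i j pairfac_Suc_second[OF s_gen[of i j] u_def, of "\<nu> j"] by simp
  qed auto
  finally have pairs: "bprod (shifted ?\<nu> s) i * (\<Prod>(i, j)\<in>index_pairs n. pairfac (?\<nu> i) (?\<nu> j) (s j / s i)) =
    (\<Prod>j\<in>{1..n} - {i}. s_fac ?z (s j) * sig_fac ?z (\<sigma> j)) *
    (\<Prod>(i, j)\<in>index_pairs n. pairfac (\<nu> i) (\<nu> j) (s j / s i))" .
  have "s_fac (q powi (- int (\<nu> i)) / q) 1 = s_fac ?z (s i)"
    by (rule s_fac_cong) (use i nz in \<open>simp add: shifted_def\<close>)
  moreover have "s_fac 1 (q * (q ^ \<nu> i * (s (Suc n) / s i))) = s_fac ?z (s (Suc n))"
    by (rule s_fac_cong) (use i nz q_nz in \<open>simp add: shifted_def power_int_minus field_simps\<close>)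
  ultimately have at_i: "diagfac (?\<nu> i) * lastfac (?\<nu> i) (s (Suc n) / s i) =
      t / q * (s_fac ?z (s i) * s_fac ?z (s (Suc n))) * (diagfac (\<nu> i) * lastfac (\<nu> i) (s (Suc n) / s i))"
    using i lastfac_Suc[OF s_gen[of "Suc n" i], of "\<nu> i"] by (simp add: diagfac_Suc(1))
  have rest: "(\<Prod>j\<in>{1..n} - {i}. diagfac (?\<nu> j) * lastfac (?\<nu> j) (s (Suc n) / s j)) =
    (\<Prod>j\<in>{1..n} - {i}. diagfac (\<nu> j) * lastfac (\<nu> j) (s (Suc n) / s j))"
    by (intro prod.cong) auto
  have single: "(\<Prod>j = 1..n. diagfac (?\<nu> j) * lastfac (?\<nu> j) (s (Suc n) / s j)) =
    t / q * (s_fac ?z (s i) * s_fac ?z (s (Suc n))) * (\<Prod>j = 1..n. diagfac (\<nu> j) * lastfac (\<nu> j) (s (Suc n) / s j))"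
    unfolding prod.remove[OF finite_atLeastAtMost i] at_i rest by (simp only: mult.assoc)
  have split: "(\<Prod>j\<in>{1..Suc n}. s_fac ?z (s j)) = s_fac ?z (s i) * s_fac ?z (s (Suc n)) * (\<Prod>j\<in>{1..n} - {i}. s_fac ?z (s j))"
    using prod.remove[OF finite_atLeastAtMost i, of "\<lambda>j. s_fac ?z (s j)"] by (simp add: mult_ac)
  have "step_fac n ?\<nu> s * bprod (shifted ?\<nu> s) i = (\<Prod>j = 1..n. diagfac (?\<nu> j) * lastfac (?\<nu> j) (s (Suc n) / s j)) *
      (bprod (shifted ?\<nu> s) i * (\<Prod>(i, j)\<in>index_pairs n. pairfac (?\<nu> i) (?\<nu> j) (s j / s i)))"
    unfolding step_fac_def by (simp only: mult_ac)
  then show ?thesis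
    unfolding pairs single split step_fac_def by (simp only: prod.distrib mult_ac)
qed

text \<open>Since \<nu>_i = 0, the factors with i as first index are constant in s, and the pairs
  with i as second index are products of values of \<open>bfac\<close> whose end factors get
  exchanged.\<close>

lemma bprod_step_fac_boundary:
  assumes i: "i \<in> {1..n}" and zero: "\<nu> i = 0"
  shows "bprod s i * step_fac n \<nu> (s(i := q * s i)) = step_fac n \<nu> s * bprod \<sigma> i"
proof -
  let ?s = "s(i := q * s i)"
  have [simp]: "pairfac 0 b z = 1" "lastfac 0 z = 1" for b z
    by (simp_all add: pairfac_def lastfac_def)
  have "bprod s i * (\<Prod>(i, j)\<in>index_pairs n. pairfac (\<nu> i) (\<nu> j) (?s j / ?s i)) =
    (\<Prod>j\<in>{1..n} - {i}. if j < i then bfac (\<sigma> i / \<sigma> j) else 1) * (\<Prod>(i, j)\<in>index_pairs n. pairfac (\<nu> i) (\<nu> j) (s j / s i))"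
    unfolding bprod_def
  proof (rule prod_index_pairs_update[OF i])
    fix j assume j: "1 \<le> j" "j < i"
    have "q ^ \<nu> j * (s i / s j) = \<sigma> i / \<sigma> j"
      using i j s_nz q_nz zero by (simp add: shifted_def power_int_minus field_simps)
    then show "bfac (s i / s j) * pairfac (\<nu> j) (\<nu> i) (?s i / ?s j) =
      (if j < i then bfac (\<sigma> i / \<sigma> j) else 1) * pairfac (\<nu> j) (\<nu> i) (s i / s j)"
      using i j pairfac_zero_second[OF s_gen[of i j], of "\<nu> j"] by (simp add: zero)
  qed (use zero in auto)
  also have "(\<Prod>j\<in>{1..n} - {i}. if j < i then bfac (\<sigma> i / \<sigma> j) else 1) = bprod \<sigma> i"
    unfolding bprod_def using i by (intro prod.mono_neutral_cong_right) auto
  finally have pairs: "bprod s i * (\<Prod>(i, j)\<in>index_pairs n. pairfac (\<nu> i) (\<nu> j) (?s j / ?s i)) =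
    bprod \<sigma> i * (\<Prod>(i, j)\<in>index_pairs n. pairfac (\<nu> i) (\<nu> j) (s j / s i))" .
  have single: "(\<Prod>j = 1..n. diagfac (\<nu> j) * lastfac (\<nu> j) (?s (Suc n) / ?s j)) =
    (\<Prod>j = 1..n. diagfac (\<nu> j) * lastfac (\<nu> j) (s (Suc n) / s j))"
    by (rule prod.cong) (use i zero in auto)
  have "bprod s i * step_fac n \<nu> ?s = (\<Prod>j = 1..n. diagfac (\<nu> j) * lastfac (\<nu> j) (?s (Suc n) / ?s j)) *
      (bprod s i * (\<Prod>(i, j)\<in>index_pairs n. pairfac (\<nu> i) (\<nu> j) (?s j / ?s i)))"
    unfolding step_fac_def by (simp only: mult_ac)
  then show ?thesis unfolding pairs single step_fac_def by (simp only: mult_ac)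
qed

text \<open>Up to the common factor \<open>step_fac n \<nu> s\<close> this is the residue theorem
  for the product of all \<open>s_fac z (s j)\<close>, j \<le> n + 1, and
  \<open>sig_fac z (\<sigma> j)\<close>, j \<le> n. The poles s_i give the terms with shifted s, the
  poles \<sigma>_i / q the subtracted ones. The values 1 at zero and q / t at infinity give 1 - q /
  t, a factor that every residue shares.\<close>

theorem step_fac_source_identity:
  "(\<Sum>i = 1..n. bprod s i * step_fac n (\<nu>(i := Suc (\<nu> i))) (s(i := q * s i)) -
      step_fac n (\<nu>(i := Suc (\<nu> i))) s * bprod (shifted (\<nu>(i := Suc (\<nu> i))) s) i) +
    bprod s (Suc n) * step_fac n \<nu> (s(Suc n := q * s (Suc n))) = step_fac n \<nu> s"
proof -
  define R where "R = (\<lambda>i. (\<Prod>j\<in>{1..Suc n} - {i}. s_fac (s i) (s j)) * (\<Prod>j\<in>{1..n}. sig_fac (s i) (\<sigma> j)))"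
  define Q where "Q = (\<lambda>i. (\<Prod>j\<in>{1..Suc n}. s_fac (\<sigma> i / q) (s j)) * (\<Prod>j\<in>{1..n} - {i}. sig_fac (\<sigma> i / q) (\<sigma> j)))"
  have nz: "s j \<noteq> 0" "\<sigma> j \<noteq> 0" if "j \<in> {1..Suc n}" for j
    using s_nz[OF that] \<sigma>_nz[OF that] by auto
  have ratio: "q powi m * s i \<noteq> q powi l * s j"
    if ij: "i \<in> {1..Suc n}" "j \<in> {1..Suc n}" and ne: "i \<noteq> j \<or> m \<noteq> l" for i j m l
  proof
    assume "q powi m * s i = q powi l * s j"
    then have eq: "q powi (m - l) * (s i / s j) = 1" using nz[OF ij(2)] q_nz by (simp add: power_int_diff)
    show False
    proof (cases "i = j")
      case True
      then show False using eq q_not_root[of "m - l"] ne nz(1)[OF ij(2)] by simp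
    next
      case False
      then show False using eq genD(1)[OF s_gen[OF ij False]] by blast
    qed
  qed
  have "(\<Sum>i = 1..Suc n. R i) - (\<Sum>i = 1..n. t / q * Q i) = 1"
  \<comment> \<open>All residues carry the factor 1 - q / t, which cannot be cancelled if t = q. In
    that case every \<open>s_fac\<close> and \<open>sig_fac\<close> away from its pole is 1, and the
    claim counts n + 1 terms against n.\<close>
  proof (cases "t = q")
    case True
    have s_fac_1: "s_fac z (s j) = 1" if "z \<noteq> s j" "j \<in> {1..Suc n}" for z j
      unfolding s_fac_def using that nz(1)[of j] True q_nz by simp
    have sig_fac_1: "sig_fac z (\<sigma> j) = 1" if "q * z \<noteq> \<sigma> j" "j \<in> {1..n}" for z j
      unfolding sig_fac_def using that nz(2)[of j] True by simp
    have "R i = 1" if "i \<in> {1..Suc n}" for i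
    proof -
      have "s i \<noteq> s j" if "j \<in> {1..Suc n} - {i}" for j
        using ratio[of i j 0 0] \<open>i \<in> _\<close> that by auto
      moreover have "q * s i \<noteq> \<sigma> j" if "j \<in> {1..n}" for j
        using ratio[of i j 1 "- int (\<nu> j)"] \<open>i \<in> _\<close> that by (auto simp: shifted_def)
      ultimately show ?thesis unfolding R_def by (simp add: s_fac_1 sig_fac_1)
    qed
    moreover have "Q i = 1" if "i \<in> {1..n}" for i
    proof -
      have "\<sigma> i / q \<noteq> s j" if "j \<in> {1..Suc n}" for j
        using ratio[of i j "- int (Suc (\<nu> i))" 0] \<open>i \<in> _\<close> that unfolding powi_neg_Suc
        by (auto simp: shifted_def)
      moreover have "q * (\<sigma> i / q) \<noteq> \<sigma> j" if "j \<in> {1..n} - {i}" for j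
        using ratio[of i j "- int (\<nu> i)" "- int (\<nu> j)"] \<open>i \<in> _\<close> that q_nz by (auto simp: shifted_def)
      ultimately show ?thesis unfolding Q_def by (simp add: s_fac_1 sig_fac_1 del: prod.cl_ivl_Suc)
    qed
    ultimately show ?thesis using True q_nz by simp
  next
    case False
    \<comment> \<open>One tag per pole: \<open>Inl j\<close> for s_j and \<open>Inr j\<close> for
      \<sigma>_j / q. \<open>u\<close> lists the reciprocals of the poles, \<open>v\<close> those of
      the zeros.\<close>
    define A :: "(nat + nat) set" where "A = {1..Suc n} <+> {1..n}"
    define u where "u = case_sum (\<lambda>j. 1 / s j) (\<lambda>j. q / \<sigma> j)"
    define v where "v = case_sum (\<lambda>j. q / (t * s j)) (\<lambda>j. t / \<sigma> j)"
    define f where "f = (\<lambda>a. (1 - v a / u a) * (\<Prod>b\<in>A - {a}. (1 - v b / u a) / (1 - u b / u a)))"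
    have "inj_on u A"
    proof (rule inj_onI)
      fix a b assume ab: "a \<in> A" "b \<in> A" "u a = u b"
      have LL: "i = j" if "i \<in> {1..Suc n}" "j \<in> {1..Suc n}" "u (Inl i) = u (Inl j)" for i j
        using ratio[of i j 0 0] that nz by (auto simp: u_def)
      have LR: False if "i \<in> {1..Suc n}" "j \<in> {1..n}" "u (Inl i) = u (Inr j)" for i j
      proof -
        have "q * s i \<noteq> \<sigma> j" using ratio[of i j 1 "- int (\<nu> j)"] that by (simp add: shifted_def)
        then show ?thesis using that nz(1)[of i] nz(2)[of j] by (simp add: u_def field_simps)
      qed
      have RR: "i = j" if "i \<in> {1..n}" "j \<in> {1..n}" "u (Inr i) = u (Inr j)" for i j
      proof (rule ccontr)
        assume "i \<noteq> j"
        then have "\<sigma> i \<noteq> \<sigma> j"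
          using ratio[of i j "- int (\<nu> i)" "- int (\<nu> j)"] that by (simp add: shifted_def)
        then show False using that nz(2)[of i] nz(2)[of j] q_nz by (simp add: u_def field_simps)
      qed
      show "a = b"
        using ab LL LR[OF _ _ sym] LR RR unfolding A_def by (elim PlusE) (blast+)
    qed
    then have "(\<Sum>a\<in>A. f a) = 1 - (\<Prod>a\<in>A. v a / u a)"
      unfolding f_def
      by (intro partial_fractions_at_zero) (use nz q_nz in \<open>auto simp: A_def u_def\<close>)
    moreover have "(\<Prod>a\<in>A. v a / u a) = q / t"
    proof -
      have "(\<Prod>a\<in>A. v a / u a) = (\<Prod>j\<in>{1..Suc n}. q / t) * (\<Prod>j\<in>{1..n}. t / q)"
        unfolding A_def prod.Plus[OF finite_atLeastAtMost finite_atLeastAtMost]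
        by (intro arg_cong2[of _ _ _ _ "(*)"] prod.cong) (use nz in \<open>auto simp: u_def v_def\<close>)
      also have "\<dots> = q / t * (q / t * (t / q)) ^ n" by (simp only: prod_constant card_atLeastAtMost power_mult_distrib) simp
      finally show ?thesis using q_nz t_nz by simp
    qed
    moreover have "(\<Sum>a\<in>A. f a) = (\<Sum>i = 1..Suc n. f (Inl i)) + (\<Sum>i = 1..n. f (Inr i))"
      unfolding A_def sum.Plus[OF finite_atLeastAtMost finite_atLeastAtMost] by (simp add: o_def)
    moreover have "f (Inl i) = (1 - q / t) * R i" if i: "i \<in> {1..Suc n}" for i
    proof -
      have "A - {Inl i} = ({1..Suc n} - {i}) <+> {1..n}" by (auto simp: A_def)
      then have "(\<Prod>b\<in>A - {Inl i}. (1 - v b / u (Inl i)) / (1 - u b / u (Inl i))) = R i"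
        unfolding R_def using nz(1)[OF i]
        by (simp add: prod.Plus u_def v_def s_fac_def sig_fac_def o_def mult.commute[of "s i"] del: prod.cl_ivl_Suc)
      then show ?thesis using nz(1)[OF i] by (simp add: f_def) (simp add: u_def v_def)
    qed
    moreover have "f (Inr i) = (1 - q / t) * (- (t / q * Q i))" if i: "i \<in> {1..n}" for i
    proof -
      have \<sigma>: "\<sigma> i \<noteq> 0" using nz(2) i by simp
      have "A - {Inr i} = {1..Suc n} <+> ({1..n} - {i})" by (auto simp: A_def)
      then have "(\<Prod>b\<in>A - {Inr i}. (1 - v b / u (Inr i)) / (1 - u b / u (Inr i))) = Q i"
        unfolding Q_def using \<sigma> q_nz
        by (simp add: prod.Plus u_def v_def s_fac_def sig_fac_def o_def mult_ac del: prod.cl_ivl_Suc)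
      then have "f (Inr i) = (1 - t / q) * Q i" using \<sigma> by (simp add: f_def) (simp add: u_def v_def)
      moreover have "(1 - q / t) * (- (t / q * Q i)) = (1 - t / q) * Q i"
        using q_nz t_nz by (simp add: field_simps)
      ultimately show ?thesis by simp
    qed
    ultimately have "1 - q / t = (\<Sum>i = 1..Suc n. (1 - q / t) * R i) + (\<Sum>i = 1..n. (1 - q / t) * (- (t / q * Q i)))"
      by (simp del: sum.cl_ivl_Suc mult_minus_right)
    also have "\<dots> = (1 - q / t) * ((\<Sum>i = 1..Suc n. R i) - (\<Sum>i = 1..n. t / q * Q i))"
      by (simp only: sum_distrib_left[symmetric] sum_negf right_diff_distrib mult_minus_right) simp
    finally have "(1 - q / t) * ((\<Sum>i = 1..Suc n. R i) - (\<Sum>i = 1..n. t / q * Q i)) = (1 - q / t) * 1"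
      by simp
    moreover have "1 - q / t \<noteq> 0" using False t_nz by auto
    ultimately show ?thesis by (simp only: mult_cancel_left simp_thms)
  qed
  then have "(\<Sum>i = 1..n. R i) - (\<Sum>i = 1..n. t / q * Q i) + R (Suc n) = 1"
    by (simp add: algebra_simps)
  from arg_cong[OF this, of "\<lambda>x. step_fac n \<nu> s * x"]
  have eq: "(\<Sum>i = 1..n. step_fac n \<nu> s * R i - step_fac n \<nu> s * (t / q * Q i)) + step_fac n \<nu> s * R (Suc n) =
      step_fac n \<nu> s"
    by (simp only: sum_subtractf sum_distrib_left right_diff_distrib distrib_left mult_1_right)
  show ?thesis
    unfolding bprod_step_fac_shift_last
    by (rule trans[OF _ eq], intro arg_cong2[of _ _ _ _ "(+)"] sum.cong refl)
      (simp add: bprod_step_fac_shift step_fac_bprod_shifted R_def Q_def del: prod.cl_ivl_Suc, simp only: R_def)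
qed

end

end

section \<open>Units, locally finite sums and rescalings of power series\<close>

lemma mfps_coeff_0 [simp]: "mfps_coeff 0 m = 0"
  by (simp add: zero_mfps.rep_eq)

lemma mfps_coeff_1: "mfps_coeff 1 m = (if m = 0 then 1 else 0)"
  by (simp add: one_mfps.rep_eq)

lemma mfps_coeff_add [simp]: "mfps_coeff (f + g) m = mfps_coeff f m + mfps_coeff g m"
  by (simp add: plus_mfps.rep_eq)

lemma mfps_coeff_diff [simp]: "mfps_coeff (f - g) m = mfps_coeff f m - mfps_coeff g m"
  by (simp add: minus_mfps.rep_eq)

lemma mfps_coeff_mult:
  "mfps_coeff (f * g) m = (\<Sum>p | fst p + snd p = m. mfps_coeff f (fst p) * mfps_coeff g (snd p))"
  by (simp add: times_mfps.rep_eq case_prod_unfold)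

lemma finite_splits: "finite {p. fst p + snd p = (m :: 'v \<Rightarrow>\<^sub>0 nat)}"
  using finite_add_decomp[of m] by (simp add: case_prod_unfold)

lemma mfps_coeff_sum: "mfps_coeff (sum f A) m = (\<Sum>a\<in>A. mfps_coeff (f a) m)"
  by (induction A rule: infinite_finite_induct) auto

lemma mfps_coeff_const: "mfps_coeff (mfps_const c) m = (if m = 0 then c else 0)"
  by (simp add: mfps_const.rep_eq)

lemma mfps_coeff_const_mult [simp]:
  fixes f :: "('v, 'a::comm_ring_1) mfps"
  shows "mfps_coeff (mfps_const c * f) m = c * mfps_coeff f m"
proof -
  have "mfps_coeff (mfps_const c * f) m =
      (\<Sum>p\<in>{(0 :: 'v \<Rightarrow>\<^sub>0 nat, m)}. mfps_coeff (mfps_const c) (fst p) * mfps_coeff f (snd p))"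
    unfolding mfps_coeff_mult
    by (rule sum.mono_neutral_right) (auto simp: finite_splits mfps_coeff_const)
  then show ?thesis by (simp add: mfps_coeff_const)
qed

lemma mfps_coeff_0_mult: "mfps_coeff (f * g) 0 = mfps_coeff f 0 * mfps_coeff g (0 :: 'v \<Rightarrow>\<^sub>0 nat)"
proof -
  have "{p. fst p + snd p = (0 :: 'v \<Rightarrow>\<^sub>0 nat)} = {(0, 0)}"
    by (auto simp: poly_mapping_eq_iff fun_eq_iff lookup_add)
  then show ?thesis by (simp add: mfps_coeff_mult)
qed

lemma mfps_const_0 [simp]: "mfps_const 0 = (0 :: ('v, 'a::comm_ring_1) mfps)"
  and mfps_const_1 [simp]: "mfps_const 1 = (1 :: ('v, 'a::comm_ring_1) mfps)"
  by (rule mfps_eqI; simp add: mfps_coeff_const mfps_coeff_1)+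

lemma mfps_const_add: "mfps_const (a + b) = (mfps_const a + mfps_const b :: ('v, 'a::comm_ring_1) mfps)"
  and mfps_const_diff: "mfps_const (a - b) = (mfps_const a - mfps_const b :: ('v, 'a::comm_ring_1) mfps)"
  by (rule mfps_eqI; simp add: mfps_coeff_const)+

lemma mfps_const_mult: "mfps_const (a * b) = (mfps_const a * mfps_const b :: ('v, 'a::comm_ring_1) mfps)"
  by (rule mfps_eqI) (simp add: mfps_coeff_const)

lemma mfps_const_power: "mfps_const (a ^ k) = (mfps_const a ^ k :: ('v, 'a::comm_ring_1) mfps)"
  by (induction k) (simp_all add: mfps_const_mult)

text \<open>Giving the variables different weights makes every weight space finite-dimensional.\<close>

definition mweight :: "('v::countable \<Rightarrow>\<^sub>0 nat) \<Rightarrow> nat"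
  where "mweight m = (\<Sum>v\<in>Poly_Mapping.keys m. Suc (to_nat v) * Poly_Mapping.lookup m v)"

lemma mweight_0 [simp]: "mweight 0 = 0"
  by (simp add: mweight_def)

lemma mweight_add: "mweight (a + b) = mweight a + mweight b"
  unfolding mweight_def by (rule setsum_keys_plus_distrib) (simp_all add: algebra_simps)

lemma lookup_le_mweight: "Suc (to_nat v) * Poly_Mapping.lookup m v \<le> mweight m"
proof (cases "v \<in> Poly_Mapping.keys m")
  case True
  then show ?thesis unfolding mweight_def by (intro member_le_sum) auto
next
  case False
  then show ?thesis by (simp add: in_keys_iff)
qed

lemma mweight_eq_0_iff [simp]: "mweight m = 0 \<longleftrightarrow> m = 0"
proof
  assume "mweight m = 0"
  then have "Poly_Mapping.lookup m v = 0" for v using lookup_le_mweight[of v m] by simp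
  then show "m = 0" by (simp add: poly_mapping_eq_iff fun_eq_iff)
qed simp

lemma finite_mweight_le: "finite {m :: 'v::countable \<Rightarrow>\<^sub>0 nat. mweight m \<le> w}"
proof -
  let ?V = "{v :: 'v. to_nat v \<le> w}"
  have finV: "finite ?V"
    by (rule finite_imageD[of to_nat]) (auto intro: finite_subset[of _ "{..w}"])
  define M :: "'v \<Rightarrow>\<^sub>0 nat" where "M = (\<Sum>v\<in>?V. Poly_Mapping.single v w)"
  have lookup_M: "Poly_Mapping.lookup M v = (if v \<in> ?V then w else 0)" for v
    using finV by (simp add: M_def lookup_sum lookup_single when_def)
  have "m \<in> fst ` {(a, b). a + b = M}" if "mweight m \<le> w" for m
  proof -
    have "Poly_Mapping.lookup m v \<le> Poly_Mapping.lookup M v" for v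
    proof (cases "Poly_Mapping.lookup m v")
      case (Suc k)
      have "Suc (to_nat v) * Suc k \<le> w" using that lookup_le_mweight[of v m] Suc by simp
      then have "to_nat v \<le> w" "Suc k \<le> w" by (auto simp: algebra_simps)
      then show ?thesis using Suc by (simp add: lookup_M)
    qed simp
    then have "m + (M - m) = M"
      by (intro poly_mapping_eqI) (simp add: lookup_add lookup_minus)
    then show ?thesis by force
  qed
  then have "{m. mweight m \<le> w} \<subseteq> fst ` {(a, b). a + b = M}" by blast
  then show ?thesis using finite_add_decomp[of M] finite_surj by blast
qed

lemma mweight_split: "fst p + snd p = m \<Longrightarrow> mweight (fst p) + mweight (snd p) = mweight m"
  by (metis mweight_add)

text \<open>This makes the field of fractions available. Leading monomials, taken by weight first
  and then by the order on exponents, multiply; a least one exists in spite of infinitely many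
  variables because each weight belongs to finitely many monomials.\<close>

instance mfps :: ("{countable, linorder}", idom) idom
proof
  fix f g :: "('a, 'b) mfps"
  assume "f \<noteq> 0" "g \<noteq> 0"
  \<comment> \<open>the lexicographically least among the finitely many support monomials of least weight\<close>
  have lead: "\<exists>a. mfps_coeff f a \<noteq> 0 \<and> (\<forall>b. mfps_coeff f b \<noteq> 0 \<longrightarrow> mweight a < mweight b \<or> mweight a = mweight b \<and> a \<le> b)"
    if "f \<noteq> 0" for f :: "('a, 'b) mfps"
  proof -
    define w where "w = (LEAST w. \<exists>m. mfps_coeff f m \<noteq> 0 \<and> mweight m = w)"
    define S where "S = {m. mfps_coeff f m \<noteq> 0 \<and> mweight m = w}"
    have "\<exists>w m. mfps_coeff f m \<noteq> 0 \<and> mweight m = w"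
      using that mfps_eqI[of f 0] by auto
    then have "S \<noteq> {}" unfolding S_def w_def using LeastI_ex[of "\<lambda>w. \<exists>m. mfps_coeff f m \<noteq> 0 \<and> mweight m = w"] by auto
    moreover have "finite S" by (rule finite_subset[OF _ finite_mweight_le[of w]]) (auto simp: S_def)
    ultimately have "Min S \<in> S" "\<And>b. b \<in> S \<Longrightarrow> Min S \<le> b" by auto
    moreover have "w \<le> mweight b" if "mfps_coeff f b \<noteq> 0" for b
      unfolding w_def using that by (intro Least_le) auto
    ultimately show ?thesis unfolding S_def by (intro exI[of _ "Min S"]) (auto simp: S_def le_less)
  qed
  obtain a where a: "mfps_coeff f a \<noteq> 0"
      "\<And>b. mfps_coeff f b \<noteq> 0 \<Longrightarrow> mweight a < mweight b \<or> mweight a = mweight b \<and> a \<le> b"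
    using lead[OF \<open>f \<noteq> 0\<close>] by blast
  obtain c where c: "mfps_coeff g c \<noteq> 0"
      "\<And>b. mfps_coeff g b \<noteq> 0 \<Longrightarrow> mweight c < mweight b \<or> mweight c = mweight b \<and> c \<le> b"
    using lead[OF \<open>g \<noteq> 0\<close>] by blast
  have "p = (a, c)" if p: "fst p + snd p = a + c" and nz: "mfps_coeff f (fst p) * mfps_coeff g (snd p) \<noteq> 0" for p
  proof -
    have nz': "mfps_coeff f (fst p) \<noteq> 0" "mfps_coeff g (snd p) \<noteq> 0" using nz by auto
    have "mweight (fst p) + mweight (snd p) = mweight a + mweight c"
      using mweight_split[OF p] by (simp add: mweight_add)
    with a(2)[OF nz'(1)] c(2)[OF nz'(2)] have le: "a \<le> fst p" "c \<le> snd p" by auto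
    have "fst p = a"
    proof (rule ccontr)
      assume "fst p \<noteq> a"
      with le have "a + c < fst p + snd p" by (intro add_less_le_mono) auto
      with p show False by simp
    qed
    with p show ?thesis by (cases p) auto
  qed
  then have "mfps_coeff (f * g) (a + c) = (\<Sum>p\<in>{(a, c)}. mfps_coeff f (fst p) * mfps_coeff g (snd p))"
    unfolding mfps_coeff_mult by (intro sum.mono_neutral_right) (auto simp: finite_splits)
  then have "mfps_coeff (f * g) (a + c) \<noteq> 0" using a c by simp
  then show "f * g \<noteq> 0" by auto
qed

section \<open>Order of vanishing, units and quotients\<close>

definition mord_ge :: "nat \<Rightarrow> ('v::countable, 'a::zero) mfps \<Rightarrow> bool"
  where "mord_ge k f \<longleftrightarrow> (\<forall>m. mweight m < k \<longrightarrow> mfps_coeff f m = 0)"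

lemma mord_geD: "mord_ge k f \<Longrightarrow> mweight m < k \<Longrightarrow> mfps_coeff f m = 0"
  by (simp add: mord_ge_def)

lemma mord_ge_0 [simp]: "mord_ge 0 f"
  by (simp add: mord_ge_def)

lemma mord_ge_1_iff: "mord_ge (Suc 0) f \<longleftrightarrow> mfps_coeff f 0 = 0"
  by (auto simp: mord_ge_def)

lemma mord_ge_mult:
  fixes f g :: "('v::countable, 'a::comm_ring_1) mfps"
  assumes "mord_ge k f" "mord_ge l g"
  shows "mord_ge (k + l) (f * g)"
  unfolding mord_ge_def
proof (intro allI impI)
  fix m :: "'v \<Rightarrow>\<^sub>0 nat" assume "mweight m < k + l"
  then have "mweight (fst p) < k \<or> mweight (snd p) < l" if "fst p + snd p = m" for p
    using mweight_split[OF that] by linarith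
  then have "mfps_coeff f (fst p) * mfps_coeff g (snd p) = 0" if "fst p + snd p = m" for p
    using that assms mord_geD by (metis mult_zero_left mult_zero_right)
  then show "mfps_coeff (f * g) m = 0"
    unfolding mfps_coeff_mult by (intro sum.neutral) blast
qed

lemma mord_ge_power:
  fixes f :: "('v::countable, 'a::comm_ring_1) mfps"
  shows "mord_ge l f \<Longrightarrow> mord_ge (l * k) (f ^ k)"
  by (induction k) (auto intro: mord_ge_mult)

lemma mord_ge_prod:
  fixes f :: "'i \<Rightarrow> ('v::countable, 'a::comm_ring_1) mfps"
  shows "(\<And>i. i \<in> A \<Longrightarrow> mord_ge (k i) (f i)) \<Longrightarrow> mord_ge (\<Sum>i\<in>A. k i) (\<Prod>i\<in>A. f i)"
  by (induction A rule: infinite_finite_induct) (auto intro: mord_ge_mult)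

text \<open>Geometric series in \<open>h\<close>, which has no constant term: \<open>h ^ k\<close>
  has no monomial of weight below \<open>k\<close>, so each coefficient of the sum is finite and
  agrees with that of a long enough partial sum.\<close>

lemma mfps_unit:
  fixes f :: "('v::countable, 'a::field) mfps"
  assumes "mfps_coeff f 0 \<noteq> 0"
  shows "f * inverse f = 1"
proof -
  define c where "c = mfps_coeff f 0"
  define h where "h = 1 - mfps_const (1 / c) * f"
  define g where "g = Abs_mfps (\<lambda>m. \<Sum>k\<le>mweight m. mfps_coeff (h ^ k) m)"
  have h: "mord_ge 1 h" using assms by (simp add: mord_ge_1_iff h_def c_def mfps_coeff_1)
  have hk: "mfps_coeff (h ^ k) m = 0" if "mweight m < k" for k m
    using mord_ge_power[OF h, of k] that by (auto dest: mord_geD)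
  have g_coeff: "mfps_coeff g m = (\<Sum>k<Suc N. mfps_coeff (h ^ k) m)" if "mweight m \<le> N" for m N
    unfolding g_def Abs_mfps_inverse[OF UNIV_I]
    using that by (intro sum.mono_neutral_left) (auto intro: hk)
  have "(1 - h) * g = 1"
  proof (rule mfps_eqI)
    fix m :: "'v \<Rightarrow>\<^sub>0 nat"
    define P where "P = (\<Sum>k<Suc (mweight m). h ^ k)"
    have "mfps_coeff g (snd p) = mfps_coeff P (snd p)" if "fst p + snd p = m" for p
      using g_coeff[of "snd p" "mweight m"] mweight_split[OF that] by (simp add: P_def mfps_coeff_sum del: sum.lessThan_Suc)
    then have "mfps_coeff ((1 - h) * g) m = mfps_coeff ((1 - h) * P) m"
      unfolding mfps_coeff_mult by (intro sum.cong) auto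
    also have "(1 - h) * P = 1 - h ^ Suc (mweight m)"
      unfolding P_def by (rule one_diff_power_eq[symmetric])
    finally show "mfps_coeff ((1 - h) * g) m = mfps_coeff 1 m" by (simp add: hk del: power_Suc)
  qed
  moreover have "(1 - h) * g = f * (mfps_const (1 / c) * g)" by (simp add: h_def mult_ac)
  ultimately have "f * (mfps_const (1 / c) * g) = 1" by simp
  with mfps_inverse_unique[OF this] show ?thesis by simp
qed

lemma mfps_divide_eq_iff:
  fixes f g h :: "('v::{countable, linorder}, 'a::field) mfps"
  assumes "mfps_coeff g 0 \<noteq> 0"
  shows "f / g = h \<longleftrightarrow> f = h * g"
proof -
  have "g * inverse g = 1" using assms by (rule mfps_unit)
  then show ?thesis by (auto simp: divide_mfps_def mult_ac)
qed

lemma mfps_coeff_0_inverse: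
  fixes f :: "('v::countable, 'a::field) mfps"
  assumes "mfps_coeff f 0 \<noteq> 0"
  shows "mfps_coeff (inverse f) 0 = inverse (mfps_coeff f 0)"
  using mfps_unit[OF assms] mfps_coeff_0_mult[of f "inverse f"] assms
  by (simp add: mfps_coeff_1 field_simps)

lemma mfps_coeff_0_divide:
  fixes f :: "('v::countable, 'a::field) mfps"
  assumes "mfps_coeff g 0 \<noteq> 0"
  shows "mfps_coeff (f / g) 0 = mfps_coeff f 0 / mfps_coeff g 0"
  using mfps_coeff_0_inverse[OF assms] by (simp add: divide_mfps_def mfps_coeff_0_mult field_simps)

lemma mfps_coeff_0_prod: "mfps_coeff (\<Prod>i\<in>A. f i) 0 = (\<Prod>i\<in>A. mfps_coeff (f i) 0)"
  by (induction A rule: infinite_finite_induct) (auto simp: mfps_coeff_0_mult mfps_coeff_1)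

lemma mfps_coeff_0_power: "mfps_coeff (f ^ k) 0 = mfps_coeff f 0 ^ k"
  by (induction k) (auto simp: mfps_coeff_0_mult mfps_coeff_1)

lemma to_fract_divide:
  fixes f g :: "('v::{countable, linorder}, 'a::field) mfps"
  assumes "mfps_coeff g 0 \<noteq> 0"
  shows "to_fract (f / g) = to_fract f / to_fract g"
proof -
  have "g \<noteq> 0" using assms by auto
  moreover have "f / g * g = f" using mfps_divide_eq_iff[OF assms, of f "f / g"] by simp
  then have "to_fract (f / g) * to_fract g = to_fract f" by (simp flip: to_fract_mult)
  ultimately show ?thesis by (simp add: field_simps)
qed

lemma to_fract_prod: "to_fract (\<Prod>i\<in>A. f i) = (\<Prod>i\<in>A. to_fract (f i))"
  by (induction A rule: infinite_finite_induct) auto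

lemma to_fract_sum: "to_fract (\<Sum>i\<in>A. f i) = (\<Sum>i\<in>A. to_fract (f i))"
  by (induction A rule: infinite_finite_induct) auto

lemma to_fract_power: "to_fract (f ^ k) = to_fract f ^ k"
  by (induction k) auto

text \<open>The formal notion of summability. \<open>infsum\<close> takes the default value 0 on
  families that do not converge, so the exchange rules below start from this condition, under which
  every coefficient is a finite sum.\<close>

definition locally_finite :: "'i set \<Rightarrow> ('i \<Rightarrow> ('v, 'a::zero) mfps) \<Rightarrow> bool"
  where "locally_finite A f \<longleftrightarrow> (\<forall>m. finite {a \<in> A. mfps_coeff (f a) m \<noteq> 0})"

lemma locally_finiteD: "locally_finite A f \<Longrightarrow> finite {a \<in> A. mfps_coeff (f a) m \<noteq> 0}"
  by (simp add: locally_finite_def)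

lemma locally_finite_mord:
  fixes f :: "'i \<Rightarrow> ('v::countable, 'a::zero) mfps"
  assumes "\<And>a. a \<in> A \<Longrightarrow> mord_ge (d a) (f a)" and "\<And>k. finite {a \<in> A. d a \<le> k}"
  shows "locally_finite A f"
  unfolding locally_finite_def
proof
  fix m :: "'v \<Rightarrow>\<^sub>0 nat"
  have "d a \<le> mweight m" if "a \<in> A" "mfps_coeff (f a) m \<noteq> 0" for a
    using assms(1)[OF that(1)] that(2) by (auto simp: mord_ge_def not_less[symmetric])
  then have "{a \<in> A. mfps_coeff (f a) m \<noteq> 0} \<subseteq> {a \<in> A. d a \<le> mweight m}" by blast
  then show "finite {a \<in> A. mfps_coeff (f a) m \<noteq> 0}" using assms(2) finite_subset by blast
qed

text \<open>The multipliers are arbitrary and may depend on the index, since a monomial has only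
  finitely many divisors. A family is therefore locally finite by virtue of its monomial factor
  alone.\<close>

lemma locally_finite_mult_left:
  fixes f g :: "'i \<Rightarrow> ('v, 'a::comm_ring_1) mfps"
  assumes "locally_finite A f"
  shows "locally_finite A (\<lambda>a. g a * f a)"
  unfolding locally_finite_def
proof
  fix m :: "'v \<Rightarrow>\<^sub>0 nat"
  have "{a \<in> A. mfps_coeff (g a * f a) m \<noteq> 0} \<subseteq>
      (\<Union>p\<in>{p. fst p + snd p = m}. {a \<in> A. mfps_coeff (f a) (snd p) \<noteq> 0})"
  proof
    fix a assume a: "a \<in> {a \<in> A. mfps_coeff (g a * f a) m \<noteq> 0}"
    then obtain p where "fst p + snd p = m" "mfps_coeff (g a) (fst p) * mfps_coeff (f a) (snd p) \<noteq> 0"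
      unfolding mfps_coeff_mult by (auto elim: sum.not_neutral_contains_not_neutral)
    with a show "a \<in> (\<Union>p\<in>{p. fst p + snd p = m}. {a \<in> A. mfps_coeff (f a) (snd p) \<noteq> 0})"
      by (intro UN_I[of p]) auto
  qed
  then show "finite {a \<in> A. mfps_coeff (g a * f a) m \<noteq> 0}"
    by (rule finite_subset) (use assms in \<open>auto intro!: finite_UN_I finite_splits dest: locally_finiteD\<close>)
qed

lemma locally_finite_cong:
  "(\<And>a. a \<in> A \<Longrightarrow> f a = g a) \<Longrightarrow> locally_finite A f \<longleftrightarrow> locally_finite A g"
  unfolding locally_finite_def by (intro all_cong1 arg_cong[of _ _ finite]) auto

section \<open>Rules for sums of locally finite families\<close>

lemma mfps_has_sum_iff:
  fixes f :: "'i \<Rightarrow> ('v, 'a::{comm_ring_1, topological_comm_monoid_add, t2_space}) mfps"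
  shows "(f has_sum S) A \<longleftrightarrow> (\<forall>m. ((\<lambda>a. mfps_coeff (f a) m) has_sum mfps_coeff S m) A)"
  by (simp add: has_sum_def tendsto_mfps_iff mfps_coeff_sum)

lemma has_sum_sum:
  fixes f :: "'j \<Rightarrow> 'i \<Rightarrow> 'a::topological_comm_monoid_add"
  assumes "\<And>j. j \<in> J \<Longrightarrow> (f j has_sum S j) A"
  shows "((\<lambda>a. \<Sum>j\<in>J. f j a) has_sum (\<Sum>j\<in>J. S j)) A"
  using assms by (induction J rule: infinite_finite_induct) (auto intro!: has_sum_add)

context
  fixes A :: "'i set" and f :: "'i \<Rightarrow> ('v, complex) mfps"
  assumes lf: "locally_finite A f"
begin

lemma summable_on_mfps_coeff: "(\<lambda>a. mfps_coeff (f a) m) summable_on A"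
  using summable_on_finite[OF locally_finiteD[OF lf, of m]]
  by (rule summable_on_cong_neutral[THEN iffD1, rotated -1]) auto

lemma has_sum_infsum_mfps: "(f has_sum infsum f A) A"
proof -
  have "(f has_sum Abs_mfps (\<lambda>m. infsum (\<lambda>a. mfps_coeff (f a) m) A)) A"
    unfolding mfps_has_sum_iff Abs_mfps_inverse[OF UNIV_I]
    by (intro allI has_sum_infsum summable_on_mfps_coeff)
  then show ?thesis by (simp add: infsumI)
qed

lemma has_sum_mfps_coeff: "((\<lambda>a. mfps_coeff (f a) m) has_sum mfps_coeff (infsum f A) m) A"
  using has_sum_infsum_mfps by (simp add: mfps_has_sum_iff)

lemma mfps_coeff_infsum: "mfps_coeff (infsum f A) m = infsum (\<lambda>a. mfps_coeff (f a) m) A"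
  using has_sum_mfps_coeff by (rule infsumI[symmetric])

lemma infsum_mfps_cmult: "infsum (\<lambda>a. g * f a) A = g * infsum f A"
proof -
  have "((\<lambda>a. g * f a) has_sum g * infsum f A) A"
    unfolding mfps_has_sum_iff mfps_coeff_mult
    by (intro allI has_sum_sum has_sum_cmult_right has_sum_mfps_coeff)
  then show ?thesis by (rule infsumI)
qed

lemma infsum_mfps_cmult_right: "infsum (\<lambda>a. f a * g) A = infsum f A * g"
  using infsum_mfps_cmult[of g] by (simp add: mult.commute)

end

lemma infsum_mfps_add:
  fixes f g :: "'i \<Rightarrow> ('v, complex) mfps"
  assumes "locally_finite A f" "locally_finite A g"
  shows "infsum (\<lambda>a. f a + g a) A = infsum f A + infsum g A"
proof -
  have "((\<lambda>a. f a + g a) has_sum (infsum f A + infsum g A)) A"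
    unfolding mfps_has_sum_iff mfps_coeff_add by (intro allI has_sum_add has_sum_mfps_coeff assms)
  then show ?thesis by (rule infsumI)
qed

lemma infsum_mfps_sum:
  fixes f :: "'j \<Rightarrow> 'i \<Rightarrow> ('v, complex) mfps"
  assumes "\<And>j. j \<in> J \<Longrightarrow> locally_finite A (f j)"
  shows "infsum (\<lambda>a. \<Sum>j\<in>J. f j a) A = (\<Sum>j\<in>J. infsum (f j) A)"
proof -
  have "((\<lambda>a. \<Sum>j\<in>J. f j a) has_sum (\<Sum>j\<in>J. infsum (f j) A)) A"
    unfolding mfps_has_sum_iff mfps_coeff_sum by (intro allI has_sum_sum has_sum_mfps_coeff assms)
  then show ?thesis by (rule infsumI)
qed

lemma infsum_mfps_Times:
  fixes f :: "'i \<Rightarrow> 'j \<Rightarrow> ('v, complex) mfps"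
  assumes "locally_finite (A \<times> B) (\<lambda>(a, b). f a b)"
  shows "infsum (\<lambda>(a, b). f a b) (A \<times> B) = infsum (\<lambda>a. infsum (f a) B) A"
proof -
  have inner: "locally_finite B (f a)" if "a \<in> A" for a
    unfolding locally_finite_def
  proof
    fix m
    have "{b \<in> B. mfps_coeff (f a b) m \<noteq> 0} \<subseteq> snd ` {p \<in> A \<times> B. mfps_coeff ((\<lambda>(a, b). f a b) p) m \<noteq> 0}"
      using that by (auto simp: image_iff)
    then show "finite {b \<in> B. mfps_coeff (f a b) m \<noteq> 0}"
      using locally_finiteD[OF assms, of m] finite_surj by blast
  qed
  have "((\<lambda>a. infsum (f a) B) has_sum infsum (\<lambda>(a, b). f a b) (A \<times> B)) A"
    unfolding mfps_has_sum_iff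
  proof
    fix m
    have *: "(\<lambda>(a, b). mfps_coeff (f a b) m) summable_on A \<times> B"
      using summable_on_mfps_coeff[OF assms, of m] by (simp add: case_prod_unfold)
    have outer: "((\<lambda>a. infsum (\<lambda>b. mfps_coeff (f a b) m) B) has_sum infsum (\<lambda>(a, b). mfps_coeff (f a b) m) (A \<times> B)) A"
      using has_sum_infsum[OF summable_on_Sigma_banach[OF *]] unfolding infsum_Sigma'_banach[OF *] .
    have eq: "mfps_coeff (infsum (f a) B) m = infsum (\<lambda>b. mfps_coeff (f a b) m) B" if "a \<in> A" for a
      by (rule mfps_coeff_infsum[OF inner[OF that]])
    have total: "mfps_coeff (infsum (\<lambda>(a, b). f a b) (A \<times> B)) m = infsum (\<lambda>(a, b). mfps_coeff (f a b) m) (A \<times> B)"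
      unfolding mfps_coeff_infsum[OF assms] by (simp add: case_prod_unfold)
    show "((\<lambda>a. mfps_coeff (infsum (f a) B) m) has_sum mfps_coeff (infsum (\<lambda>(a, b). f a b) (A \<times> B)) m) A"
      unfolding total by (rule has_sum_cong[THEN iffD2, OF eq outer])
  qed
  then show ?thesis by (rule infsumI[symmetric])
qed

section \<open>Rescaling the variables\<close>

definition monom_eval :: "('v \<Rightarrow> 'a::comm_monoid_mult) \<Rightarrow> ('v \<Rightarrow>\<^sub>0 nat) \<Rightarrow> 'a"
  where "monom_eval a m = (\<Prod>v\<in>Poly_Mapping.keys m. a v ^ Poly_Mapping.lookup m v)"

lemma monom_eval_superset:
  "finite V \<Longrightarrow> Poly_Mapping.keys m \<subseteq> V \<Longrightarrow> monom_eval a m = (\<Prod>v\<in>V. a v ^ Poly_Mapping.lookup m v)"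
  unfolding monom_eval_def by (rule prod.mono_neutral_left) (auto simp: in_keys_iff)

lemma monom_eval_0 [simp]: "monom_eval a 0 = 1"
  by (simp add: monom_eval_def)

lemma monom_eval_add: "monom_eval a (m + m') = monom_eval a m * monom_eval a m'"
proof -
  let ?V = "Poly_Mapping.keys m \<union> Poly_Mapping.keys m'"
  have "finite ?V" "Poly_Mapping.keys (m + m') \<subseteq> ?V" by (auto simp: in_keys_iff lookup_add)
  then show ?thesis
    by (simp add: monom_eval_superset[of ?V] lookup_add power_add prod.distrib)
qed

lemma monom_eval_single: "monom_eval a (Poly_Mapping.single v k) = a v ^ k"
  by (simp add: monom_eval_def)

text \<open>A ring homomorphism in which the value 0 is allowed and removes a variable. So the
  q-shifts, the limit of vanishing ratios and the statement that a variable does not occur are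
  instances of one operation.\<close>

lift_definition mfps_scale :: "('v \<Rightarrow> 'a) \<Rightarrow> ('v, 'a::comm_ring_1) mfps \<Rightarrow> ('v, 'a) mfps"
  is "\<lambda>a f m. monom_eval a m * f m" .

lemma mfps_coeff_scale [simp]: "mfps_coeff (mfps_scale a f) m = monom_eval a m * mfps_coeff f m"
  by (simp add: mfps_scale.rep_eq)

lemma mfps_scale_0 [simp]: "mfps_scale a 0 = 0"
  and mfps_scale_1 [simp]: "mfps_scale a 1 = 1"
  and mfps_scale_diff: "mfps_scale a (f - g) = mfps_scale a f - mfps_scale a g"
  and mfps_scale_const [simp]: "mfps_scale a (mfps_const c) = mfps_const c"
  by (rule mfps_eqI; simp add: mfps_coeff_1 mfps_coeff_const algebra_simps)+

lemma mfps_scale_mult: "mfps_scale a (f * g) = mfps_scale a f * mfps_scale a g"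
proof (rule mfps_eqI)
  fix m
  show "mfps_coeff (mfps_scale a (f * g)) m = mfps_coeff (mfps_scale a f * mfps_scale a g) m"
    unfolding mfps_coeff_scale mfps_coeff_mult sum_distrib_left
    by (rule sum.cong) (auto simp: monom_eval_add mult_ac)
qed

lemma mfps_scale_var: "mfps_scale a (mfps_var v) = mfps_const (a v) * mfps_var v"
  by (rule mfps_eqI) (simp add: mfps_var.rep_eq monom_eval_single)

lemma mfps_scale_prod: "mfps_scale a (\<Prod>i\<in>A. f i) = (\<Prod>i\<in>A. mfps_scale a (f i))"
  by (induction A rule: infinite_finite_induct) (auto simp: mfps_scale_mult)

lemma mfps_scale_power: "mfps_scale a (f ^ k) = mfps_scale a f ^ k"
  by (induction k) (auto simp: mfps_scale_mult)

lemma mfps_scale_divide: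
  fixes f g :: "('v::{countable, linorder}, 'a::field) mfps"
  assumes "mfps_coeff g 0 \<noteq> 0"
  shows "mfps_scale a (f / g) = mfps_scale a f / mfps_scale a g"
proof -
  have "f / g * g = f" using mfps_divide_eq_iff[OF assms, of f "f / g"] by simp
  then have "mfps_scale a (f / g) * mfps_scale a g = mfps_scale a f" by (simp flip: mfps_scale_mult)
  moreover have "mfps_coeff (mfps_scale a g) 0 \<noteq> 0" using assms by simp
  ultimately show ?thesis using mfps_divide_eq_iff by metis
qed

lemma mfps_scale_infsum:
  fixes f :: "'i \<Rightarrow> ('v, complex) mfps"
  assumes "locally_finite A f"
  shows "mfps_scale a (infsum f A) = infsum (\<lambda>i. mfps_scale a (f i)) A"
proof -
  have "((\<lambda>i. mfps_scale a (f i)) has_sum mfps_scale a (infsum f A)) A"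
    using has_sum_infsum_mfps[OF assms] unfolding mfps_has_sum_iff
    by (auto intro: has_sum_cmult_right)
  then show ?thesis by (rule infsumI[symmetric])
qed

section \<open>The \<open>q\<close>-binomial theorem\<close>

lemma tendsto_mfps_mult:
  fixes f g :: "'i \<Rightarrow> ('v, complex) mfps"
  assumes "(f \<longlongrightarrow> F) net" "(g \<longlongrightarrow> G) net"
  shows "((\<lambda>x. f x * g x) \<longlongrightarrow> F * G) net"
  using assms unfolding tendsto_mfps_iff mfps_coeff_mult by (intro allI tendsto_sum tendsto_mult) auto

instance ratio_var :: countable
  by countable_datatype

text \<open>The order is transported from the enumeration; its purpose is the monomial order behind
  the integral domain instance.\<close>

instantiation ratio_var :: linorder
begin

definition less_eq_ratio_var :: "ratio_var \<Rightarrow> ratio_var \<Rightarrow> bool"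
  where "less_eq_ratio_var v w \<longleftrightarrow> to_nat v \<le> to_nat w"

definition less_ratio_var :: "ratio_var \<Rightarrow> ratio_var \<Rightarrow> bool"
  where "less_ratio_var v w \<longleftrightarrow> to_nat v < to_nat w"

instance
  by standard (auto simp: less_eq_ratio_var_def less_ratio_var_def)

end

lemma qpoch_eq_fin_qpoch: "qpoch z q k = fin_qpoch (mfps_const q) z k"
  by (simp add: qpoch_def fin_qpoch_def mfps_const_power)

lemma qpoch_0 [simp]: "qpoch z q 0 = 1"
  by (simp add: qpoch_def)

lemma qpoch_Suc: "qpoch z q (Suc k) = qpoch z q k * (1 - mfps_const (q ^ k) * z)"
  by (simp add: qpoch_def)

lemma mfps_coeff_0_qpoch: "mfps_coeff (qpoch z q k) 0 = (\<Prod>i<k. 1 - q ^ i * mfps_coeff z 0)"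
  by (simp add: qpoch_def mfps_coeff_0_prod mfps_coeff_1)

lemma qpoch_add: "qpoch z q (k + l) = qpoch z q k * qpoch (mfps_const (q ^ k) * z) q l"
  by (induction l) (simp_all add: qpoch_Suc power_add mfps_const_mult mult_ac)

lemma mfps_scale_qpoch: "mfps_scale a (qpoch z q k) = qpoch (mfps_scale a z) q k"
  by (simp add: qpoch_def mfps_scale_prod mfps_scale_diff mfps_scale_mult)

locale qpoch_conv =
  fixes q :: complex and z :: series
  assumes norm_q: "norm q < 1"
    and nonzero: "\<And>k. q ^ k * mfps_coeff z 0 \<noteq> 1"
begin

lemma qpoch_coeff_0_tendsto:
  obtains c where "(\<lambda>N. mfps_coeff (qpoch z q N) 0) \<longlonglongrightarrow> c" "c \<noteq> 0"
proof -
  let ?f = "\<lambda>i. 1 - q ^ i * mfps_coeff z 0"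
  have "summable (\<lambda>i. norm (?f i - 1))"
    using norm_q by (auto simp: norm_mult norm_power intro!: summable_mult2 summable_geometric)
  then have conv: "convergent_prod ?f"
    by (simp add: abs_convergent_prod_conv_summable abs_convergent_prod_imp_convergent_prod)
  then have "prodinf ?f \<noteq> 0" using nonzero by (intro prodinf_nonzero) auto
  moreover have "(\<lambda>n. \<Prod>i<n. ?f i) \<longlonglongrightarrow> prodinf ?f"
    using convergent_prod_LIMSEQ[OF conv] by (subst LIMSEQ_lessThan_iff_atMost)
  ultimately show ?thesis using that by (simp add: mfps_coeff_0_qpoch)
qed

lemma qpoch_coeff_0_nonzero: "mfps_coeff (qpoch z q N) 0 \<noteq> 0"
  using nonzero by (auto simp: mfps_coeff_0_qpoch)

text \<open>Induction on the weight. With z_0 the constant term of z, the coefficient obeys x (N +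
  1) = x N (1 - q^N z_0) - q^N y N, where \<open>y\<close> involves only coefficients of lower
  weight and converges. Dividing by the constant terms \<open>P N\<close>, which solve the
  homogeneous recursion, gives the partial sums of a series dominated by a geometric one.\<close>

lemma qpoch_coeff_convergent: "convergent (\<lambda>N. mfps_coeff (qpoch z q N) m)"
proof (induction "mweight m" arbitrary: m rule: less_induct)
  case less
  define P where "P N = mfps_coeff (qpoch z q N) 0" for N
  obtain c where c: "P \<longlonglongrightarrow> c" "c \<noteq> 0"
    using qpoch_coeff_0_tendsto unfolding P_def by blast
  have P_nz: "P N \<noteq> 0" for N unfolding P_def by (rule qpoch_coeff_0_nonzero)
  have P_Suc: "P (Suc N) = P N * (1 - q ^ N * mfps_coeff z 0)" for N
    by (simp add: P_def mfps_coeff_0_qpoch)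
  define x where "x N = mfps_coeff (qpoch z q N) m" for N
  define D where "D = {p. fst p + snd p = m} - {(m, 0)}"
  define y where "y N = (\<Sum>p\<in>D. mfps_coeff (qpoch z q N) (fst p) * mfps_coeff z (snd p))" for N
  have step: "x (Suc N) = x N * (1 - q ^ N * mfps_coeff z 0) - q ^ N * y N" for N
  proof -
    have "x (Suc N) = x N - q ^ N * mfps_coeff (qpoch z q N * z) m"
      by (simp add: x_def qpoch_Suc right_diff_distrib mult.left_commute[of "qpoch z q N"])
    also have "mfps_coeff (qpoch z q N * z) m = x N * mfps_coeff z 0 + y N"
      unfolding mfps_coeff_mult x_def y_def D_def
      by (subst sum.remove[of _ "(m, 0)"]) (auto simp: finite_splits)
    finally show ?thesis by (simp add: algebra_simps)
  qed
  have "convergent y"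
    unfolding y_def
  proof (intro convergent_sum convergent_mult convergent_const)
    fix p assume "p \<in> D"
    then have p: "fst p + snd p = m" "snd p \<noteq> 0" by (cases p; auto simp: D_def)+
    then have "mweight (fst p) < mweight m"
      using mweight_split[OF p(1)] mweight_eq_0_iff[of "snd p"] by linarith
    then show "convergent (\<lambda>N. mfps_coeff (qpoch z q N) (fst p))" by (rule less)
  qed
  moreover have "(\<lambda>N. P (Suc N)) \<longlonglongrightarrow> c" using c(1) by (simp add: LIMSEQ_Suc)
  ultimately have "(\<lambda>N. y N / P (Suc N)) \<longlonglongrightarrow> lim y / c"
    using c(2) by (intro tendsto_divide) (simp_all add: convergent_LIMSEQ_iff)
  then have "Bseq (\<lambda>N. y N / P (Suc N))" by (intro convergent_imp_Bseq convergentI)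
  then obtain B where B: "norm (y N / P (Suc N)) \<le> B" for N
    by (rule BseqE) blast
  have "summable (\<lambda>N. q ^ N * (y N / P (Suc N)))"
  proof (rule summable_comparison_test')
    show "summable (\<lambda>N. norm q ^ N * B)" using norm_q by (intro summable_mult2 summable_geometric) simp
    show "norm (q ^ N * (y N / P (Suc N))) \<le> norm q ^ N * B" if "N \<ge> 0" for N
      unfolding norm_mult norm_power by (intro mult_left_mono B) simp
  qed
  then have conv_sum: "convergent (\<lambda>N. \<Sum>i<N. q ^ i * (y i / P (Suc i)))"
    by (simp add: summable_iff_convergent)
  have telescope: "x N / P N = x 0 / P 0 - (\<Sum>i<N. q ^ i * (y i / P (Suc i)))" for N
  proof (induction N)
    case (Suc N)
    have "x (Suc N) / P (Suc N) = x N / P N - q ^ N * (y N / P (Suc N))"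
      using P_nz[of "Suc N"] P_nz[of N] unfolding step P_Suc by (simp add: diff_divide_distrib)
    then show ?case using Suc.IH by simp
  qed simp
  have "convergent (\<lambda>N. x 0 / P 0 - (\<Sum>i<N. q ^ i * (y i / P (Suc i))))"
    by (intro convergent_diff convergent_const conv_sum)
  then have "convergent (\<lambda>N. x N / P N)"
    by (rule back_subst[of convergent]) (rule ext, rule telescope[symmetric])
  moreover have "convergent P" using c(1) by (rule convergentI)
  ultimately have "convergent (\<lambda>N. x N / P N * P N)" by (rule convergent_mult)
  then show ?case using P_nz by (simp add: x_def)
qed

lemma qpoch_inf_has_limit: "(\<lambda>N. qpoch z q N) \<longlonglongrightarrow> qpoch_inf z q"
  and mfps_coeff_0_qpoch_inf: "mfps_coeff (qpoch_inf z q) 0 \<noteq> 0"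
proof -
  define L where "L = Abs_mfps (\<lambda>m. lim (\<lambda>N. mfps_coeff (qpoch z q N) m))"
  have L: "(\<lambda>N. qpoch z q N) \<longlonglongrightarrow> L"
    unfolding tendsto_mfps_iff L_def Abs_mfps_inverse[OF UNIV_I]
    using qpoch_coeff_convergent by (simp add: convergent_LIMSEQ_iff)
  obtain c where "(\<lambda>N. mfps_coeff (qpoch z q N) 0) \<longlonglongrightarrow> c" "c \<noteq> 0"
    by (rule qpoch_coeff_0_tendsto)
  then have L0: "mfps_coeff L 0 \<noteq> 0"
    using L unfolding tendsto_mfps_iff by (metis LIMSEQ_unique)
  \<comment> \<open>\<open>has_prod\<close> takes the factors up to and including \<open>N\<close>,
    \<open>qpoch\<close> those before \<open>N\<close>.\<close>
  have "(\<lambda>N. qpoch z q (Suc N)) \<longlonglongrightarrow> L" using L by (rule LIMSEQ_Suc)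
  then have "(\<lambda>k. 1 - mfps_const (q ^ k) * z) has_prod L"
    unfolding has_prod_def raw_has_prod_def qpoch_def using L0 by (auto simp: lessThan_Suc_atMost)
  then have "qpoch_inf z q = L" unfolding qpoch_inf_def by (rule has_prod_unique[symmetric])
  then show "(\<lambda>N. qpoch z q N) \<longlonglongrightarrow> qpoch_inf z q" "mfps_coeff (qpoch_inf z q) 0 \<noteq> 0"
    using L L0 by simp_all
qed

lemma qpoch_inf_split: "qpoch_inf z q = qpoch z q k * qpoch_inf (mfps_const (q ^ k) * z) q"
proof -
  interpret shifted: qpoch_conv q "mfps_const (q ^ k) * z"
  proof
    show "q ^ j * mfps_coeff (mfps_const (q ^ k) * z) 0 \<noteq> 1" for j
      using nonzero[of "j + k"] by (simp add: power_add mult.assoc)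
  qed (rule norm_q)
  have "(\<lambda>N. qpoch z q k * qpoch (mfps_const (q ^ k) * z) q N) \<longlonglongrightarrow>
      qpoch z q k * qpoch_inf (mfps_const (q ^ k) * z) q"
    by (intro tendsto_mfps_mult tendsto_const shifted.qpoch_inf_has_limit)
  moreover have "(\<lambda>N. qpoch z q (k + N)) \<longlonglongrightarrow> qpoch_inf z q"
    using LIMSEQ_ignore_initial_segment[OF qpoch_inf_has_limit, of k] by (simp add: add.commute)
  ultimately show ?thesis unfolding qpoch_add by (metis LIMSEQ_unique)
qed

end

lemma locally_finite_power_series:
  assumes "mfps_coeff z 0 = (0::complex)"
  shows "locally_finite UNIV (\<lambda>k. c k * (z :: series) ^ k)"
proof (rule locally_finite_mult_left, rule locally_finite_mord)
  show "mord_ge k (z ^ k)" for k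
    using mord_ge_power[of 1 z k] assms by (simp add: mord_ge_1_iff)
qed (simp add: atMost_def[symmetric])

text \<open>Comparing consecutive coefficients, the series satisfies G(w) (1 - w) = (1 - t w) G(q
  w). Iterating N times leaves G(q^N z), which tends to G(0) = 1.\<close>

theorem q_binomial:
  fixes z :: series
  assumes q: "norm q < 1" "q \<noteq> 0" and z: "mfps_coeff z 0 = 0"
  shows "infsum (\<lambda>k. mfps_const (fin_qpoch q t k / fin_qpoch q q k) * z ^ k) UNIV * qpoch_inf z q =
    qpoch_inf (mfps_const t * z) q"
proof -
  define a where "a k = fin_qpoch q t k / fin_qpoch q q k" for k
  define G where "G w = infsum (\<lambda>k. mfps_const (a k) * w ^ k) UNIV" for w :: series
  have q_ne: "1 - q ^ Suc k \<noteq> 0" for k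
  proof
    assume "1 - q ^ Suc k = 0"
    then have "norm (q ^ Suc k) = norm (1 :: complex)" by simp
    then have "norm q ^ Suc k = 1" by (simp only: norm_power norm_one)
    then show False using q power_Suc_less_one[of "norm q" k] by simp
  qed
  have a_Suc: "a (Suc k) * (1 - q ^ Suc k) = a k * (1 - t * q ^ k)" for k
    using q_ne[of k] by (simp add: a_def fin_qpoch_Suc mult_ac)
  have step: "G w * (1 - w) = (1 - mfps_const t * w) * G (mfps_const q * w)"
    if w: "mfps_coeff w 0 = 0" for w
  proof -
    have lf: "locally_finite UNIV (\<lambda>k. c k * w ^ k)" for c by (rule locally_finite_power_series[OF w])
    have Gq: "G (mfps_const q * w) = infsum (\<lambda>k. mfps_const (a k * q ^ k) * w ^ k) UNIV"
      by (simp add: G_def power_mult_distrib mfps_const_power mfps_const_mult mult_ac)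
    have "G w - G (mfps_const q * w) = infsum (\<lambda>k. mfps_const (a k * (1 - q ^ k)) * w ^ k) UNIV"
    proof -
      have "infsum (\<lambda>k. mfps_const (a k * (1 - q ^ k)) * w ^ k) UNIV + G (mfps_const q * w) =
          infsum (\<lambda>k. mfps_const (a k * (1 - q ^ k)) * w ^ k + mfps_const (a k * q ^ k) * w ^ k) UNIV"
        unfolding Gq by (rule infsum_mfps_add[symmetric]) (rule lf)+
      also have "\<dots> = G w"
        unfolding G_def distrib_right[symmetric] mfps_const_add[symmetric] by (simp add: right_diff_distrib)
      finally show ?thesis by (simp add: algebra_simps)
    qed
    \<comment> \<open>The term k = 0 carries 1 - q^0 = 0, so the sum can be reindexed by
      \<open>Suc\<close>.\<close>
    also have "\<dots> = infsum (\<lambda>k. mfps_const (a k * (1 - q ^ k)) * w ^ k) (range Suc)"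
    proof (rule infsum_cong_neutral)
      fix k assume "k \<in> UNIV - range Suc"
      then have "k = 0" by (cases k) auto
      then show "mfps_const (a k * (1 - q ^ k)) * w ^ k = 0" by simp
    qed auto
    also have "\<dots> = infsum (\<lambda>k. mfps_const (a (Suc k) * (1 - q ^ Suc k)) * w ^ Suc k) UNIV"
      by (subst infsum_reindex) (auto simp: o_def)
    also have "\<dots> = infsum (\<lambda>k. w * (mfps_const (a k) * w ^ k) + (- (mfps_const t * w)) * (mfps_const (a k * q ^ k) * w ^ k)) UNIV"
      unfolding a_Suc by (rule infsum_cong) (simp add: right_diff_distrib mfps_const_diff mfps_const_mult algebra_simps)
    also have "\<dots> = w * G w + (- (mfps_const t * w)) * G (mfps_const q * w)"
      unfolding Gq unfolding G_def
      by (subst infsum_mfps_add) (intro locally_finite_mult_left lf infsum_mfps_cmult arg_cong2[of _ _ _ _ "(+)"])+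
    finally show ?thesis by (simp add: algebra_simps)
  qed
  have iter: "G z * qpoch z q N = qpoch (mfps_const t * z) q N * G (mfps_const (q ^ N) * z)" for N
  proof (induction N)
    case (Suc N)
    have "G z * qpoch z q (Suc N) =
        qpoch (mfps_const t * z) q N * (G (mfps_const (q ^ N) * z) * (1 - mfps_const (q ^ N) * z))"
      unfolding qpoch_Suc using Suc.IH by (simp only: mult.assoc[symmetric])
    also have "\<dots> = qpoch (mfps_const t * z) q (Suc N) * G (mfps_const (q ^ Suc N) * z)"
    proof -
      have "mfps_coeff (mfps_const (q ^ N) * z) 0 = 0" using z by simp
      from step[OF this] have "G (mfps_const (q ^ N) * z) * (1 - mfps_const (q ^ N) * z) =
          (1 - mfps_const (q ^ N) * (mfps_const t * z)) * G (mfps_const (q ^ Suc N) * z)"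
        by (simp add: mfps_const_mult mult.assoc mult.left_commute[of "mfps_const t"])
      then show ?thesis by (simp only: qpoch_Suc mult.assoc)
    qed
    finally show ?case .
  qed simp
  have G_lim: "(\<lambda>N. G (mfps_const (q ^ N) * z)) \<longlonglongrightarrow> 1"
    unfolding tendsto_mfps_iff
  proof
    fix m
    have eq: "mfps_coeff (G (mfps_const (q ^ N) * z)) m = (\<Sum>k\<le>mweight m. a k * ((q ^ k) ^ N * mfps_coeff (z ^ k) m))" for N
    proof -
      have z': "mfps_coeff (mfps_const (q ^ N) * z) 0 = 0" using z by simp
      have "mfps_coeff (G (mfps_const (q ^ N) * z)) m = infsum (\<lambda>k. mfps_coeff (mfps_const (a k) * (mfps_const (q ^ N) * z) ^ k) m) UNIV"
        unfolding G_def by (rule mfps_coeff_infsum[OF locally_finite_power_series[OF z']])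
      also have "\<dots> = infsum (\<lambda>k. a k * ((q ^ k) ^ N * mfps_coeff (z ^ k) m)) UNIV"
      proof -
        have "(mfps_const (q ^ N) * z) ^ k = mfps_const ((q ^ k) ^ N) * z ^ k" for k
          by (simp only: power_mult_distrib mfps_const_power[symmetric] power_mult[symmetric] mult.commute[of N])
        then show ?thesis by simp
      qed
      also have "\<dots> = infsum (\<lambda>k. a k * ((q ^ k) ^ N * mfps_coeff (z ^ k) m)) {..mweight m}"
      proof (rule infsum_cong_neutral)
        fix k assume "k \<in> UNIV - {..mweight m}"
        moreover have "mord_ge k (z ^ k)" using mord_ge_power[of 1 z k] z by (simp add: mord_ge_1_iff)
        ultimately show "a k * ((q ^ k) ^ N * mfps_coeff (z ^ k) m) = 0" by (simp add: mord_geD)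
      qed auto
      finally show ?thesis by simp
    qed
    have "(\<lambda>N. a k * ((q ^ k) ^ N * mfps_coeff (z ^ k) m)) \<longlonglongrightarrow> (if k = 0 then mfps_coeff 1 m else 0)" for k
    proof (cases k)
      case (Suc l)
      have "norm (q ^ k) = norm q ^ Suc l" by (simp only: Suc norm_power)
      then have "norm (q ^ k) < 1" using q power_Suc_less_one[of "norm q" l] by simp
      then have "(\<lambda>N. a k * ((q ^ k) ^ N * mfps_coeff (z ^ k) m)) \<longlonglongrightarrow> a k * (0 * mfps_coeff (z ^ k) m)"
        by (intro tendsto_intros LIMSEQ_power_zero)
      then show ?thesis using Suc by simp
    qed (simp add: a_def)
    then have "(\<lambda>N. \<Sum>k\<le>mweight m. a k * ((q ^ k) ^ N * mfps_coeff (z ^ k) m)) \<longlonglongrightarrow>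
        (\<Sum>k\<le>mweight m. if k = 0 then mfps_coeff 1 m else 0)"
      by (intro tendsto_sum)
    then show "(\<lambda>N. mfps_coeff (G (mfps_const (q ^ N) * z)) m) \<longlonglongrightarrow> mfps_coeff 1 m"
      by (simp add: eq)
  qed
  interpret z: qpoch_conv q z by standard (use q z in auto)
  interpret tz: qpoch_conv q "mfps_const t * z" by standard (use q z in auto)
  have "(\<lambda>N. qpoch (mfps_const t * z) q N * G (mfps_const (q ^ N) * z)) \<longlonglongrightarrow> qpoch_inf (mfps_const t * z) q * 1"
    by (intro tendsto_mfps_mult G_lim tz.qpoch_inf_has_limit)
  moreover have "(\<lambda>N. qpoch (mfps_const t * z) q N * G (mfps_const (q ^ N) * z)) \<longlonglongrightarrow> G z * qpoch_inf z q"
    unfolding iter[symmetric] by (intro tendsto_mfps_mult tendsto_const z.qpoch_inf_has_limit)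
  ultimately have "G z * qpoch_inf z q = qpoch_inf (mfps_const t * z) q * 1"
    using LIMSEQ_unique by blast
  then show ?thesis unfolding G_def a_def mult_1_right .
qed

section \<open>Recurrence in \<open>n\<close>\<close>

text \<open>What c_n requires of the ratios s_j / s_i: its denominators off the diagonal then have
  constant term 1, and those on the diagonal are constants.\<close>

definition admissible :: "(nat \<Rightarrow> nat \<Rightarrow> series) \<Rightarrow> bool"
  where "admissible r \<longleftrightarrow> (\<forall>i. r i i = 1) \<and> (\<forall>i j. i < j \<longrightarrow> mfps_coeff (r i j) 0 = 0)"

definition twist :: "(nat \<Rightarrow> complex) \<Rightarrow> (nat \<Rightarrow> nat \<Rightarrow> series) \<Rightarrow> nat \<Rightarrow> nat \<Rightarrow> series"
  where "twist c r i j = mfps_const (c j / c i) * r i j"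

lemma y_ratio_eq_twist: "y_ratio c = twist c x_ratio"
  by (simp add: y_ratio_def twist_def fun_eq_iff)

lemma twist_twist: "twist b (twist c r) = twist (\<lambda>i. b i * c i) r"
  by (simp add: twist_def fun_eq_iff mult.assoc[symmetric] flip: mfps_const_mult)

lemma admissible_twist: "admissible r \<Longrightarrow> (\<And>i. c i \<noteq> 0) \<Longrightarrow> admissible (twist c r)"
  by (simp add: admissible_def twist_def)

lemma mfps_coeff_0_var [simp]: "mfps_coeff (mfps_var v) 0 = 0"
  using lookup_single_eq[of v "1 :: nat"] by (auto simp: mfps_var.rep_eq simp del: lookup_single_eq)

lemma mfps_coeff_0_ratio:
  assumes "i < j"
  shows "mfps_coeff (x_ratio i j) 0 = 0" "mfps_coeff (s_ratio i j) 0 = 0"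
  using assms by (auto simp: x_ratio_def s_ratio_def mfps_coeff_0_prod intro!: prod_zero bexI[of _ i])

lemma admissible_x_ratio: "admissible x_ratio"
  using mfps_coeff_0_ratio(1) by (simp add: admissible_def x_ratio_def)

lemma mord_ge_s_ratio: "i < j \<Longrightarrow> mord_ge 1 (s_ratio i j)"
  using mfps_coeff_0_ratio(2) by (simp add: mord_ge_1_iff)

definition tuples :: "nat \<Rightarrow> (nat \<Rightarrow> nat) set"
  where "tuples n = {\<nu>. \<forall>i. i \<notin> {1..n} \<longrightarrow> \<nu> i = 0}"

definition s_monom :: "nat \<Rightarrow> (nat \<Rightarrow> nat \<Rightarrow> nat) \<Rightarrow> series"
  where "s_monom n \<theta> = (\<Prod>(i, j)\<in>index_pairs n. s_ratio i j ^ \<theta> i j)"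

definition last_monom :: "nat \<Rightarrow> (nat \<Rightarrow> nat) \<Rightarrow> series"
  where "last_monom n \<nu> = (\<Prod>i = 1..n. s_ratio i (Suc n) ^ \<nu> i)"

text \<open>The factor of \<open>c_coeff q t (Suc n) \<theta> r\<close> with \<open>k = Suc n\<close> and \<open>\<nu> i = \<theta> i (Suc n)\<close>.\<close>

definition step_coeff :: "complex \<Rightarrow> complex \<Rightarrow> nat \<Rightarrow> (nat \<Rightarrow> nat) \<Rightarrow> (nat \<Rightarrow> nat \<Rightarrow> series) \<Rightarrow> series"
  where "step_coeff q t n \<nu> r =
    (\<Prod>(i, j)\<in>{(i, j). 1 \<le> i \<and> i < j \<and> j \<le> Suc n}.
      qpoch (mfps_const t * r i j) q (\<nu> i) / qpoch (mfps_const q * r i j) q (\<nu> i)) *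
    (\<Prod>(i, j)\<in>{(i, j). 1 \<le> i \<and> i \<le> j \<and> j < Suc n}.
      qpoch (mfps_const (q powi (- int (\<nu> j)) * q / t) * r i j) q (\<nu> i) /
      qpoch (mfps_const (q powi (- int (\<nu> j))) * r i j) q (\<nu> i))"

text \<open>The f_n of the overview with the roles of x and s exchanged. The monomials are fixed to
  the formal s, since only the other argument is ever shifted.\<close>

definition psum :: "complex \<Rightarrow> complex \<Rightarrow> nat \<Rightarrow> (nat \<Rightarrow> nat \<Rightarrow> series) \<Rightarrow> series"
  where "psum q t n r = infsum (\<lambda>\<theta>. c_coeff q t n \<theta> r * s_monom n \<theta>) (strict_upper n)"

lemma index_pairs_Suc: "index_pairs (Suc n) = index_pairs n \<union> (\<lambda>i. (i, Suc n)) ` {1..n}"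
  by (auto simp: index_pairs_def)

lemma prod_index_pairs_Suc:
  "(\<Prod>(i, j)\<in>index_pairs (Suc n). f i j) = (\<Prod>(i, j)\<in>index_pairs n. f i j) * (\<Prod>i = 1..n. f i (Suc n))"
proof -
  have "index_pairs n \<inter> (\<lambda>i. (i, Suc n)) ` {1..n} = {}" by (auto simp: index_pairs_def)
  then show ?thesis
    unfolding index_pairs_Suc by (subst prod.union_disjoint) (auto simp: prod.reindex inj_on_def)
qed

lemma locally_finite_reindex:
  assumes "bij_betw g A B" "locally_finite B f"
  shows "locally_finite A (\<lambda>a. f (g a))"
  unfolding locally_finite_def
proof
  fix m
  have "g ` {a \<in> A. mfps_coeff (f (g a)) m \<noteq> 0} \<subseteq> {b \<in> B. mfps_coeff (f b) m \<noteq> 0}"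
    using assms(1) by (auto simp: bij_betw_def)
  moreover have "inj_on g {a \<in> A. mfps_coeff (f (g a)) m \<noteq> 0}"
    using assms(1) by (auto simp: bij_betw_def intro: inj_on_subset)
  ultimately show "finite {a \<in> A. mfps_coeff (f (g a)) m \<noteq> 0}"
    using locally_finiteD[OF assms(2)] by (meson finite_imageD finite_subset)
qed

text \<open>The order of the monomial is at least the sum of the entries of \<theta>, and only
  finitely many matrices have bounded entry sum.\<close>

lemma locally_finite_s_monom: "locally_finite (strict_upper n) (\<lambda>\<theta>. g \<theta> * s_monom n \<theta>)"
proof (rule locally_finite_mult_left, rule locally_finite_mord)
  show "mord_ge (\<Sum>(i, j)\<in>index_pairs n. \<theta> i j) (s_monom n \<theta>)" for \<theta>
    unfolding s_monom_def case_prod_unfold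
  proof (rule mord_ge_prod)
    fix p assume "p \<in> index_pairs n"
    then show "mord_ge (\<theta> (fst p) (snd p)) (s_ratio (fst p) (snd p) ^ \<theta> (fst p) (snd p))"
      using mord_ge_power[OF mord_ge_s_ratio, of "fst p" "snd p" "\<theta> (fst p) (snd p)"]
      by (auto simp: index_pairs_def)
  qed
  fix k :: nat
  let ?F = "{f. \<forall>p. (p \<in> index_pairs n \<longrightarrow> f p \<in> {..k}) \<and> (p \<notin> index_pairs n \<longrightarrow> f p = 0)}"
  have "{\<theta> \<in> strict_upper n. (\<Sum>(i, j)\<in>index_pairs n. \<theta> i j) \<le> k} \<subseteq> curry ` ?F"
  proof
    fix \<theta> assume \<theta>: "\<theta> \<in> {\<theta> \<in> strict_upper n. (\<Sum>(i, j)\<in>index_pairs n. \<theta> i j) \<le> k}"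
    have "\<theta> i j \<le> k" if "(i, j) \<in> index_pairs n" for i j
      using \<theta> member_le_sum[OF that, of "\<lambda>(i, j). \<theta> i j"] by auto
    then have "case_prod \<theta> \<in> ?F" using \<theta> by (auto simp: strict_upper_def index_pairs_def)
    moreover have "\<theta> = curry (case_prod \<theta>)" by simp
    ultimately show "\<theta> \<in> curry ` ?F" by blast
  qed
  moreover have "finite ?F" by (rule finite_set_of_finite_funs) auto
  ultimately show "finite {\<theta> \<in> strict_upper n. (\<Sum>(i, j)\<in>index_pairs n. \<theta> i j) \<le> k}"
    by (meson finite_imageI finite_subset)
qed

lemma locally_finite_tuples:
  assumes "\<And>i. i \<in> {1..n} \<Longrightarrow> mord_ge 1 (w i)"
  shows "locally_finite (tuples n) (\<lambda>\<nu>. g \<nu> * (\<Prod>i = 1..n. w i ^ \<nu> i :: series))"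
proof (rule locally_finite_mult_left, rule locally_finite_mord)
  show "mord_ge (\<Sum>i = 1..n. \<nu> i) (\<Prod>i = 1..n. w i ^ \<nu> i)" for \<nu>
  proof (rule mord_ge_prod)
    fix i assume "i \<in> {1..n}"
    then show "mord_ge (\<nu> i) (w i ^ \<nu> i)"
      using mord_ge_power[OF assms, of i "\<nu> i"] by simp
  qed
  fix k :: nat
  let ?F = "{f. \<forall>i. (i \<in> {1..n} \<longrightarrow> f i \<in> {..k}) \<and> (i \<notin> {1..n} \<longrightarrow> f i = 0)}"
  have "{\<nu> \<in> tuples n. (\<Sum>i = 1..n. \<nu> i) \<le> k} \<subseteq> ?F"
  proof
    fix \<nu> assume \<nu>: "\<nu> \<in> {\<nu> \<in> tuples n. (\<Sum>i = 1..n. \<nu> i) \<le> k}"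
    have "\<nu> i \<le> k" if "i \<in> {1..n}" for i
      using \<nu> member_le_sum[OF that, of \<nu>] by auto
    then show "\<nu> \<in> ?F" using \<nu> by (auto simp: tuples_def)
  qed
  moreover have "finite ?F" by (rule finite_set_of_finite_funs) auto
  ultimately show "finite {\<nu> \<in> tuples n. (\<Sum>i = 1..n. \<nu> i) \<le> k}"
    by (meson finite_subset)
qed

lemma locally_finite_last_monom: "locally_finite (tuples n) (\<lambda>\<nu>. g \<nu> * last_monom n \<nu>)"
  unfolding last_monom_def by (rule locally_finite_tuples) (simp add: mord_ge_s_ratio del: One_nat_def)

lemma c_coeff_cong:
  assumes "\<And>i j. j \<le> n \<Longrightarrow> \<theta> i j = \<theta>' i j" and "\<And>i j. 1 \<le> i \<Longrightarrow> i \<le> j \<Longrightarrow> j \<le> n \<Longrightarrow> r i j = r' i j"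
  shows "c_coeff q t n \<theta> r = c_coeff q t n \<theta>' r'"
proof -
  have "tail_diff n \<theta> k i j = tail_diff n \<theta>' k i j" for k i j
    unfolding tail_diff_def using assms(1) by (intro sum.cong) auto
  then show ?thesis
    unfolding c_coeff_def using assms
    by (intro arg_cong2[of _ _ _ _ "(*)"] prod.cong refl) auto
qed

text \<open>For k \<le> n the tail sums contain \<nu>_i - \<nu>_j from the last column, and
  q^(\<nu>_i - \<nu>_j) s_j / s_i is a ratio of the vector q^-\<nu> s; hence the
  \<open>twist\<close>.\<close>

lemma c_coeff_Suc:
  assumes "q \<noteq> 0"
  shows "c_coeff q t (Suc n) \<theta> r = step_coeff q t n (\<lambda>i. \<theta> i (Suc n)) r *
    c_coeff q t n \<theta> (twist (\<lambda>i. q powi (- int (\<theta> i (Suc n)))) r)"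
\<comment> \<open>For n = 0 the index k = n + 1 = 1 lies outside the range of k, but the factor it
  would contribute is an empty product.\<close>
proof (cases "n = 0")
  case True
  have empty: "{(i, j). 1 \<le> i \<and> i < j \<and> j \<le> Suc 0} = {}" "{(i, j). 1 \<le> i \<and> i \<le> j \<and> j < Suc 0} = {}"
    by auto
  show ?thesis unfolding True c_coeff_def step_coeff_def empty by simp
next
  case False
  then have K: "{2..Suc n} = insert (Suc n) {2..n}" by auto
  have last: "tail_diff (Suc n) \<theta> (Suc n) i j = 0" for i j by (simp add: tail_diff_def)
  have rest: "mfps_const (q powi (e + tail_diff (Suc n) \<theta> k i j) * x) * r i j =
      mfps_const (q powi (e + tail_diff n \<theta> k i j) * x) * twist (\<lambda>i. q powi (- int (\<theta> i (Suc n)))) r i j"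
    if "k \<in> {2..n}" for e k i j x
  proof -
    have "{k + 1..Suc n} = insert (Suc n) {k + 1..n}" using that by auto
    then have "tail_diff (Suc n) \<theta> k i j = (int (\<theta> i (Suc n)) - int (\<theta> j (Suc n))) + tail_diff n \<theta> k i j"
      by (simp add: tail_diff_def)
    then have "e + tail_diff (Suc n) \<theta> k i j = (e + tail_diff n \<theta> k i j) + (- int (\<theta> j (Suc n)) - (- int (\<theta> i (Suc n))))"
      by simp
    then have "q powi (e + tail_diff (Suc n) \<theta> k i j) =
        q powi (e + tail_diff n \<theta> k i j) * (q powi (- int (\<theta> j (Suc n))) / q powi (- int (\<theta> i (Suc n))))"
      using assms by (simp only: power_int_add power_int_diff simp_thms)
    then show ?thesis by (simp only: twist_def mfps_const_mult mult_ac)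
  qed
  have rest0: "mfps_const (q powi tail_diff (Suc n) \<theta> k i j * x) * r i j =
      mfps_const (q powi tail_diff n \<theta> k i j * x) * twist (\<lambda>i. q powi (- int (\<theta> i (Suc n)))) r i j"
    if "k \<in> {2..n}" for k i j x
    using rest[OF that, of 0 i j x] by simp
  have rest1: "mfps_const (q powi (tail_diff (Suc n) \<theta> k i j - int e)) * r i j =
      mfps_const (q powi (tail_diff n \<theta> k i j - int e)) * twist (\<lambda>i. q powi (- int (\<theta> i (Suc n)))) r i j"
    if "k \<in> {2..n}" for e k i j
    using rest[OF that, of "- int e" i j 1] by simp
  have rest2: "mfps_const (q powi (tail_diff (Suc n) \<theta> k i j - int e) * q / t) * r i j =
      mfps_const (q powi (tail_diff n \<theta> k i j - int e) * q / t) * twist (\<lambda>i. q powi (- int (\<theta> i (Suc n)))) r i j"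
    if "k \<in> {2..n}" for e k i j
    using rest[OF that, of "- int e" i j "q / t"] by simp
  have "c_coeff q t (Suc n) \<theta> r = step_coeff q t n (\<lambda>i. \<theta> i (Suc n)) r *
    ((\<Prod>k = 2..n. \<Prod>(i, j) \<in> {(i, j). 1 \<le> i \<and> i < j \<and> j \<le> k}.
        qpoch (mfps_const (q powi tail_diff (Suc n) \<theta> k i j * t) * r i j) q (\<theta> i k) /
        qpoch (mfps_const (q powi tail_diff (Suc n) \<theta> k i j * q) * r i j) q (\<theta> i k)) *
    (\<Prod>k = 2..n. \<Prod>(i, j) \<in> {(i, j). 1 \<le> i \<and> i \<le> j \<and> j < k}.
        qpoch (mfps_const (q powi (- int (\<theta> j k) + tail_diff (Suc n) \<theta> k i j) * q / t) * r i j) q (\<theta> i k) /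
        qpoch (mfps_const (q powi (- int (\<theta> j k) + tail_diff (Suc n) \<theta> k i j)) * r i j) q (\<theta> i k)))"
    unfolding c_coeff_def K step_coeff_def by (simp add: last mult_ac)
  also have "\<dots> = step_coeff q t n (\<lambda>i. \<theta> i (Suc n)) r * c_coeff q t n \<theta> (twist (\<lambda>i. q powi (- int (\<theta> i (Suc n)))) r)"
    unfolding c_coeff_def
    by (intro arg_cong2[of _ _ _ _ "(*)"] prod.cong refl) (auto simp: rest0 rest1 rest2)
  finally show ?thesis .
qed

lemma psum_Suc:
  assumes "q \<noteq> 0"
  shows "psum q t (Suc n) r = infsum (\<lambda>\<nu>. step_coeff q t n \<nu> r *
    psum q t n (twist (\<lambda>i. q powi (- int (\<nu> i))) r) * last_monom n \<nu>) (tuples n)"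
proof -
  define join where "join = (\<lambda>(\<nu> :: nat \<Rightarrow> nat, \<theta> :: nat \<Rightarrow> nat \<Rightarrow> nat) i j. if j = Suc n then \<nu> i else \<theta> i j)"
  define G where "G \<nu> \<theta> = step_coeff q t n \<nu> r * last_monom n \<nu> *
    (c_coeff q t n \<theta> (twist (\<lambda>i. q powi (- int (\<nu> i))) r) * s_monom n \<theta>)" for \<nu> \<theta>
  have bij: "bij_betw join (tuples n \<times> strict_upper n) (strict_upper (Suc n))"
  proof (rule bij_betw_byWitness[where f' = "\<lambda>\<theta>. (\<lambda>i. \<theta> i (Suc n), \<lambda>i j. if j = Suc n then 0 else \<theta> i j)"])
    show "\<forall>p\<in>tuples n \<times> strict_upper n. (\<lambda>i. join p i (Suc n), \<lambda>i j. if j = Suc n then 0 else join p i j) = p"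
      by (auto simp: join_def strict_upper_def fun_eq_iff)
    show "\<forall>\<theta>\<in>strict_upper (Suc n). join (\<lambda>i. \<theta> i (Suc n), \<lambda>i j. if j = Suc n then 0 else \<theta> i j) = \<theta>"
      by (auto simp: join_def fun_eq_iff)
    show "join ` (tuples n \<times> strict_upper n) \<subseteq> strict_upper (Suc n)"
      by (auto simp: join_def strict_upper_def tuples_def)
    show "(\<lambda>\<theta>. (\<lambda>i. \<theta> i (Suc n), \<lambda>i j. if j = Suc n then 0 else \<theta> i j)) ` strict_upper (Suc n) \<subseteq> tuples n \<times> strict_upper n"
      by (auto simp: strict_upper_def tuples_def)
  qed
  have summand: "c_coeff q t (Suc n) (join (\<nu>, \<theta>)) r * s_monom (Suc n) (join (\<nu>, \<theta>)) = G \<nu> \<theta>" for \<nu> \<theta>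
  proof -
    have "c_coeff q t n (join (\<nu>, \<theta>)) r' = c_coeff q t n \<theta> r'" for r'
      by (rule c_coeff_cong) (auto simp: join_def)
    moreover have "(\<lambda>i. join (\<nu>, \<theta>) i (Suc n)) = \<nu>" by (simp add: join_def)
    moreover have "s_monom (Suc n) (join (\<nu>, \<theta>)) = s_monom n \<theta> * last_monom n \<nu>"
      unfolding s_monom_def last_monom_def prod_index_pairs_Suc
      by (intro arg_cong2[of _ _ _ _ "(*)"] prod.cong refl) (auto simp: join_def index_pairs_def)
    ultimately show ?thesis
      unfolding c_coeff_Suc[OF assms] G_def by (simp add: mult_ac join_def)
  qed
  have lf: "locally_finite (tuples n \<times> strict_upper n) (\<lambda>(\<nu>, \<theta>). G \<nu> \<theta>)"
    using locally_finite_reindex[OF bij locally_finite_s_monom[of "Suc n" "\<lambda>\<theta>. c_coeff q t (Suc n) \<theta> r"]]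
    by (rule locally_finite_cong[THEN iffD1, rotated]) (auto simp: summand)
  have "psum q t (Suc n) r = infsum (\<lambda>p. c_coeff q t (Suc n) (join p) r * s_monom (Suc n) (join p)) (tuples n \<times> strict_upper n)"
    unfolding psum_def by (rule infsum_reindex_bij_betw[OF bij, symmetric])
  also have "\<dots> = infsum (\<lambda>(\<nu>, \<theta>). G \<nu> \<theta>) (tuples n \<times> strict_upper n)"
    by (rule infsum_cong) (auto simp: summand)
  also have "\<dots> = infsum (\<lambda>\<nu>. infsum (G \<nu>) (strict_upper n)) (tuples n)"
    by (rule infsum_mfps_Times[OF lf])
  also have "\<dots> = infsum (\<lambda>\<nu>. step_coeff q t n \<nu> r * psum q t n (twist (\<lambda>i. q powi (- int (\<nu> i))) r) * last_monom n \<nu>) (tuples n)"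
    unfolding G_def psum_def by (subst infsum_mfps_cmult[OF locally_finite_s_monom]) (simp add: mult_ac)
  finally show ?thesis .
qed

lemma psum_0 [simp]: "psum q t 0 r = 1"
proof -
  have "strict_upper 0 = {\<lambda>_ _. 0}" by (auto simp: strict_upper_def fun_eq_iff)
  moreover have "index_pairs 0 = {}" by (auto simp: index_pairs_def)
  ultimately show ?thesis by (simp add: psum_def c_coeff_def s_monom_def)
qed

lemma psum_cong:
  assumes "\<And>i j. 1 \<le> i \<Longrightarrow> i \<le> j \<Longrightarrow> j \<le> n \<Longrightarrow> r i j = r' i j"
  shows "psum q t n r = psum q t n r'"
  unfolding psum_def using c_coeff_cong[OF refl assms] by (intro infsum_cong arg_cong2[of _ _ _ _ "(*)"]) auto

section \<open>Denominators and rescaling for complex parameters\<close>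

locale qt_series =
  fixes q t :: complex
  assumes q_nz: "q \<noteq> 0" and norm_q: "norm q < 1" and t_nz: "t \<noteq> 0"
begin

lemma q_powi_ne_1: "m \<noteq> 0 \<Longrightarrow> q powi m \<noteq> 1"
proof
  assume m: "m \<noteq> 0" and eq: "q powi m = 1"
  have *: "q ^ Suc k \<noteq> 1" for k
  proof
    assume "q ^ Suc k = 1"
    then have "norm (q ^ Suc k) = norm (1 :: complex)" by (rule arg_cong)
    then have "norm q ^ Suc k = 1" by (simp only: norm_power norm_one)
    then show False using norm_q q_nz power_Suc_less_one[of "norm q" k] by simp
  qed
  show False
  proof (cases m)
    case (nonneg k)
    then obtain l where "k = Suc l" using m by (cases k) auto
    then have "q powi m = q ^ Suc l" unfolding nonneg by (simp only: power_int_of_nat)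
    then show False using *[of l] eq by simp
  next
    case (neg k)
    have "q powi m = inverse (q ^ Suc k)" unfolding neg power_int_minus power_int_of_nat ..
    then show False using *[of k] eq by (metis inverse_1 inverse_inverse_eq)
  qed
qed

lemma denominator_off_diagonal:
  assumes "admissible r" "i < j"
  shows "mfps_coeff (qpoch (mfps_const e * r i j) q k) 0 = 1"
  using assms by (simp add: mfps_coeff_0_qpoch admissible_def)

text \<open>The exponents of q run from -k to -1 and stop short of 0.\<close>

lemma denominator_diagonal: "mfps_coeff (qpoch (mfps_const (q powi (- int k))) q k) 0 \<noteq> 0"
proof -
  have "1 - q ^ i * q powi (- int k) \<noteq> 0" if "i < k" for i
    using q_powi_ne_1[of "int i - int k"] that q_nz by (simp add: power_int_diff power_int_minus field_simps)
  then show ?thesis by (simp add: mfps_coeff_0_qpoch mfps_coeff_const)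
qed

lemma denominator:
  assumes "admissible r" "i \<le> j"
  shows "mfps_coeff (qpoch (mfps_const (q powi (- int (\<theta> j k) + tail_diff n \<theta> k i j)) * r i j) q (\<theta> i k)) 0 \<noteq> 0"
proof (cases "i = j")
  case True
  then show ?thesis
    using denominator_diagonal assms by (simp add: admissible_def tail_diff_def)
next
  case False
  then show ?thesis using denominator_off_diagonal[OF assms(1)] assms(2) by simp
qed

lemma mfps_scale_c_coeff:
  assumes "admissible r"
  shows "mfps_scale a (c_coeff q t n \<theta> r) = c_coeff q t n \<theta> (\<lambda>i j. mfps_scale a (r i j))"
  unfolding c_coeff_def mfps_scale_mult mfps_scale_prod case_prod_unfold
  by (intro arg_cong2[of _ _ _ _ "(*)"] prod.cong refl)
    (use denominator_off_diagonal[OF assms] denominator[OF assms] in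
      \<open>auto simp: mfps_scale_divide mfps_scale_qpoch mfps_scale_mult\<close>)

lemma mfps_scale_s_ratio: "(\<And>i. a (SVar i) = 1) \<Longrightarrow> mfps_scale a (s_ratio i j) = s_ratio i j"
  by (simp add: s_ratio_def mfps_scale_prod mfps_scale_var)

lemma mfps_scale_psum:
  assumes "admissible r" and a: "\<And>i. a (SVar i) = 1"
  shows "mfps_scale a (psum q t n r) = psum q t n (\<lambda>i j. mfps_scale a (r i j))"
  unfolding psum_def mfps_scale_infsum[OF locally_finite_s_monom]
  by (intro infsum_cong)
    (simp add: mfps_scale_mult mfps_scale_c_coeff[OF assms(1)] s_monom_def mfps_scale_prod
      mfps_scale_power mfps_scale_s_ratio a case_prod_unfold)

end

section \<open>The difference equation\<close>

definition bser :: "complex \<Rightarrow> complex \<Rightarrow> series \<Rightarrow> series"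
  where "bser q t z = ((1 - mfps_const t * z) * (1 - mfps_const (q / t) * z)) / ((1 - z) * (1 - mfps_const q * z))"

definition bcoeff :: "complex \<Rightarrow> complex \<Rightarrow> (nat \<Rightarrow> nat \<Rightarrow> series) \<Rightarrow> nat \<Rightarrow> series"
  where "bcoeff q t r i = (\<Prod>j = 1..<i. bser q t (r j i))"

lemma prod_weak_index_pairs:
  "(\<Prod>(i, j)\<in>{(i, j). 1 \<le> i \<and> i \<le> j \<and> j < Suc n}. f i j) =
    (\<Prod>(i, j)\<in>index_pairs n. f i j) * (\<Prod>i = 1..n. f i i)"
proof -
  have "{(i, j). 1 \<le> i \<and> i \<le> j \<and> j < Suc n} = index_pairs n \<union> (\<lambda>i. (i, i)) ` {1..n}"
    by (auto simp: index_pairs_def)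
  moreover have "index_pairs n \<inter> (\<lambda>i. (i, i)) ` {1..n} = {}" by (auto simp: index_pairs_def)
  ultimately show ?thesis
    by (simp only:) (subst prod.union_disjoint, auto simp: prod.reindex inj_on_def)
qed

lemma mfps_var_nonzero: "mfps_var v \<noteq> (0 :: ('v, 'a::comm_ring_1) mfps)"
proof
  assume "mfps_var v = (0 :: ('v, 'a) mfps)"
  then have "mfps_coeff (mfps_var v :: ('v, 'a) mfps) (Poly_Mapping.single v 1) = 0"
    by (simp add: zero_mfps.rep_eq)
  then show False by (simp add: mfps_var.rep_eq)
qed

lemma x_ratio_nonzero: "x_ratio i j \<noteq> 0" and s_ratio_nonzero: "s_ratio i j \<noteq> 0"
  by (simp_all add: x_ratio_def s_ratio_def mfps_var_nonzero)

lemma x_ratio_mult: "i \<le> j \<Longrightarrow> j \<le> k \<Longrightarrow> x_ratio i j * x_ratio j k = x_ratio i k"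
  and s_ratio_mult: "i \<le> j \<Longrightarrow> j \<le> k \<Longrightarrow> s_ratio i j * s_ratio j k = s_ratio i k"
  unfolding x_ratio_def s_ratio_def by (rule prod.atLeastLessThan_concat; assumption)+

context qt_series
begin

sublocale num: qt_field q t
  by standard (use q_nz t_nz q_powi_ne_1 in auto)

text \<open>
  In the field of fractions the ratios \<open>y_ratio c i j\<close> become quotients of actual points, which makes the
  identities between \<open>step_fac\<close>'s available.
\<close>

definition qK :: "series fract" where "qK = to_fract (mfps_const q)"
definition tK :: "series fract" where "tK = to_fract (mfps_const t)"

text \<open>Normalised by x_1 = 1, as \<open>x_ratio 1 i\<close> is a series; quotients of points do
  not depend on the normalisation.\<close>

definition points :: "(nat \<Rightarrow> complex) \<Rightarrow> nat \<Rightarrow> series fract"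
  where "points c i = to_fract (mfps_const (c i) * x_ratio 1 i)"

lemma to_fract_const_inverse: "to_fract (mfps_const (inverse a) :: series) = inverse (to_fract (mfps_const a))"
proof (cases "a = 0")
  case False
  then have "to_fract (mfps_const a :: series) * to_fract (mfps_const (inverse a)) = 1"
    by (simp flip: to_fract_mult mfps_const_mult)
  then show ?thesis by (metis inverse_unique)
qed simp

lemma to_fract_const_divide:
  "to_fract (mfps_const (a / b) :: series) = to_fract (mfps_const a) / to_fract (mfps_const b)"
  by (simp add: divide_inverse mfps_const_mult to_fract_const_inverse)

lemma to_fract_const_powi: "to_fract (mfps_const (q powi m)) = qK powi m"
  by (cases m) (simp_all only: power_int_of_nat power_int_minus to_fract_const_inverse mfps_const_power to_fract_power qK_def)

lemma const_eq_1_iff: "mfps_const a = (1 :: series) \<longleftrightarrow> a = 1"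
proof
  assume "mfps_const a = (1 :: series)"
  then have "mfps_coeff (mfps_const a :: series) 0 = mfps_coeff (1 :: series) 0" by (rule arg_cong)
  then show "a = 1" by (simp add: mfps_coeff_const mfps_coeff_1)
qed simp

lemma const_eq_0_iff: "mfps_const a = (0 :: series) \<longleftrightarrow> a = 0"
proof
  assume "mfps_const a = (0 :: series)"
  then have "mfps_coeff (mfps_const a :: series) 0 = mfps_coeff (0 :: series) 0" by (rule arg_cong)
  then show "a = 0" by (simp add: mfps_coeff_const)
qed simp

sublocale K: qt_field qK tK
proof
  show "qK \<noteq> 0" "tK \<noteq> 0"
    using q_nz t_nz by (simp_all add: qK_def tK_def const_eq_0_iff)
  show "qK powi m \<noteq> 1" if "m \<noteq> 0" for m
    using q_powi_ne_1[OF that] const_eq_1_iff[of "q powi m"]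
    unfolding to_fract_const_powi[symmetric] to_fract_1[symmetric] to_fract_eq_iff by simp
qed

lemma points_nonzero: "c i \<noteq> 0 \<Longrightarrow> points c i \<noteq> 0"
  by (simp add: points_def const_eq_0_iff x_ratio_nonzero)

lemma to_fract_y_ratio:
  assumes "1 \<le> i" "i \<le> j" "c i \<noteq> 0"
  shows "to_fract (y_ratio c i j) = points c j / points c i"
proof -
  have "y_ratio c i j * (mfps_const (c i) * x_ratio 1 i) =
      (mfps_const (c j / c i) * mfps_const (c i)) * (x_ratio 1 i * x_ratio i j)"
    by (simp only: y_ratio_def mult_ac)
  also have "mfps_const (c j / c i) * mfps_const (c i) = mfps_const (c j)"
    using assms by (simp flip: mfps_const_mult)
  also have "x_ratio 1 i * x_ratio i j = x_ratio 1 j" using assms by (intro x_ratio_mult) auto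
  finally have "to_fract (y_ratio c i j) * points c i = points c j"
    unfolding points_def to_fract_mult[symmetric] by simp
  then show ?thesis using points_nonzero[of c i] assms(3) by (simp add: field_simps)
qed

text \<open>For i < j the quotient y_j / y_i is a series without constant term, so no multiple of it
  by q^m equals 1; the other quotients are inverses of these.\<close>

lemma points_gen:
  assumes c: "\<And>i. c i \<noteq> 0" and ij: "1 \<le> i" "1 \<le> j" "i \<noteq> j"
  shows "K.gen (points c i / points c j)"
proof -
  have less: "K.gen (points c j / points c i)" if "1 \<le> i" "i < j" for i j
    unfolding K.gen_def
  proof safe
    assume "points c j / points c i = 0"
    then show False using points_nonzero c by simp
  next
    fix m assume "qK powi m * (points c j / points c i) = 1"
    then have "to_fract (mfps_const (q powi m) * y_ratio c i j) = to_fract 1"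
      using that c to_fract_y_ratio[of i j c] by (simp add: to_fract_const_powi)
    then have "mfps_const (q powi m) * y_ratio c i j = 1" by (simp only: to_fract_eq_iff)
    then have "mfps_coeff (mfps_const (q powi m) * y_ratio c i j) 0 = mfps_coeff (1 :: series) 0" by (rule arg_cong)
    then show False using that mfps_coeff_0_ratio[of i j] by (simp add: y_ratio_def mfps_coeff_1)
  qed
  show ?thesis
  proof (cases "i < j")
    case True
    then show ?thesis using K.gen_inverse[OF less[of i j]] ij by simp
  next
    case False
    then show ?thesis using less[of j i] ij by simp
  qed
qed

lemma admissible_y_ratio: "(\<And>i. c i \<noteq> 0) \<Longrightarrow> admissible (y_ratio c)"
  unfolding y_ratio_eq_twist by (intro admissible_twist admissible_x_ratio)

lemma to_fract_qpoch: "to_fract (qpoch z q k) = fin_qpoch qK (to_fract z) k"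
  by (simp add: qpoch_eq_fin_qpoch fin_qpoch_def qK_def to_fract_prod to_fract_power)

lemma to_fract_step_coeff:
  assumes c: "\<And>i. c i \<noteq> 0"
  shows "to_fract (step_coeff q t n \<nu> (y_ratio c)) = K.step_fac n \<nu> (points c)"
proof -
  let ?r = "y_ratio c"
  have adm: "admissible ?r" by (rule admissible_y_ratio[OF c])
  define p1 where "p1 i j = qpoch (mfps_const t * ?r i j) q (\<nu> i) / qpoch (mfps_const q * ?r i j) q (\<nu> i)" for i j
  define p2 where "p2 i j = qpoch (mfps_const (q powi (- int (\<nu> j)) * q / t) * ?r i j) q (\<nu> i) /
      qpoch (mfps_const (q powi (- int (\<nu> j))) * ?r i j) q (\<nu> i)" for i j
  have p1: "to_fract (p1 i j) = K.lastfac (\<nu> i) (points c j / points c i)" if "1 \<le> i" "i < j" for i j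
    using that c to_fract_y_ratio[of i j c] denominator_off_diagonal[OF adm that(2)]
    by (simp add: p1_def to_fract_divide to_fract_qpoch K.lastfac_def flip: qK_def tK_def)
  have p2: "to_fract (p2 i j) = fin_qpoch qK (qK powi (- int (\<nu> j)) * qK / tK * (points c j / points c i)) (\<nu> i) /
      fin_qpoch qK (qK powi (- int (\<nu> j)) * (points c j / points c i)) (\<nu> i)" if "1 \<le> i" "i < j" for i j
    using that c to_fract_y_ratio[of i j c] denominator_off_diagonal[OF adm that(2)]
    by (simp add: p2_def to_fract_divide to_fract_qpoch to_fract_const_divide mfps_const_mult to_fract_const_powi flip: qK_def tK_def)
  have p2_diag: "to_fract (p2 i i) = K.diagfac (\<nu> i)" for i
    using denominator_diagonal adm
    by (simp add: p2_def to_fract_divide to_fract_qpoch to_fract_const_divide mfps_const_mult to_fract_const_powi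
        K.diagfac_def admissible_def flip: qK_def tK_def)
  have "step_coeff q t n \<nu> ?r = (\<Prod>(i, j)\<in>index_pairs n. p1 i j) * (\<Prod>i = 1..n. p1 i (Suc n)) *
     ((\<Prod>(i, j)\<in>index_pairs n. p2 i j) * (\<Prod>i = 1..n. p2 i i))"
    unfolding step_coeff_def p1_def[symmetric] p2_def[symmetric] prod_weak_index_pairs
      index_pairs_def[of "Suc n", symmetric] prod_index_pairs_Suc ..
  also have "\<dots> = (\<Prod>i = 1..n. p2 i i * p1 i (Suc n)) * (\<Prod>(i, j)\<in>index_pairs n. p1 i j * p2 i j)"
    by (simp add: prod.distrib case_prod_unfold mult_ac)
  finally show ?thesis
    unfolding K.step_fac_def
    by (simp only: to_fract_mult to_fract_prod case_prod_unfold)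
      (intro arg_cong2[of _ _ _ _ "(*)"] prod.cong refl,
        auto simp: p1 p2 p2_diag K.pairfac_def K.lastfac_def index_pairs_def)
qed

lemma to_fract_bser:
  assumes "mfps_coeff z 0 = 0"
  shows "to_fract (bser q t z) = K.bfac (to_fract z)"
proof -
  have "mfps_coeff ((1 - z) * (1 - mfps_const q * z)) 0 \<noteq> 0"
    using assms by (simp add: mfps_coeff_0_mult mfps_coeff_1)
  then show ?thesis
    unfolding bser_def K.bfac_def by (simp add: to_fract_divide to_fract_const_divide qK_def tK_def)
qed

lemma to_fract_bcoeff:
  assumes c: "\<And>i. c i \<noteq> 0"
  shows "to_fract (bcoeff q t (y_ratio c) i) = K.bprod (points c) i"
  unfolding bcoeff_def K.bprod_def to_fract_prod
proof (rule prod.cong)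
  fix j assume j: "j \<in> {1..<i}"
  then have "mfps_coeff (y_ratio c j i) 0 = 0" using admissible_y_ratio[OF c] by (simp add: admissible_def)
  then show "to_fract (bser q t (y_ratio c j i)) = K.bfac (points c i / points c j)"
    using j c to_fract_y_ratio[of j i c] by (simp add: to_fract_bser)
qed simp

lemma points_shift: "points (c(i := q * c i)) = (points c)(i := qK * points c i)"
  by (auto simp: points_def qK_def mfps_const_mult mult_ac fun_eq_iff)

definition qshift :: "(nat \<Rightarrow> nat) \<Rightarrow> (nat \<Rightarrow> complex) \<Rightarrow> nat \<Rightarrow> complex"
  where "qshift \<nu> c i = q powi (- int (\<nu> i)) * c i"

lemma points_qshift: "points (qshift \<nu> c) = K.shifted \<nu> (points c)"
  by (auto simp: points_def qshift_def K.shifted_def mfps_const_mult mult.assoc fun_eq_iff simp flip: to_fract_const_powi)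

lemma qshift_nonzero: "c i \<noteq> 0 \<Longrightarrow> qshift \<nu> c i \<noteq> 0"
  using q_nz by (simp add: qshift_def)

lemma twist_y_ratio: "twist (\<lambda>i. q powi (- int (\<nu> i))) (y_ratio c) = y_ratio (qshift \<nu> c)"
  by (simp add: y_ratio_eq_twist twist_twist qshift_def[abs_def])

lemma upd_nonzero: "(\<And>i. c i \<noteq> 0) \<Longrightarrow> (c(k := q * c k)) i \<noteq> 0"
  using q_nz by simp

lemma step_coeff_source_identity:
  assumes c: "\<And>i. c i \<noteq> 0"
  shows "(\<Sum>i = 1..n. bcoeff q t (y_ratio c) i * step_coeff q t n (\<nu>(i := Suc (\<nu> i))) (y_ratio (c(i := q * c i))) -
      step_coeff q t n (\<nu>(i := Suc (\<nu> i))) (y_ratio c) * bcoeff q t (y_ratio (qshift (\<nu>(i := Suc (\<nu> i))) c)) i) +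
    bcoeff q t (y_ratio c) (Suc n) * step_coeff q t n \<nu> (y_ratio (c(Suc n := q * c (Suc n)))) =
    step_coeff q t n \<nu> (y_ratio c)"
proof -
  note nz = c upd_nonzero[of c, OF c] qshift_nonzero[OF c]
  have pts: "points c i \<noteq> 0" for i by (rule points_nonzero[OF c])
  have gen: "K.gen (points c i / points c j)" if "i \<in> {1..Suc n}" "j \<in> {1..Suc n}" "i \<noteq> j" for i j
    using points_gen[of c i j, OF c] that by simp
  have "(\<Sum>i = 1..n. K.bprod (points c) i * K.step_fac n (\<nu>(i := Suc (\<nu> i))) ((points c)(i := qK * points c i)) -
      K.step_fac n (\<nu>(i := Suc (\<nu> i))) (points c) * K.bprod (K.shifted (\<nu>(i := Suc (\<nu> i))) (points c)) i) +
    K.bprod (points c) (Suc n) * K.step_fac n \<nu> ((points c)(Suc n := qK * points c (Suc n))) =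
    K.step_fac n \<nu> (points c)"
    by (rule K.step_fac_source_identity) (use pts gen in auto)
  then have "to_fract ((\<Sum>i = 1..n. bcoeff q t (y_ratio c) i * step_coeff q t n (\<nu>(i := Suc (\<nu> i))) (y_ratio (c(i := q * c i))) -
      step_coeff q t n (\<nu>(i := Suc (\<nu> i))) (y_ratio c) * bcoeff q t (y_ratio (qshift (\<nu>(i := Suc (\<nu> i))) c)) i) +
    bcoeff q t (y_ratio c) (Suc n) * step_coeff q t n \<nu> (y_ratio (c(Suc n := q * c (Suc n))))) =
    to_fract (step_coeff q t n \<nu> (y_ratio c))"
    by (simp only: to_fract_add to_fract_sum to_fract_diff to_fract_mult to_fract_bcoeff[OF nz(1)]
        to_fract_bcoeff[OF nz(2)] to_fract_bcoeff[OF nz(3)] to_fract_step_coeff[OF nz(1)] to_fract_step_coeff[OF nz(2)]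
        points_shift points_qshift)
  then show ?thesis by (simp only: to_fract_eq_iff)
qed

lemma step_coeff_boundary:
  assumes c: "\<And>i. c i \<noteq> 0" and i: "i \<in> {1..n}" "\<nu> i = 0"
  shows "bcoeff q t (y_ratio c) i * step_coeff q t n \<nu> (y_ratio (c(i := q * c i))) =
    step_coeff q t n \<nu> (y_ratio c) * bcoeff q t (y_ratio (qshift \<nu> c)) i"
proof -
  note nz = c upd_nonzero[of c, OF c] qshift_nonzero[OF c]
  have pts: "points c i \<noteq> 0" for i by (rule points_nonzero[OF c])
  have gen: "K.gen (points c i / points c j)" if "i \<in> {1..Suc n}" "j \<in> {1..Suc n}" "i \<noteq> j" for i j
    using points_gen[of c i j, OF c] that by simp
  have "K.bprod (points c) i * K.step_fac n \<nu> ((points c)(i := qK * points c i)) =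
    K.step_fac n \<nu> (points c) * K.bprod (K.shifted \<nu> (points c)) i"
    by (rule K.bprod_step_fac_boundary) (use pts gen i in auto)
  then have "to_fract (bcoeff q t (y_ratio c) i * step_coeff q t n \<nu> (y_ratio (c(i := q * c i)))) =
    to_fract (step_coeff q t n \<nu> (y_ratio c) * bcoeff q t (y_ratio (qshift \<nu> c)) i)"
    by (simp only: to_fract_mult to_fract_bcoeff[OF nz(1)]
        to_fract_bcoeff[OF nz(2)] to_fract_bcoeff[OF nz(3)] to_fract_step_coeff[OF nz(1)] to_fract_step_coeff[OF nz(2)]
        points_shift points_qshift)
  then show ?thesis by (simp only: to_fract_eq_iff)
qed

section \<open>Sums over the last column\<close>

definition last_sum :: "nat \<Rightarrow> ((nat \<Rightarrow> nat) \<Rightarrow> series) \<Rightarrow> series"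
  where "last_sum n h = infsum (\<lambda>\<nu>. h \<nu> * last_monom n \<nu>) (tuples n)"

lemma last_sum_cong: "(\<And>\<nu>. \<nu> \<in> tuples n \<Longrightarrow> h \<nu> = h' \<nu>) \<Longrightarrow> last_sum n h = last_sum n h'"
  unfolding last_sum_def by (rule infsum_cong) simp

lemma last_sum_add: "last_sum n (\<lambda>\<nu>. h \<nu> + h' \<nu>) = last_sum n h + last_sum n h'"
  unfolding last_sum_def distrib_right by (intro infsum_mfps_add locally_finite_last_monom)

lemma last_sum_cmult: "last_sum n (\<lambda>\<nu>. g * h \<nu>) = g * last_sum n h"
  unfolding last_sum_def mult.assoc by (intro infsum_mfps_cmult locally_finite_last_monom)

lemma last_sum_diff: "last_sum n (\<lambda>\<nu>. h \<nu> - h' \<nu>) = last_sum n h - last_sum n h'"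
  using last_sum_add[of n h "\<lambda>\<nu>. - 1 * h' \<nu>"] last_sum_cmult[of n "- 1" h'] by simp

lemma last_sum_sum: "last_sum n (\<lambda>\<nu>. \<Sum>j\<in>J. h j \<nu>) = (\<Sum>j\<in>J. last_sum n (h j))"
  unfolding last_sum_def sum_distrib_right by (intro infsum_mfps_sum locally_finite_last_monom)

lemma last_monom_Suc:
  assumes "i \<in> {1..n}"
  shows "s_ratio 1 i * last_monom n (\<nu>(i := Suc (\<nu> i))) = s_ratio 1 (Suc n) * last_monom n \<nu>"
proof -
  have "(\<Prod>j\<in>{1..n} - {i}. s_ratio j (Suc n) ^ (\<nu>(i := Suc (\<nu> i))) j) = (\<Prod>j\<in>{1..n} - {i}. s_ratio j (Suc n) ^ \<nu> j)"
    by (rule prod.cong) auto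
  then have "last_monom n (\<nu>(i := Suc (\<nu> i))) = s_ratio i (Suc n) * last_monom n \<nu>"
    unfolding last_monom_def prod.remove[OF finite_atLeastAtMost assms] by (simp add: mult.assoc)
  moreover have "s_ratio 1 i * s_ratio i (Suc n) = s_ratio 1 (Suc n)"
    using assms by (intro s_ratio_mult) auto
  ultimately show ?thesis by (simp add: mult.assoc[symmetric])
qed

text \<open>Raising \<nu>_i multiplies the monomial by s_(n+1) / s_i, which trades the weight s_i
  for s_(n+1). The tuples with \<nu>_i = 0 are not of the raised form, so \<open>h\<close> has to
  vanish there.\<close>

lemma last_sum_shift:
  assumes i: "i \<in> {1..n}" and zero: "\<And>\<nu>. \<nu> \<in> tuples n \<Longrightarrow> \<nu> i = 0 \<Longrightarrow> h \<nu> = 0"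
  shows "s_ratio 1 i * last_sum n h = s_ratio 1 (Suc n) * last_sum n (\<lambda>\<nu>. h (\<nu>(i := Suc (\<nu> i))))"
proof -
  let ?up = "\<lambda>\<nu> :: nat \<Rightarrow> nat. \<nu>(i := Suc (\<nu> i))"
  have bij: "bij_betw ?up (tuples n) {\<nu> \<in> tuples n. \<nu> i \<noteq> 0}"
    by (rule bij_betw_byWitness[where f' = "\<lambda>\<nu>. \<nu>(i := \<nu> i - 1)"]) (use i in \<open>auto simp: tuples_def\<close>)
  have "s_ratio 1 i * last_sum n h = infsum (\<lambda>\<nu>. s_ratio 1 i * (h \<nu> * last_monom n \<nu>)) (tuples n)"
    unfolding last_sum_def by (rule infsum_mfps_cmult[symmetric]) (rule locally_finite_last_monom)
  also have "\<dots> = infsum (\<lambda>\<nu>. s_ratio 1 i * (h \<nu> * last_monom n \<nu>)) {\<nu> \<in> tuples n. \<nu> i \<noteq> 0}"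
    by (rule infsum_cong_neutral) (auto simp: zero)
  also have "\<dots> = infsum (\<lambda>\<nu>. s_ratio 1 i * (h (?up \<nu>) * last_monom n (?up \<nu>))) (tuples n)"
    by (rule infsum_reindex_bij_betw[OF bij, symmetric])
  also have "\<dots> = infsum (\<lambda>\<nu>. s_ratio 1 (Suc n) * (h (?up \<nu>) * last_monom n \<nu>)) (tuples n)"
    using last_monom_Suc[OF i] by (simp only: mult.left_commute[of "s_ratio 1 i"] mult.left_commute[of "s_ratio 1 (Suc n)"])
  also have "\<dots> = s_ratio 1 (Suc n) * last_sum n (\<lambda>\<nu>. h (?up \<nu>))"
    unfolding last_sum_def by (rule infsum_mfps_cmult) (rule locally_finite_last_monom)
  finally show ?thesis .
qed

abbreviation F :: "nat \<Rightarrow> (nat \<Rightarrow> complex) \<Rightarrow> series"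
  where "F n c \<equiv> psum q t n (y_ratio c)"

lemma F_Suc: "F (Suc n) c = last_sum n (\<lambda>\<nu>. step_coeff q t n \<nu> (y_ratio c) * F n (qshift \<nu> c))"
  unfolding psum_Suc[OF q_nz] last_sum_def twist_y_ratio ..

text \<open>
  In the induction step the terms \<open>F n (qshift \<nu> c)\<close> are treated as independent: the source identity
  makes the coefficient of each of them vanish, after \<open>\<nu>\<close> has been shifted by a unit vector in the terms with
  \<open>i \<le> n\<close>, the boundary terms \<open>\<nu>\<^sub>i = 0\<close> cancelling by \<open>step_coeff_boundary\<close>.
\<close>

theorem F_eigen:
  assumes c: "\<And>i. c i \<noteq> 0"
  shows "(\<Sum>i = 1..n. s_ratio 1 i * (bcoeff q t (y_ratio c) i * F n (c(i := q * c i)))) =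
    (\<Sum>i = 1..n. s_ratio 1 i) * F n c"
  using c
proof (induction n arbitrary: c)
  case (Suc n)
  note c = \<open>\<And>i. c i \<noteq> 0\<close>
  let ?up = "\<lambda>i (\<nu> :: nat \<Rightarrow> nat). \<nu>(i := Suc (\<nu> i))" and ?T = "\<lambda>i c. c(i := q * c i)"
  define S where "S = s_ratio 1"
  define B where "B c = bcoeff q t (y_ratio c)" for c
  define D where "D \<nu> c = step_coeff q t n \<nu> (y_ratio c)" for \<nu> c
  have F_Suc': "F (Suc n) c = last_sum n (\<lambda>\<nu>. D \<nu> c * F n (qshift \<nu> c))" for c
    unfolding F_Suc D_def ..
  have commute: "qshift \<nu> (?T i c) = ?T i (qshift \<nu> c)" for \<nu> i
    by (auto simp: qshift_def fun_eq_iff)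
  \<comment> \<open>Raising \<nu>_i and shifting c_i cancel, so after reindexing all terms carry the
    same \<open>F n (qshift \<nu> c)\<close>.\<close>
  have undo: "qshift (?up i \<nu>) (?T i c) = qshift \<nu> c" for \<nu> i
  proof
    fix j
    have "q powi (- int (Suc (\<nu> i))) * (q * c i) = q powi (- int (\<nu> i)) * c i"
      using q_nz unfolding num.powi_neg_Suc by simp
    then show "qshift (?up i \<nu>) (?T i c) j = qshift \<nu> c j" by (simp add: qshift_def del: of_nat_Suc)
  qed
  \<comment> \<open>\<open>F n\<close> does not see coordinate n + 1.\<close>
  have last: "F n (qshift \<nu> (?T (Suc n) c)) = F n (qshift \<nu> c)" for \<nu>
    by (rule psum_cong) (auto simp: y_ratio_def qshift_def)
  \<comment> \<open>Difference of the two coefficients of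
    \<open>F n (qshift \<nu> (?T i c))\<close>: the first comes from expanding
    \<open>F (Suc n)\<close> at the shifted point, the second from the induction hypothesis at
    \<open>qshift \<nu> c\<close>.\<close>
  define h where "h i \<nu> = (B c i * D \<nu> (?T i c) - D \<nu> c * B (qshift \<nu> c) i) * F n (qshift \<nu> (?T i c))" for i \<nu>
  have IH: "(\<Sum>i = 1..n. S i * (B (qshift \<nu> c) i * F n (qshift \<nu> (?T i c)))) = (\<Sum>i = 1..n. S i) * F n (qshift \<nu> c)" for \<nu>
  proof -
    have "qshift \<nu> c i \<noteq> 0" for i by (rule qshift_nonzero[of c i, OF c])
    from Suc.IH[of "qshift \<nu> c", OF this] show ?thesis unfolding S_def B_def commute .
  qed
  have part: "S i * last_sum n (h i) = S (Suc n) * last_sum n (\<lambda>\<nu>. h i (?up i \<nu>))" if "i \<in> {1..n}" for i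
    unfolding S_def
  proof (rule last_sum_shift[OF that])
    fix \<nu> :: "nat \<Rightarrow> nat" assume "\<nu> i = 0"
    then show "h i \<nu> = 0"
      using step_coeff_boundary[of c i n \<nu>, OF c that] by (simp add: h_def B_def D_def)
  qed
  have "(\<Sum>i = 1..n. S i) * F (Suc n) c =
      last_sum n (\<lambda>\<nu>. \<Sum>i = 1..n. S i * (D \<nu> c * B (qshift \<nu> c) i * F n (qshift \<nu> (?T i c))))"
    unfolding F_Suc' last_sum_cmult[symmetric]
  proof (rule last_sum_cong)
    fix \<nu>
    show "(\<Sum>i = 1..n. S i) * (D \<nu> c * F n (qshift \<nu> c)) =
        (\<Sum>i = 1..n. S i * (D \<nu> c * B (qshift \<nu> c) i * F n (qshift \<nu> (?T i c))))"
      unfolding mult.left_commute[of "sum S {1..n}"] IH[symmetric] sum_distrib_left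
      by (rule sum.cong) (simp_all only: mult_ac)
  qed
  also have "\<dots> = (\<Sum>i = 1..n. S i * last_sum n (\<lambda>\<nu>. D \<nu> c * B (qshift \<nu> c) i * F n (qshift \<nu> (?T i c))))"
    by (simp only: last_sum_sum last_sum_cmult)
  finally have right: "(\<Sum>i = 1..n. S i) * F (Suc n) c = \<dots>" .
  have left: "B c i * F (Suc n) (?T i c) = last_sum n (\<lambda>\<nu>. B c i * D \<nu> (?T i c) * F n (qshift \<nu> (?T i c)))" for i
    unfolding F_Suc' last_sum_cmult[symmetric] mult.assoc ..
  have "(\<Sum>i = 1..n. S i * (B c i * F (Suc n) (?T i c))) - (\<Sum>i = 1..n. S i) * F (Suc n) c =
      (\<Sum>i = 1..n. S i * last_sum n (h i))"
    unfolding right left h_def left_diff_distrib last_sum_diff by (simp only: sum_subtractf right_diff_distrib)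
  also have "\<dots> = S (Suc n) * last_sum n (\<lambda>\<nu>. \<Sum>i = 1..n. h i (?up i \<nu>))"
    using part by (simp add: last_sum_sum sum_distrib_left)
  finally have 1: "(\<Sum>i = 1..n. S i * (B c i * F (Suc n) (?T i c))) =
    (\<Sum>i = 1..n. S i) * F (Suc n) c + S (Suc n) * last_sum n (\<lambda>\<nu>. \<Sum>i = 1..n. h i (?up i \<nu>))"
    by (simp add: algebra_simps)
  have 2: "B c (Suc n) * F (Suc n) (?T (Suc n) c) = last_sum n (\<lambda>\<nu>. B c (Suc n) * D \<nu> (?T (Suc n) c) * F n (qshift \<nu> c))"
    unfolding F_Suc' last last_sum_cmult[symmetric] mult.assoc ..
  have "(\<Sum>i = 1..n. h i (?up i \<nu>)) + B c (Suc n) * D \<nu> (?T (Suc n) c) * F n (qshift \<nu> c) = D \<nu> c * F n (qshift \<nu> c)" for \<nu>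
    using arg_cong[OF step_coeff_source_identity[of c n \<nu>, OF c], of "\<lambda>x. x * F n (qshift \<nu> c)"]
    unfolding h_def undo B_def D_def by (simp only: distrib_right sum_distrib_right)
  then have "last_sum n (\<lambda>\<nu>. \<Sum>i = 1..n. h i (?up i \<nu>)) + B c (Suc n) * F (Suc n) (?T (Suc n) c) = F (Suc n) c"
    unfolding 2 F_Suc'[of c] last_sum_add[symmetric] by simp
  then have "S (Suc n) * last_sum n (\<lambda>\<nu>. \<Sum>i = 1..n. h i (?up i \<nu>)) + S (Suc n) * (B c (Suc n) * F (Suc n) (?T (Suc n) c)) = S (Suc n) * F (Suc n) c"
    by (simp only: distrib_left[symmetric])
  then have "(\<Sum>i = 1..Suc n. S i * (B c i * F (Suc n) (?T i c))) = (\<Sum>i = 1..Suc n. S i) * F (Suc n) c"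
    using 1 by (simp add: distrib_right add.assoc)
  then show ?case unfolding S_def B_def .
qed simp

end

section \<open>Uniqueness\<close>

definition xdeg :: "(ratio_var \<Rightarrow>\<^sub>0 nat) \<Rightarrow> nat"
  where "xdeg m = (\<Sum>v\<in>Poly_Mapping.keys m. case v of XVar _ \<Rightarrow> Poly_Mapping.lookup m v | SVar _ \<Rightarrow> 0)"

lemma xdeg_add: "xdeg (a + b) = xdeg a + xdeg b"
  unfolding xdeg_def by (rule setsum_keys_plus_distrib) (simp_all split: ratio_var.split)

lemma xdeg_eq_0_iff: "xdeg m = 0 \<longleftrightarrow> (\<forall>j. Poly_Mapping.lookup m (XVar j) = 0)"
proof
  assume "xdeg m = 0"
  then have "\<forall>v\<in>Poly_Mapping.keys m. (case v of XVar _ \<Rightarrow> Poly_Mapping.lookup m v | SVar _ \<Rightarrow> 0) = 0"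
    unfolding xdeg_def by (simp add: sum_eq_0_iff)
  then show "\<forall>j. Poly_Mapping.lookup m (XVar j) = 0" by (force simp: in_keys_iff)
next
  assume "\<forall>j. Poly_Mapping.lookup m (XVar j) = 0"
  then show "xdeg m = 0" unfolding xdeg_def by (intro sum.neutral) (auto split: ratio_var.split)
qed

lemma monom_eval_eq_0_iff:
  fixes a :: "'v \<Rightarrow> 'a::idom"
  shows "monom_eval a m = 0 \<longleftrightarrow> (\<exists>v. a v = 0 \<and> Poly_Mapping.lookup m v \<noteq> 0)"
  by (auto simp: monom_eval_def in_keys_iff)

lemma monom_eval_eq_1: "(\<And>v. Poly_Mapping.lookup m v \<noteq> 0 \<Longrightarrow> a v = 1) \<Longrightarrow> monom_eval a m = 1"
  unfolding monom_eval_def by (rule prod.neutral) (auto simp: in_keys_iff)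

lemma mfps_coeff_var_mult:
  fixes f :: "('v, 'a::comm_ring_1) mfps"
  shows "mfps_coeff (mfps_var v * f) (Poly_Mapping.single v 1 + m) = mfps_coeff f m"
proof -
  have "mfps_coeff (mfps_var v * f) (Poly_Mapping.single v 1 + m) =
      (\<Sum>p\<in>{(Poly_Mapping.single v 1, m)}. mfps_coeff (mfps_var v) (fst p) * mfps_coeff f (snd p))"
    unfolding mfps_coeff_mult
    by (rule sum.mono_neutral_right) (auto simp: finite_splits mfps_var.rep_eq)
  then show ?thesis by (simp add: mfps_var.rep_eq)
qed

definition s_exponent :: "nat \<Rightarrow> nat \<Rightarrow> ratio_var \<Rightarrow>\<^sub>0 nat"
  where "s_exponent i j = (\<Sum>a = i..<j. Poly_Mapping.single (SVar a) 1)"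

lemma mfps_coeff_s_ratio_mult:
  "mfps_coeff (s_ratio i j * f) (s_exponent i j + m) = mfps_coeff f m"
proof -
  have "mfps_coeff ((\<Prod>a\<in>A. mfps_var (SVar a)) * f) ((\<Sum>a\<in>A. Poly_Mapping.single (SVar a) 1) + m) = mfps_coeff f m"
    if "finite A" for A
    using that
  proof (induction A)
    case (insert a A)
    then show ?case
      using mfps_coeff_var_mult[of "SVar a" "(\<Prod>a\<in>A. mfps_var (SVar a)) * f" "(\<Sum>a\<in>A. Poly_Mapping.single (SVar a) 1) + m"]
      by (simp add: mult.assoc add.assoc)
  qed simp
  then show ?thesis by (simp add: s_ratio_def s_exponent_def)
qed

lemma xdeg_s_exponent: "xdeg (s_exponent i j) = 0"
  by (simp add: xdeg_eq_0_iff s_exponent_def lookup_sum lookup_single when_def)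

lemma lookup_XVar_split:
  assumes "fst p + snd p = m" "xdeg (fst p) = 0"
  shows "Poly_Mapping.lookup (snd p) (XVar j) = Poly_Mapping.lookup m (XVar j)"
  using assms(1)[symmetric] assms(2) by (simp add: lookup_add xdeg_eq_0_iff)

definition kill_x :: "ratio_var \<Rightarrow> complex"
  where "kill_x v = (case v of XVar _ \<Rightarrow> 0 | SVar _ \<Rightarrow> 1)"

lemma monom_eval_kill_x: "monom_eval kill_x m = (if xdeg m = 0 then 1 else 0)"
proof (cases "xdeg m = 0")
  case True
  then show ?thesis
    by (simp add: xdeg_eq_0_iff, intro monom_eval_eq_1) (auto simp: kill_x_def split: ratio_var.split)
next
  case False
  then show ?thesis
    by (auto simp: xdeg_eq_0_iff monom_eval_eq_0_iff kill_x_def split: ratio_var.split)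
qed

text \<open>The effect of \<open>x\<^sub>i \<mapsto> q x\<^sub>i\<close> on the ratio variables.\<close>

definition x_scale :: "complex \<Rightarrow> nat \<Rightarrow> ratio_var \<Rightarrow> complex"
  where "x_scale q i v = (case v of XVar j \<Rightarrow> (if Suc j = i then q else if j = i then 1 / q else 1) | SVar _ \<Rightarrow> 1)"

context qt_series
begin

lemma bser_0: "bser q t 0 = 1"
  by (simp add: bser_def mfps_divide_eq_iff mfps_coeff_1)

text \<open>Setting the x ratios to zero turns every factor into \<open>bser q t 0 = 1\<close>; all
  other terms of the coefficient raise the x-degree.\<close>

lemma mfps_coeff_bcoeff_x_ratio:
  assumes "xdeg m = 0"
  shows "mfps_coeff (bcoeff q t x_ratio i) m = (if m = 0 then 1 else 0)"
proof -
  have "mfps_scale kill_x (bcoeff q t x_ratio i) = (\<Prod>j = 1..<i. mfps_scale kill_x (bser q t (x_ratio j i)))"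
    by (simp add: bcoeff_def mfps_scale_prod)
  also have "\<dots> = 1"
  proof (rule prod.neutral, rule)
    fix j assume j: "j \<in> {1..<i}"
    have "mfps_scale kill_x (x_ratio j i) = 0"
      using j by (auto simp: x_ratio_def mfps_scale_prod mfps_scale_var kill_x_def intro!: prod_zero bexI[of _ j])
    moreover have "mfps_coeff ((1 - x_ratio j i) * (1 - mfps_const q * x_ratio j i)) 0 \<noteq> 0"
      using j by (simp add: mfps_coeff_0_mult mfps_coeff_1 mfps_coeff_0_ratio)
    ultimately have "mfps_scale kill_x (bser q t (x_ratio j i)) = bser q t 0"
      by (simp add: bser_def mfps_scale_divide mfps_scale_mult mfps_scale_diff)
    then show "mfps_scale kill_x (bser q t (x_ratio j i)) = 1" by (simp add: bser_0)
  qed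
  finally have "mfps_coeff (mfps_scale kill_x (bcoeff q t x_ratio i)) m = mfps_coeff 1 m" by simp
  then show ?thesis using assms by (simp add: monom_eval_kill_x mfps_coeff_1)
qed

text \<open>
  Among the monomials of least degree in the \<open>XVar\<close>s the equation reduces to
  \<open>\<Sum>\<^sub>i s\<^sub>i (q\<^bsup>\<mu>\<^sub>i\<^esup> - 1) Z = 0\<close>, where \<open>\<mu>\<^sub>i\<close> is the exponent of \<open>x\<^sub>i\<close>; the least \<open>i\<close> with \<open>\<mu>\<^sub>i \<noteq> 0\<close> gives the
  lowest term in the \<open>SVar\<close>s.
\<close>

theorem eigen_unique:
  assumes eq: "(\<Sum>i = 1..n. s_ratio 1 i * (bcoeff q t x_ratio i * mfps_scale (x_scale q i) Z)) =
      (\<Sum>i = 1..n. s_ratio 1 i) * Z"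
    and range: "\<And>m j. mfps_coeff Z m \<noteq> 0 \<Longrightarrow> Poly_Mapping.lookup m (XVar j) \<noteq> 0 \<Longrightarrow> 1 \<le> j \<and> j < n"
    and no_const: "\<And>m. mfps_coeff Z m \<noteq> 0 \<Longrightarrow> xdeg m \<noteq> 0"
  shows "Z = 0"
proof (rule ccontr)
  assume "Z \<noteq> 0"
  then obtain m1 where "mfps_coeff Z m1 \<noteq> 0" using mfps_eqI[of Z 0] by auto
  then obtain m' where m': "mfps_coeff Z m' \<noteq> 0" "\<And>m. mfps_coeff Z m \<noteq> 0 \<Longrightarrow> xdeg m' \<le> xdeg m"
    using ex_has_least_nat[of "\<lambda>m. mfps_coeff Z m \<noteq> 0" m1 xdeg] by blast
  define d where "d = xdeg m'"
  have xmin: "d \<le> xdeg m" if "mfps_coeff Z m \<noteq> 0" for m using m'(2)[OF that] by (simp add: d_def)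
  \<comment> \<open>A second minimisation, by weight, among the monomials of least x-degree: no
    proper divisor of \<open>m0\<close> with the same x-degree is then in the support.\<close>
  obtain m0 where m0: "mfps_coeff Z m0 \<noteq> 0" "xdeg m0 = d"
      "\<And>m. mfps_coeff Z m \<noteq> 0 \<Longrightarrow> xdeg m = d \<Longrightarrow> mweight m0 \<le> mweight m"
    using ex_has_least_nat[of "\<lambda>m. mfps_coeff Z m \<noteq> 0 \<and> xdeg m = d" m' mweight] m'(1) d_def by blast
  define k where "k j = Poly_Mapping.lookup m0 (XVar j)" for j
  have "\<exists>j. k j \<noteq> 0" using no_const[OF m0(1)] by (simp add: xdeg_eq_0_iff k_def)
  define v where "v = (LEAST j. k j \<noteq> 0)"
  have kv: "k v \<noteq> 0" unfolding v_def by (rule LeastI_ex) fact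
  have kv_min: "k j = 0" if "j < v" for j using not_less_Least[of j "\<lambda>j. k j \<noteq> 0"] that by (auto simp: v_def)
  have v: "1 \<le> v" "v < n" using range[OF m0(1), of v] kv by (auto simp: k_def)
  \<comment> \<open>Subtracting Z inside each term makes the lowest part diagonal: on x-degree
    \<open>d\<close>, \<open>Y i\<close> multiplies every monomial by its shift factor minus
    1.\<close>
  define Y where "Y i = bcoeff q t x_ratio i * mfps_scale (x_scale q i) Z - Z" for i
  have sum_Y: "(\<Sum>i = 1..n. s_ratio 1 i * Y i) = 0"
    using eq by (simp add: Y_def right_diff_distrib sum_subtractf sum_distrib_right)
  have Y_low: "mfps_coeff (Y i) m = 0" if "xdeg m < d" for i m
  proof -
    have zero: "mfps_coeff Z b = 0" if "xdeg b < d" for b using xmin[of b] that by fastforce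
    have "mfps_coeff (mfps_scale (x_scale q i) Z) (snd p) = 0" if "fst p + snd p = m" for p
      using zero[of "snd p"] that \<open>xdeg m < d\<close> xdeg_add[of "fst p" "snd p"] by simp
    then have "mfps_coeff (bcoeff q t x_ratio i * mfps_scale (x_scale q i) Z) m = 0"
      unfolding mfps_coeff_mult by (intro sum.neutral ballI) (simp del: mfps_coeff_scale)
    then show ?thesis
      unfolding Y_def using zero[OF that] by simp
  qed
  have Y_d: "mfps_coeff (Y i) m = (monom_eval (x_scale q i) m - 1) * mfps_coeff Z m" if "xdeg m = d" for i m
  proof -
    have "mfps_coeff (bcoeff q t x_ratio i * mfps_scale (x_scale q i) Z) m =
      (\<Sum>p\<in>{(0, m)}. mfps_coeff (bcoeff q t x_ratio i) (fst p) * mfps_coeff (mfps_scale (x_scale q i) Z) (snd p))"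
      unfolding mfps_coeff_mult
    proof (rule sum.mono_neutral_right)
      show "\<forall>p\<in>{p. fst p + snd p = m} - {(0, m)}.
        mfps_coeff (bcoeff q t x_ratio i) (fst p) * mfps_coeff (mfps_scale (x_scale q i) Z) (snd p) = 0"
      proof
        fix p assume p: "p \<in> {p. fst p + snd p = m} - {(0, m)}"
        then have sum: "xdeg (fst p) + xdeg (snd p) = d" "fst p \<noteq> 0"
          using that xdeg_add[of "fst p" "snd p"] by (cases p; auto)+
        show "mfps_coeff (bcoeff q t x_ratio i) (fst p) * mfps_coeff (mfps_scale (x_scale q i) Z) (snd p) = 0"
        proof (cases "xdeg (fst p) = 0")
          case True
          then show ?thesis using mfps_coeff_bcoeff_x_ratio[OF True] sum(2) by simp
        next
          case False
          then have "mfps_coeff Z (snd p) = 0" using xmin[of "snd p"] sum(1) by fastforce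
          then show ?thesis by simp
        qed
      qed
    qed (auto simp: finite_splits)
    moreover have "xdeg 0 = 0" by (simp add: xdeg_eq_0_iff)
    ultimately show ?thesis by (simp add: Y_def mfps_coeff_bcoeff_x_ratio left_diff_distrib)
  qed
  have eval_cong: "monom_eval (x_scale q i) m = monom_eval (x_scale q i) m0"
    if "\<And>j. Poly_Mapping.lookup m (XVar j) = k j" for i m
  proof -
    let ?V = "Poly_Mapping.keys m \<union> Poly_Mapping.keys m0"
    have "x_scale q i w ^ Poly_Mapping.lookup m w = x_scale q i w ^ Poly_Mapping.lookup m0 w" for w
      using that by (cases w) (auto simp: x_scale_def k_def)
    then show ?thesis by (simp add: monom_eval_superset[of ?V])
  qed
  have eval_v: "monom_eval (x_scale q v) m0 \<noteq> 1"
  proof -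
    have "monom_eval (x_scale q v) m0 = (\<Prod>w\<in>insert (XVar v) (Poly_Mapping.keys m0). x_scale q v w ^ Poly_Mapping.lookup m0 w)"
      by (rule monom_eval_superset) auto
    also have "\<dots> = (\<Prod>w\<in>{XVar v}. x_scale q v w ^ Poly_Mapping.lookup m0 w)"
    proof (rule prod.mono_neutral_right)
      show "\<forall>w\<in>insert (XVar v) (Poly_Mapping.keys m0) - {XVar v}. x_scale q v w ^ Poly_Mapping.lookup m0 w = 1"
        using kv_min by (auto simp: x_scale_def k_def split: ratio_var.split)
    qed auto
    also have "\<dots> = q powi (- int (k v))"
      by (simp add: x_scale_def k_def power_int_minus power_one_over inverse_eq_divide)
    finally show ?thesis using q_powi_ne_1[of "- int (k v)"] kv by simp
  qed
  have eval_less: "monom_eval (x_scale q i) m0 = 1" if "i < v" for i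
  proof (rule monom_eval_eq_1)
    fix w assume "Poly_Mapping.lookup m0 w \<noteq> 0"
    then show "x_scale q i w = 1"
      using that kv_min by (cases w) (auto simp: x_scale_def k_def less_Suc_eq)
  qed
  \<comment> \<open>The lowest term of s_v Z, relative to s_1. Terms with i < v vanish there because
    the shift of x_i fixes all monomials with the x-exponents of \<open>m0\<close>, terms with i > v
    because s_i / s_v leaves only coefficients of Z of smaller weight or degree.\<close>
  let ?m = "s_exponent 1 v + m0"
  have "mfps_coeff (s_ratio 1 i * Y i) ?m = (if i = v then (monom_eval (x_scale q v) m0 - 1) * mfps_coeff Z m0 else 0)"
    if i: "i \<in> {1..n}" for i
  proof -
    consider "i < v" | "i = v" | "v < i" by linarith
    then show ?thesis
    proof cases
      case 1
      have "mfps_coeff (Y i) (snd p) = 0" if p: "fst p + snd p = ?m" for p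
      proof (cases "xdeg (fst p) = 0")
        case True
        have "Poly_Mapping.lookup (snd p) (XVar j) = k j" for j
          using lookup_XVar_split[OF p True, of j] xdeg_s_exponent[of 1 v] by (simp add: lookup_add xdeg_eq_0_iff k_def)
        moreover have "xdeg (snd p) = d"
          using True xdeg_add[of "fst p" "snd p"] xdeg_add[of "s_exponent 1 v" m0] xdeg_s_exponent m0(2) p by simp
        ultimately show ?thesis using Y_d eval_cong eval_less[OF 1] by simp
      next
        case False
        then have "xdeg (snd p) < d"
          using xdeg_add[of "fst p" "snd p"] xdeg_add[of "s_exponent 1 v" m0] xdeg_s_exponent m0(2) p by simp
        then show ?thesis by (rule Y_low)
      qed
      then have "mfps_coeff (s_ratio 1 i * Y i) ?m = 0"
        unfolding mfps_coeff_mult by (intro sum.neutral ballI) simp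
      then show ?thesis using 1 by simp
    next
      case 2
      then show ?thesis using mfps_coeff_s_ratio_mult[of 1 v "Y v" m0] Y_d[OF m0(2)] by simp
    next
      case 3
      have "s_ratio 1 i * Y i = s_ratio 1 v * (s_ratio v i * Y i)"
        using s_ratio_mult[of 1 v i] 3 v by (simp add: mult.assoc[symmetric])
      then have "mfps_coeff (s_ratio 1 i * Y i) ?m = mfps_coeff (s_ratio v i * Y i) m0"
        by (simp only: mfps_coeff_s_ratio_mult)
      also have "\<dots> = 0"
        unfolding mfps_coeff_mult
      proof (rule sum.neutral, rule)
        fix p assume "p \<in> {p. fst p + snd p = m0}"
        then have p: "fst p + snd p = m0" by simp
        show "mfps_coeff (s_ratio v i) (fst p) * mfps_coeff (Y i) (snd p) = 0"
        proof (cases "fst p = 0 \<or> xdeg (snd p) < d")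
          case True
          then show ?thesis using Y_low mfps_coeff_0_ratio(2)[OF 3] by auto
        next
          case False
          then have "xdeg (snd p) = d" using xdeg_add[of "fst p" "snd p"] p m0(2) by simp
          moreover have "mweight (snd p) < mweight m0"
            using False mweight_split[OF p] mweight_eq_0_iff[of "fst p"] by linarith
          then have "mfps_coeff Z (snd p) = 0" using m0(3)[of "snd p"] \<open>xdeg (snd p) = d\<close> by fastforce
          ultimately show ?thesis using Y_d by simp
        qed
      qed
      finally show ?thesis using 3 by simp
    qed
  qed
  then have "mfps_coeff (\<Sum>i = 1..n. s_ratio 1 i * Y i) ?m =
      (\<Sum>i = 1..n. if i = v then (monom_eval (x_scale q v) m0 - 1) * mfps_coeff Z m0 else 0)"
    unfolding mfps_coeff_sum by (rule sum.cong[OF refl])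
  then have "(monom_eval (x_scale q v) m0 - 1) * mfps_coeff Z m0 = 0"
    using v unfolding sum_Y by simp
  then show False using eval_v m0(1) by simp
qed

end

section \<open>The symmetry between \<open>t\<close> and \<open>q / t\<close>\<close>

lemma prod_telescope_ratio:
  fixes c :: "nat \<Rightarrow> 'a::field"
  assumes "\<And>i. c i \<noteq> 0" "i \<le> j"
  shows "(\<Prod>l = i..<j. c (Suc l) / c l) = c j / c i"
  using assms(2) by (induction j rule: nat_induct_at_least) (simp_all add: assms(1))

definition dilate :: "(nat \<Rightarrow> complex) \<Rightarrow> ratio_var \<Rightarrow> complex"
  where "dilate c v = (case v of XVar j \<Rightarrow> c (Suc j) / c j | SVar _ \<Rightarrow> 1)"

lemma mfps_const_prod: "(\<Prod>i\<in>A. mfps_const (f i)) = (mfps_const (\<Prod>i\<in>A. f i) :: ('v, 'a::comm_ring_1) mfps)"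
  by (induction A rule: infinite_finite_induct) (simp_all add: mfps_const_mult)

lemma dilate_x_ratio:
  assumes "\<And>i. c i \<noteq> 0" "i \<le> j"
  shows "mfps_scale (dilate c) (x_ratio i j) = y_ratio c i j"
  by (simp add: x_ratio_def y_ratio_def mfps_scale_prod mfps_scale_var dilate_def prod.distrib
      mfps_const_prod prod_telescope_ratio[of c i j, OF assms])

lemma x_scale_eq_dilate: "q \<noteq> 0 \<Longrightarrow> x_scale q i = dilate ((\<lambda>_. 1)(i := q))"
  by (auto simp: x_scale_def dilate_def fun_eq_iff split: ratio_var.split)

text \<open>The ratios in the limit where all \<open>x\<^bsub>i+1\<^esub> / x\<^sub>i\<close> tend to zero.\<close>

definition delta_ratio :: "nat \<Rightarrow> nat \<Rightarrow> series"
  where "delta_ratio i j = (if i = j then 1 else 0)"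

lemma admissible_delta: "admissible delta_ratio"
  by (simp add: admissible_def delta_ratio_def)

lemma kill_x_x_ratio: "i \<le> j \<Longrightarrow> mfps_scale kill_x (x_ratio i j) = delta_ratio i j"
  by (auto simp: x_ratio_def delta_ratio_def mfps_scale_prod mfps_scale_var kill_x_def intro!: prod_zero bexI[of _ i])

lemma mfps_scale_delta: "mfps_scale a (delta_ratio i j) = delta_ratio i j"
  by (simp add: delta_ratio_def)

lemma mfps_mult_divide_cancel:
  fixes a b c :: "('v::countable, 'a::field) mfps"
  assumes "mfps_coeff a 0 \<noteq> 0"
  shows "(a / b) * (c / a) = c / b"
proof -
  have "(a / b) * (c / a) = (a * inverse a) * (c / b)" by (simp only: divide_mfps_def mult_ac)
  then show ?thesis using mfps_unit[OF assms] by simp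
qed

context qt_series
begin

lemma dual: "qt_series q (q / t)"
  by standard (use q_nz norm_q t_nz in auto)

lemma bser_dual: "bser q (q / t) z = bser q t z"
  using q_nz by (simp add: bser_def mult.commute)

lemma dilate_psum:
  assumes "\<And>i. c i \<noteq> 0"
  shows "mfps_scale (dilate c) (psum q t n x_ratio) = psum q t n (y_ratio c)"
proof -
  have "mfps_scale (dilate c) (psum q t n x_ratio) = psum q t n (\<lambda>i j. mfps_scale (dilate c) (x_ratio i j))"
    by (rule mfps_scale_psum[OF admissible_x_ratio]) (simp add: dilate_def)
  also have "\<dots> = psum q t n (y_ratio c)"
    by (rule psum_cong) (rule dilate_x_ratio[OF assms])
  finally show ?thesis .
qed

lemma scale_psum_delta:
  assumes "\<And>i. a (SVar i) = 1"
  shows "mfps_scale a (psum q t n delta_ratio) = psum q t n delta_ratio"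
  using mfps_scale_psum[OF admissible_delta, of a] assms by (simp add: mfps_scale_delta)

lemma kill_x_psum: "mfps_scale kill_x (psum q t n x_ratio) = psum q t n delta_ratio"
proof -
  have "mfps_scale kill_x (psum q t n x_ratio) = psum q t n (\<lambda>i j. mfps_scale kill_x (x_ratio i j))"
    by (rule mfps_scale_psum[OF admissible_x_ratio]) (simp add: kill_x_def)
  also have "\<dots> = psum q t n delta_ratio"
    by (rule psum_cong) (rule kill_x_x_ratio)
  finally show ?thesis .
qed

text \<open>A series is fixed by this rescaling exactly if, among the x ratios, only x_2 / x_1, ...,
  x_n / x_(n-1) occur in it.\<close>

definition in_range :: "nat \<Rightarrow> ratio_var \<Rightarrow> complex"
  where "in_range n v = (case v of XVar j \<Rightarrow> (if 1 \<le> j \<and> j < n then 1 else 0) | SVar _ \<Rightarrow> 1)"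

lemma in_range_psum: "mfps_scale (in_range n) (psum q t n x_ratio) = psum q t n x_ratio"
proof -
  have "mfps_scale (in_range n) (psum q t n x_ratio) = psum q t n (\<lambda>i j. mfps_scale (in_range n) (x_ratio i j))"
    by (rule mfps_scale_psum[OF admissible_x_ratio]) (simp add: in_range_def)
  also have "\<dots> = psum q t n x_ratio"
    by (rule psum_cong)
      (auto simp: x_ratio_def mfps_scale_prod mfps_scale_var in_range_def intro!: prod.cong)
  finally show ?thesis .
qed

lemma y_ratio_1: "y_ratio (\<lambda>_. 1) = x_ratio"
  by (simp add: y_ratio_def fun_eq_iff)

lemma psum_eigen:
  "(\<Sum>i = 1..n. s_ratio 1 i * (bcoeff q t x_ratio i * mfps_scale (x_scale q i) (psum q t n x_ratio))) =
    (\<Sum>i = 1..n. s_ratio 1 i) * psum q t n x_ratio"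
proof -
  have "mfps_scale (x_scale q i) (psum q t n x_ratio) = psum q t n (y_ratio ((\<lambda>_. 1)(i := q * 1)))" for i
    unfolding x_scale_eq_dilate[OF q_nz] mult_1_right by (rule dilate_psum) (simp add: q_nz)
  then show ?thesis using F_eigen[of "\<lambda>_. 1" n] by (simp add: y_ratio_1)
qed

text \<open>The difference Z of the two sides solves the difference equation, which is the same for
  t and q / t, because the limits \<open>U0\<close> and \<open>V0\<close> contain no x. They are
  also the x-free parts of \<open>U\<close> and \<open>V\<close>, so Z has no x-free part and
  uniqueness gives Z = 0.\<close>

theorem psum_dual_proportional:
  assumes c: "\<And>i. c i \<noteq> 0"
  shows "psum q (q / t) n delta_ratio * psum q t n (y_ratio c) =
    psum q t n delta_ratio * psum q (q / t) n (y_ratio c)"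
proof -
  interpret dual: qt_series q "q / t" by (rule dual)
  define U V U0 V0 where "U = psum q t n x_ratio" and "V = psum q (q / t) n x_ratio"
    and "U0 = psum q t n delta_ratio" and "V0 = psum q (q / t) n delta_ratio"
  define Z where "Z = V0 * U - U0 * V"
  have scale_Z: "mfps_scale a Z = V0 * mfps_scale a U - U0 * mfps_scale a V" if "\<And>i. a (SVar i) = 1" for a
    using scale_psum_delta[of a n, OF that] dual.scale_psum_delta[of a n, OF that]
    by (simp add: Z_def mfps_scale_diff mfps_scale_mult U0_def V0_def)
  have "Z = 0"
  proof (rule eigen_unique)
    have eigV: "(\<Sum>i = 1..n. s_ratio 1 i * (bcoeff q t x_ratio i * mfps_scale (x_scale q i) V)) = (\<Sum>i = 1..n. s_ratio 1 i) * V"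
      using dual.psum_eigen[of n] unfolding V_def bcoeff_def bser_dual .
    have eigU: "(\<Sum>i = 1..n. s_ratio 1 i * (bcoeff q t x_ratio i * mfps_scale (x_scale q i) U)) = (\<Sum>i = 1..n. s_ratio 1 i) * U"
      using psum_eigen[of n] unfolding U_def .
    have "(\<Sum>i = 1..n. s_ratio 1 i * (bcoeff q t x_ratio i * mfps_scale (x_scale q i) Z)) =
        (\<Sum>i = 1..n. V0 * (s_ratio 1 i * (bcoeff q t x_ratio i * mfps_scale (x_scale q i) U)) -
          U0 * (s_ratio 1 i * (bcoeff q t x_ratio i * mfps_scale (x_scale q i) V)))"
    proof (rule sum.cong[OF refl])
      fix i
      have "mfps_scale (x_scale q i) Z = V0 * mfps_scale (x_scale q i) U - U0 * mfps_scale (x_scale q i) V"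
        by (rule scale_Z) (simp add: x_scale_def)
      then show "s_ratio 1 i * (bcoeff q t x_ratio i * mfps_scale (x_scale q i) Z) =
          V0 * (s_ratio 1 i * (bcoeff q t x_ratio i * mfps_scale (x_scale q i) U)) -
          U0 * (s_ratio 1 i * (bcoeff q t x_ratio i * mfps_scale (x_scale q i) V))"
        by (simp add: right_diff_distrib mult_ac)
    qed
    also have "\<dots> = V0 * ((\<Sum>i = 1..n. s_ratio 1 i) * U) - U0 * ((\<Sum>i = 1..n. s_ratio 1 i) * V)"
      unfolding sum_subtractf sum_distrib_left[symmetric] eigU eigV ..
    also have "\<dots> = (\<Sum>i = 1..n. s_ratio 1 i) * Z" by (simp add: Z_def algebra_simps)
    finally show "(\<Sum>i = 1..n. s_ratio 1 i * (bcoeff q t x_ratio i * mfps_scale (x_scale q i) Z)) =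
      (\<Sum>i = 1..n. s_ratio 1 i) * Z" .
  next
    fix m j assume nz: "mfps_coeff Z m \<noteq> 0" and j: "Poly_Mapping.lookup m (XVar j) \<noteq> 0"
    have "mfps_scale (in_range n) Z = V0 * mfps_scale (in_range n) U - U0 * mfps_scale (in_range n) V"
      by (rule scale_Z) (simp add: in_range_def)
    also have "\<dots> = Z" unfolding U_def V_def in_range_psum dual.in_range_psum Z_def ..
    finally have "mfps_coeff (mfps_scale (in_range n) Z) m = mfps_coeff Z m" by (rule arg_cong)
    then have "monom_eval (in_range n) m * mfps_coeff Z m = mfps_coeff Z m" unfolding mfps_coeff_scale .
    then have "monom_eval (in_range n) m \<noteq> 0" using nz by auto
    then have "in_range n (XVar j) \<noteq> 0" using j by (auto simp: monom_eval_eq_0_iff)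
    then show "1 \<le> j \<and> j < n" by (auto simp: in_range_def split: if_splits)
  next
    fix m assume nz: "mfps_coeff Z m \<noteq> 0"
    have "mfps_scale kill_x Z = V0 * mfps_scale kill_x U - U0 * mfps_scale kill_x V"
      by (rule scale_Z) (simp add: kill_x_def)
    also have "\<dots> = 0"
      unfolding U_def V_def U0_def V0_def kill_x_psum dual.kill_x_psum by (simp add: mult.commute)
    finally have "mfps_coeff (mfps_scale kill_x Z) m = mfps_coeff 0 m" by (rule arg_cong)
    then have "monom_eval kill_x m * mfps_coeff Z m = 0" unfolding mfps_coeff_scale mfps_coeff_0 .
    then show "xdeg m \<noteq> 0" using nz by (cases "xdeg m = 0") (auto simp: monom_eval_kill_x)
  qed
  have "mfps_scale (dilate c) Z = V0 * mfps_scale (dilate c) U - U0 * mfps_scale (dilate c) V"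
    by (rule scale_Z) (simp add: dilate_def)
  then show ?thesis
    unfolding \<open>Z = 0\<close> U_def V_def U0_def V0_def dilate_psum[of c, OF c] dual.dilate_psum[of c, OF c]
    by simp
qed

text \<open>Reversing the order of the factors; the right-hand side displays the coefficients of a
  q-binomial series with argument scaled by q / t.\<close>

lemma diagfac_closed: "num.diagfac k = (q / t) ^ k * (fin_qpoch q t k / fin_qpoch q q k)"
proof (induction k)
  case 0
  show ?case by (simp add: num.diagfac_def)
next
  case (Suc k)
  then show ?case
    unfolding num.diagfac_Suc(2) fin_qpoch_Suc by (simp add: num.sig_fac_def mult_ac)
qed

lemma qpoch_const: "qpoch (mfps_const a) q k = mfps_const (fin_qpoch q a k)"
  by (simp add: qpoch_def fin_qpoch_def mfps_const_diff mfps_const_mult flip: mfps_const_prod)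

lemma qpoch_diagonal:
  "qpoch (mfps_const (q powi (- int k) * q / t)) q k / qpoch (mfps_const (q powi (- int k))) q k =
    mfps_const (num.diagfac k)"
proof -
  have "fin_qpoch q (q powi (- int k)) k \<noteq> 0"
    using denominator_diagonal[of k] by (simp add: qpoch_const mfps_coeff_const)
  then show ?thesis
    by (simp add: qpoch_const mfps_divide_eq_iff mfps_coeff_const num.diagfac_def flip: mfps_const_mult)
qed

lemma step_coeff_delta: "step_coeff q t n \<nu> delta_ratio = (\<Prod>i = 1..n. mfps_const (num.diagfac (\<nu> i)))"
proof -
  have "(\<Prod>(i, j)\<in>index_pairs (Suc n). qpoch (mfps_const t * delta_ratio i j) q (\<nu> i) / qpoch (mfps_const q * delta_ratio i j) q (\<nu> i)) = 1"
    by (rule prod.neutral) (auto simp: index_pairs_def delta_ratio_def qpoch_def mfps_divide_eq_iff mfps_coeff_1)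
  moreover have "(\<Prod>(i, j)\<in>index_pairs n. qpoch (mfps_const (q powi (- int (\<nu> j)) * q / t) * delta_ratio i j) q (\<nu> i) /
      qpoch (mfps_const (q powi (- int (\<nu> j))) * delta_ratio i j) q (\<nu> i)) = 1"
    by (rule prod.neutral) (auto simp: index_pairs_def delta_ratio_def qpoch_def mfps_divide_eq_iff mfps_coeff_1)
  ultimately show ?thesis
    unfolding step_coeff_def prod_weak_index_pairs index_pairs_def[of "Suc n", symmetric]
    by (simp only: mult_1_left) (simp add: delta_ratio_def qpoch_diagonal)
qed

lemma infsum_tuples_prod:
  assumes "\<And>i. i \<in> {1..n} \<Longrightarrow> mord_ge 1 (w i)"
  shows "infsum (\<lambda>\<nu>. \<Prod>i = 1..n. e (\<nu> i) * w i ^ \<nu> i :: series) (tuples n) =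
    (\<Prod>i = 1..n. infsum (\<lambda>k. e k * w i ^ k) UNIV)"
  using assms
proof (induction n)
  case 0
  have "tuples 0 = {\<lambda>_. 0}" by (auto simp: tuples_def fun_eq_iff)
  then show ?case by simp
next
  case (Suc n)
  let ?join = "\<lambda>(\<nu> :: nat \<Rightarrow> nat, k). \<nu>(Suc n := k)"
  have bij: "bij_betw ?join (tuples n \<times> UNIV) (tuples (Suc n))"
    by (rule bij_betw_byWitness[where f' = "\<lambda>\<nu>. (\<nu>(Suc n := 0), \<nu> (Suc n))"])
      (auto simp: tuples_def fun_eq_iff)
  define g where "g \<nu> = (\<Prod>i = 1..Suc n. e (\<nu> i)) * (\<Prod>i = 1..Suc n. w i ^ \<nu> i)" for \<nu>
  define p where "p \<nu> = (\<Prod>i = 1..n. e (\<nu> i) * w i ^ \<nu> i)" for \<nu>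
  define r where "r k = e k * w (Suc n) ^ k" for k
  have g_join: "g (?join (\<nu>, k)) = p \<nu> * r k" for \<nu> k
  proof -
    have "(\<Prod>i = 1..n. e ((\<nu>(Suc n := k)) i) * w i ^ (\<nu>(Suc n := k)) i) = p \<nu>"
      unfolding p_def by (rule prod.cong) auto
    then show ?thesis by (simp add: g_def r_def flip: prod.distrib)
  qed
  have lf: "locally_finite (tuples n \<times> UNIV) (\<lambda>(\<nu>, k). p \<nu> * r k)"
    using locally_finite_reindex[OF bij locally_finite_tuples[of "Suc n" w "\<lambda>\<nu>. \<Prod>i = 1..Suc n. e (\<nu> i)", OF Suc.prems]]
    unfolding g_def[symmetric] by (rule locally_finite_cong[THEN iffD1, rotated]) (use g_join in auto)
  have lf_r: "locally_finite UNIV r"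
    unfolding r_def using Suc.prems[of "Suc n"] by (intro locally_finite_power_series) (simp add: mord_ge_1_iff)
  have lf_p: "locally_finite (tuples n) p"
    unfolding p_def prod.distrib using Suc.prems by (intro locally_finite_tuples) auto
  have "infsum (\<lambda>\<nu>. \<Prod>i = 1..Suc n. e (\<nu> i) * w i ^ \<nu> i) (tuples (Suc n)) = infsum g (tuples (Suc n))"
    by (rule infsum_cong) (simp only: g_def prod.distrib)
  also have "\<dots> = infsum (\<lambda>x. g (?join x)) (tuples n \<times> UNIV)"
    by (rule infsum_reindex_bij_betw[OF bij, symmetric])
  also have "\<dots> = infsum (\<lambda>(\<nu>, k). p \<nu> * r k) (tuples n \<times> UNIV)"
    by (rule infsum_cong) (use g_join in auto)
  also have "\<dots> = infsum (\<lambda>\<nu>. infsum (\<lambda>k. p \<nu> * r k) UNIV) (tuples n)"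
    by (rule infsum_mfps_Times[OF lf])
  also have "\<dots> = infsum p (tuples n) * infsum r UNIV"
    unfolding infsum_mfps_cmult[OF lf_r] by (rule infsum_mfps_cmult_right[OF lf_p])
  also have "infsum p (tuples n) = (\<Prod>i = 1..n. infsum (\<lambda>k. e k * w i ^ k) UNIV)"
    unfolding p_def by (rule Suc.IH) (use Suc.prems in auto)
  finally show ?case by (simp add: r_def)
qed

lemma qpoch_conv_off: "mfps_coeff z 0 = 0 \<Longrightarrow> qpoch_conv q z"
  by standard (simp_all add: norm_q)

lemma mfps_coeff_0_qpoch_inf_s: "i < j \<Longrightarrow> mfps_coeff (qpoch_inf (mfps_const a * s_ratio i j) q) 0 \<noteq> 0"
  by (rule qpoch_conv.mfps_coeff_0_qpoch_inf[OF qpoch_conv_off]) (simp add: mfps_coeff_0_ratio)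

text \<open>With all ratios zero only the diagonal factors of a column depend on \<nu>, so its sum
  splits into n single sums, each a q-binomial series at (q / t) s_(n+1) / s_i.\<close>

lemma psum_delta:
  "psum q t n delta_ratio =
    (\<Prod>(i, j)\<in>index_pairs n. qpoch_inf (mfps_const q * s_ratio i j) q / qpoch_inf (mfps_const (q / t) * s_ratio i j) q)"
proof (induction n)
  case 0
  have "index_pairs 0 = {}" by (auto simp: index_pairs_def)
  then show ?case by simp
next
  case (Suc n)
  have one: "infsum (\<lambda>k. mfps_const (num.diagfac k) * s_ratio i (Suc n) ^ k) UNIV =
    qpoch_inf (mfps_const q * s_ratio i (Suc n)) q / qpoch_inf (mfps_const (q / t) * s_ratio i (Suc n)) q"
    if "i \<in> {1..n}" for i
  proof -
    let ?z = "mfps_const (q / t) * s_ratio i (Suc n)"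
    have z: "mfps_coeff ?z 0 = 0" using that by (simp add: mfps_coeff_0_ratio)
    have summand: "mfps_const (num.diagfac k) * s_ratio i (Suc n) ^ k = mfps_const (fin_qpoch q t k / fin_qpoch q q k) * ?z ^ k" for k
      unfolding diagfac_closed mfps_const_mult mfps_const_power power_mult_distrib by (simp only: mult_ac)
    have tz: "mfps_const t * ?z = mfps_const q * s_ratio i (Suc n)"
      using t_nz by (simp add: mult.assoc[symmetric] flip: mfps_const_mult)
    have product: "infsum (\<lambda>k. mfps_const (num.diagfac k) * s_ratio i (Suc n) ^ k) UNIV * qpoch_inf ?z q =
      qpoch_inf (mfps_const q * s_ratio i (Suc n)) q"
      unfolding summand q_binomial[OF norm_q q_nz z] tz ..
    have "mfps_coeff (qpoch_inf ?z q) 0 \<noteq> 0" using that by (intro mfps_coeff_0_qpoch_inf_s) simp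
    then show ?thesis by (rule mfps_divide_eq_iff[THEN iffD2, symmetric]) (rule product[symmetric])
  qed
  have twist_delta: "psum q t n (twist (\<lambda>i. q powi (- int (\<nu> i))) delta_ratio) = psum q t n delta_ratio" for \<nu>
    by (rule psum_cong) (simp add: twist_def delta_ratio_def q_nz)
  have "psum q t (Suc n) delta_ratio = infsum (\<lambda>\<nu>. psum q t n delta_ratio * (step_coeff q t n \<nu> delta_ratio * last_monom n \<nu>)) (tuples n)"
    unfolding psum_Suc[OF q_nz] twist_delta by (simp only: mult_ac)
  also have "\<dots> = psum q t n delta_ratio * infsum (\<lambda>\<nu>. step_coeff q t n \<nu> delta_ratio * last_monom n \<nu>) (tuples n)"
    by (rule infsum_mfps_cmult[OF locally_finite_last_monom])
  also have "infsum (\<lambda>\<nu>. step_coeff q t n \<nu> delta_ratio * last_monom n \<nu>) (tuples n) =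
      (\<Prod>i = 1..n. infsum (\<lambda>k. mfps_const (num.diagfac k) * s_ratio i (Suc n) ^ k) UNIV)"
    unfolding step_coeff_delta last_monom_def prod.distrib[symmetric]
    by (rule infsum_tuples_prod) (simp add: mord_ge_s_ratio del: One_nat_def)
  also have "\<dots> = (\<Prod>i = 1..n. qpoch_inf (mfps_const q * s_ratio i (Suc n)) q / qpoch_inf (mfps_const (q / t) * s_ratio i (Suc n)) q)"
    by (rule prod.cong[OF refl one])
  finally show ?case unfolding Suc.IH prod_index_pairs_Suc .
qed

text \<open>The quotient of the products in \<open>psum_delta\<close> for t and for q / t, in which
  (q s_j / s_i; q) cancels.\<close>

definition dual_ratio :: "nat \<Rightarrow> series"
  where "dual_ratio n = (\<Prod>(i, j)\<in>index_pairs n. qpoch_inf (mfps_const t * s_ratio i j) q / qpoch_inf (mfps_const (q / t) * s_ratio i j) q)"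

theorem psum_dual:
  assumes c: "\<And>i. c i \<noteq> 0"
  shows "psum q t n (y_ratio c) = dual_ratio n * psum q (q / t) n (y_ratio c)"
proof -
  interpret dual: qt_series q "q / t" by (rule dual)
  let ?V0 = "psum q (q / t) n delta_ratio"
  have V0: "?V0 = (\<Prod>(i, j)\<in>index_pairs n. qpoch_inf (mfps_const q * s_ratio i j) q / qpoch_inf (mfps_const t * s_ratio i j) q)"
    using dual.psum_delta[of n] q_nz by simp
  have unit: "mfps_coeff (qpoch_inf (mfps_const a * s_ratio i j) q) 0 \<noteq> 0" if "(i, j) \<in> index_pairs n" for a i j
    using that by (intro mfps_coeff_0_qpoch_inf_s) (simp add: index_pairs_def)
  have "dual_ratio n * ?V0 = psum q t n delta_ratio"
    unfolding dual_ratio_def V0 psum_delta prod.distrib[symmetric]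
    by (rule prod.cong) (auto simp: mfps_mult_divide_cancel unit)
  then have "?V0 * psum q t n (y_ratio c) = dual_ratio n * ?V0 * psum q (q / t) n (y_ratio c)"
    using psum_dual_proportional[of c n, OF c] by simp
  then have "?V0 * psum q t n (y_ratio c) = ?V0 * (dual_ratio n * psum q (q / t) n (y_ratio c))"
    by (simp only: mult_ac)
  moreover have "mfps_coeff ?V0 0 \<noteq> 0"
    unfolding V0 mfps_coeff_0_prod using unit by (auto simp: mfps_coeff_0_divide)
  then have "?V0 \<noteq> 0" by auto
  ultimately show ?thesis by simp
qed

end

section \<open>The kernel\<close>

definition phi_factor :: "complex \<Rightarrow> complex \<Rightarrow> nat \<Rightarrow> (nat \<Rightarrow> nat \<Rightarrow> series) \<Rightarrow> series"
  where "phi_factor q t n r =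
    (\<Prod>(i, j)\<in>index_pairs n. qpoch_inf (mfps_const q * r i j) q / qpoch_inf (mfps_const (q / t) * r i j) q)"

lemma phi_eq: "phi n s_ratio r q t = phi_factor q t n r * psum q t n r"
  unfolding phi_def phi_factor_def psum_def s_monom_def index_pairs_def ..

context qt_series
begin

section \<open>Quotients of infinite products\<close>

lemma qpoch_inf_nonzero: "qpoch_conv q z \<Longrightarrow> to_fract (qpoch_inf z q) \<noteq> 0"
  using qpoch_conv.mfps_coeff_0_qpoch_inf[of q z] by auto

lemma qpoch_nonzero: "qpoch_conv q z \<Longrightarrow> to_fract (qpoch z q k) \<noteq> 0"
  using qpoch_conv.qpoch_coeff_0_nonzero[of q z k] by auto

lemma qpoch_conv_shift: "qpoch_conv q z \<Longrightarrow> qpoch_conv q (mfps_const (q ^ k) * z)"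
proof
  assume z: "qpoch_conv q z"
  show "q ^ j * mfps_coeff (mfps_const (q ^ k) * z) 0 \<noteq> 1" for j
    using qpoch_conv.nonzero[OF z, of "j + k"] by (simp add: power_add mult.assoc)
qed (rule norm_q)

context
  fixes a b :: series and k :: nat
  assumes a: "qpoch_conv q a" and b: "qpoch_conv q b"
begin

lemmas units = qpoch_conv.mfps_coeff_0_qpoch_inf qpoch_conv.qpoch_coeff_0_nonzero
lemmas convs = a b qpoch_conv_shift[OF a] qpoch_conv_shift[OF b]

lemma to_fract_split:
  "to_fract (qpoch_inf a q) = to_fract (qpoch a q k) * to_fract (qpoch_inf (mfps_const (q ^ k) * a) q)"
  "to_fract (qpoch_inf b q) = to_fract (qpoch b q k) * to_fract (qpoch_inf (mfps_const (q ^ k) * b) q)"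
  unfolding to_fract_mult[symmetric] to_fract_eq_iff
  by (rule qpoch_conv.qpoch_inf_split[OF a] qpoch_conv.qpoch_inf_split[OF b])+

text \<open>This replaces a kernel quotient at a shifted argument by the unshifted one;
  \<open>qpoch_ratio'\<close> reduces two opposite quotients to a finite one.\<close>

lemma qpoch_ratio:
  "(qpoch_inf a q / qpoch_inf b q) * (qpoch b q k / qpoch a q k) =
    qpoch_inf (mfps_const (q ^ k) * a) q / qpoch_inf (mfps_const (q ^ k) * b) q"
proof -
  have "to_fract ((qpoch_inf a q / qpoch_inf b q) * (qpoch b q k / qpoch a q k)) =
    to_fract (qpoch_inf (mfps_const (q ^ k) * a) q / qpoch_inf (mfps_const (q ^ k) * b) q)"
    using convs[THEN qpoch_inf_nonzero] a[THEN qpoch_nonzero] b[THEN qpoch_nonzero]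
    unfolding to_fract_mult to_fract_divide[OF units(1)[OF b]] to_fract_divide[OF units(2)[OF a]]
      to_fract_divide[OF units(1)[OF qpoch_conv_shift[OF b]]] to_fract_split
    by (simp add: field_simps)
  then show ?thesis by (simp only: to_fract_eq_iff)
qed

lemma qpoch_ratio':
  "(qpoch_inf a q / qpoch_inf b q) *
    (qpoch_inf (mfps_const (q ^ k) * b) q / qpoch_inf (mfps_const (q ^ k) * a) q) = qpoch a q k / qpoch b q k"
proof -
  have "to_fract ((qpoch_inf a q / qpoch_inf b q) *
      (qpoch_inf (mfps_const (q ^ k) * b) q / qpoch_inf (mfps_const (q ^ k) * a) q)) =
    to_fract (qpoch a q k / qpoch b q k)"
    using convs[THEN qpoch_inf_nonzero] a[THEN qpoch_nonzero] b[THEN qpoch_nonzero]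
    unfolding to_fract_mult to_fract_divide[OF units(1)[OF b]] to_fract_divide[OF units(2)[OF b]]
      to_fract_divide[OF units(1)[OF qpoch_conv_shift[OF a]]] to_fract_split
    by (simp add: field_simps)
  then show ?thesis by (simp only: to_fract_eq_iff)
qed

end

text \<open>The points of the Jackson integral are \<open>y\<^sub>i = jpoint \<nu> i x\<^sub>i\<close>.\<close>

definition jpoint :: "(nat \<Rightarrow> nat) \<Rightarrow> nat \<Rightarrow> complex"
  where "jpoint \<nu> i = q powi (- int (\<nu> i) - 1) * t"

lemma jpoint_eq: "jpoint \<nu> i = t / (q ^ \<nu> i * q)"
  using q_nz by (simp add: jpoint_def power_int_diff power_int_minus divide_inverse mult_ac)

lemma jpoint_nonzero: "jpoint \<nu> i \<noteq> 0"
  using q_nz t_nz by (simp add: jpoint_eq)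

lemma jpoint_ratio: "jpoint \<nu> j / jpoint \<nu> i = q ^ \<nu> i / q ^ \<nu> j"
  using q_nz t_nz by (simp add: jpoint_eq field_simps)

text \<open>The common factor t / q of all coordinates drops out of the ratios.\<close>

lemma y_ratio_jpoint: "y_ratio (jpoint \<nu>) = y_ratio (qshift \<nu> (\<lambda>_. 1))"
  using q_nz by (simp add: y_ratio_def fun_eq_iff jpoint_ratio qshift_def power_int_minus field_simps)

lemma lambda_power_jpoint: "lambda_power q t n i (q * jpoint \<nu> i / t) = (mfps_const t * s_ratio i (n + 1)) ^ \<nu> i"
proof -
  have arg: "q * jpoint \<nu> i / t = q powi (- int (\<nu> i))"
    using q_nz t_nz by (simp add: jpoint_eq power_int_minus field_simps)
  have "k = \<nu> i" if "q powi (- int (\<nu> i)) = q powi (- int k)" for k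
  proof (rule ccontr)
    assume "k \<noteq> \<nu> i"
    then have "q powi (int k - int (\<nu> i)) \<noteq> 1" by (intro q_powi_ne_1) simp
    moreover have "q powi (int k - int (\<nu> i)) = q powi (- int (\<nu> i)) / q powi (- int k)"
      using q_nz by (simp add: power_int_diff power_int_minus field_simps)
    ultimately show False using that q_nz by simp
  qed
  then have "(THE k. q * jpoint \<nu> i / t = q powi (- int k)) = \<nu> i"
    unfolding arg by (intro the_equality) auto
  then show ?thesis by (simp add: lambda_power_def)
qed

lemma one_over_jpoint: "1 / jpoint \<nu> i = q ^ \<nu> i * (q / t)" "t * (1 / jpoint \<nu> i) = q ^ \<nu> i * q"
  using t_nz by (simp_all add: jpoint_eq)

lemma x_over_y_jpoint:
  "x_over_y (jpoint \<nu>) j i = mfps_const (q ^ \<nu> i) * (mfps_const (q / t) * x_ratio i j)"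
  "mfps_const t * x_over_y (jpoint \<nu>) j i = mfps_const (q ^ \<nu> i) * (mfps_const q * x_ratio i j)"
proof -
  show "x_over_y (jpoint \<nu>) j i = mfps_const (q ^ \<nu> i) * (mfps_const (q / t) * x_ratio i j)"
    unfolding x_over_y_def mult.assoc[symmetric] mfps_const_mult[symmetric] one_over_jpoint(1) ..
  show "mfps_const t * x_over_y (jpoint \<nu>) j i = mfps_const (q ^ \<nu> i) * (mfps_const q * x_ratio i j)"
    unfolding x_over_y_def mult.assoc[symmetric] mfps_const_mult[symmetric] one_over_jpoint(2) ..
qed

lemma q_power_ne_1: "q ^ Suc j \<noteq> 1"
  using q_powi_ne_1[of "int (Suc j)"] unfolding power_int_of_nat by simp

lemma qpoch_conv_q: "qpoch_conv q (mfps_const q)"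
proof
  show "q ^ j * mfps_coeff (mfps_const q) 0 \<noteq> 1" for j
    using q_power_ne_1[of j] by (simp add: mfps_coeff_const mult.commute)
qed (rule norm_q)

lemma qpoch_conv_q_over_t:
  assumes "\<And>k :: nat. t \<noteq> q ^ (k + 1)"
  shows "qpoch_conv q (mfps_const (q / t))"
proof
  show "q ^ j * mfps_coeff (mfps_const (q / t)) 0 \<noteq> 1" for j
    using assms[of j] t_nz by (auto simp: mfps_coeff_const field_simps)
qed (rule norm_q)

text \<open>Here x_i / y_i = q^\<nu>_i q / t, so the constant prefactor cancels the tails of the
  infinite products and leaves (q / t; q)_k / (q; q)_k with k = \<nu>_i. The power of t stems from
  the lambda power; together they are the diagonal factor for q / t by
  \<open>diagfac_closed\<close>.\<close>

lemma kernel_diagonal: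
  assumes t: "\<And>k :: nat. t \<noteq> q ^ (k + 1)"
  shows "(qpoch_inf (mfps_const (q / t)) q / (mfps_const (1 - q) * qpoch_inf (mfps_const q) q)) * mfps_const (1 - q) *
      (qpoch_inf (mfps_const t * x_over_y (jpoint \<nu>) i i) q / qpoch_inf (x_over_y (jpoint \<nu>) i i) q) * mfps_const t ^ \<nu> i =
    qpoch (mfps_const (q powi (- int (\<nu> i)) * q / (q / t)) * x_ratio i i) q (\<nu> i) /
      qpoch (mfps_const (q powi (- int (\<nu> i))) * x_ratio i i) q (\<nu> i)"
proof -
  interpret dual: qt_series q "q / t" by (rule dual)
  define k where "k = \<nu> i"
  note conv_q = qpoch_conv_q and conv_qt = qpoch_conv_q_over_t[OF t]
  have units: "mfps_coeff (qpoch_inf (mfps_const q) q) 0 \<noteq> 0" "mfps_coeff (qpoch_inf (mfps_const (q / t)) q) 0 \<noteq> 0"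
    by (rule qpoch_conv.mfps_coeff_0_qpoch_inf, rule conv_q conv_qt)+
  have "1 - q \<noteq> 0" using q_power_ne_1[of 0] by simp
  then have "mfps_coeff (mfps_const (1 - q) * qpoch_inf (mfps_const q) q) 0 \<noteq> 0"
    using units by simp
  then have "qpoch_inf (mfps_const (q / t)) q / (mfps_const (1 - q) * qpoch_inf (mfps_const q) q) *
      (mfps_const (1 - q) * qpoch_inf (mfps_const q) q) = qpoch_inf (mfps_const (q / t)) q"
    by (metis mfps_divide_eq_iff)
  then have prefactor: "qpoch_inf (mfps_const (q / t)) q / (mfps_const (1 - q) * qpoch_inf (mfps_const q) q) * mfps_const (1 - q) =
      qpoch_inf (mfps_const (q / t)) q / qpoch_inf (mfps_const q) q"
    by (subst eq_commute, subst mfps_divide_eq_iff[OF units(1)]) (simp only: mult.assoc)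
  have x1: "x_ratio i i = 1" by (simp add: x_ratio_def)
  have fq: "fin_qpoch q q k \<noteq> 0" using qpoch_conv.qpoch_coeff_0_nonzero[OF conv_q, of k] by (simp add: qpoch_const mfps_coeff_const)
  have "qpoch_inf (mfps_const (q / t)) q / qpoch_inf (mfps_const q) q *
      (qpoch_inf (mfps_const (q ^ k) * mfps_const q) q / qpoch_inf (mfps_const (q ^ k) * mfps_const (q / t)) q) =
      qpoch (mfps_const (q / t)) q k / qpoch (mfps_const q) q k"
    by (rule qpoch_ratio'[OF conv_qt conv_q])
  also have "\<dots> = mfps_const (fin_qpoch q (q / t) k / fin_qpoch q q k)"
    using fq by (simp add: qpoch_const mfps_divide_eq_iff mfps_coeff_const flip: mfps_const_mult)
  finally have "qpoch_inf (mfps_const (q / t)) q / qpoch_inf (mfps_const q) q *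
      (qpoch_inf (mfps_const (q ^ k) * mfps_const q) q / qpoch_inf (mfps_const (q ^ k) * mfps_const (q / t)) q) * mfps_const t ^ k =
      mfps_const (dual.num.diagfac k)"
    using q_nz by (simp add: dual.diagfac_closed mult.commute flip: mfps_const_mult mfps_const_power)
  then show ?thesis
    unfolding prefactor x_over_y_jpoint(2) unfolding x_over_y_jpoint(1) x1 mult_1_right k_def[symmetric] dual.qpoch_diagonal .
qed

lemma kernel_pair:
  assumes "i < j"
  shows "(qpoch_inf (mfps_const t * x_over_y (jpoint \<nu>) j i) q / qpoch_inf (x_over_y (jpoint \<nu>) j i) q) =
    (qpoch_inf (mfps_const q * x_ratio i j) q / qpoch_inf (mfps_const (q / t) * x_ratio i j) q) *
    (qpoch (mfps_const (q / t) * x_ratio i j) q (\<nu> i) / qpoch (mfps_const q * x_ratio i j) q (\<nu> i))"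
  unfolding x_over_y_jpoint(2) unfolding x_over_y_jpoint(1)
  by (rule qpoch_ratio[symmetric]; rule qpoch_conv_off; simp add: mfps_coeff_0_ratio[OF assms])

text \<open>The last quotient on the left is the prefactor of \<phi>_n at y and cancels against one
  kernel quotient. The other arguments are z = q^-\<nu>_j x_j / x_i, t z and their multiples by
  q^\<nu>_i, so a finite quotient of length \<nu>_i remains.\<close>

lemma kernel_inner:
  assumes "i < j"
  shows "(qpoch_inf (mfps_const q * y_over_x (jpoint \<nu>) j i) q / qpoch_inf (mfps_const (q / t) * y_over_x (jpoint \<nu>) j i) q) *
      ((qpoch_inf (y_ratio (jpoint \<nu>) i j) q / qpoch_inf (mfps_const t * y_ratio (jpoint \<nu>) i j) q) *
        (qpoch_inf (mfps_const (q / t) * y_ratio (jpoint \<nu>) i j) q / qpoch_inf (mfps_const q * y_ratio (jpoint \<nu>) i j) q)) *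
      (qpoch_inf (mfps_const q * y_ratio (jpoint \<nu>) i j) q / qpoch_inf (mfps_const (q / t) * y_ratio (jpoint \<nu>) i j) q) =
    qpoch (mfps_const (q powi (- int (\<nu> j)) * q / (q / t)) * x_ratio i j) q (\<nu> i) /
      qpoch (mfps_const (q powi (- int (\<nu> j))) * x_ratio i j) q (\<nu> i)"
proof -
  define z where "z = mfps_const (q powi (- int (\<nu> j))) * x_ratio i j"
  define y where "y = y_ratio (jpoint \<nu>) i j"
  have x0: "mfps_coeff (x_ratio i j) 0 = 0" by (rule mfps_coeff_0_ratio[OF assms])
  have conv: "qpoch_conv q z" "qpoch_conv q (mfps_const t * z)"
    by (rule qpoch_conv_off; simp add: z_def x0)+
  have y0: "mfps_coeff (qpoch_inf (mfps_const a * y) q) 0 \<noteq> 0" for a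
    by (rule qpoch_conv.mfps_coeff_0_qpoch_inf[OF qpoch_conv_off]) (simp add: y_def y_ratio_def x0)
  have yz: "y = mfps_const (q ^ \<nu> i) * z" "mfps_const t * y = mfps_const (q ^ \<nu> i) * (mfps_const t * z)"
    unfolding y_def z_def y_ratio_def jpoint_ratio
    by (simp_all add: power_int_minus divide_inverse mfps_const_mult mult_ac)
  have num: "mfps_const q * y_over_x (jpoint \<nu>) j i = mfps_const t * z"
  proof -
    have "q * jpoint \<nu> j = t * q powi (- int (\<nu> j))"
      using q_nz by (simp add: jpoint_eq power_int_minus field_simps)
    then show ?thesis unfolding y_over_x_def z_def mult.assoc[symmetric] mfps_const_mult[symmetric] by simp
  qed
  have den: "mfps_const (q / t) * y_over_x (jpoint \<nu>) j i = z"
  proof -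
    have "q / t * jpoint \<nu> j = q powi (- int (\<nu> j))"
      using q_nz t_nz by (simp add: jpoint_eq power_int_minus field_simps)
    then show ?thesis unfolding y_over_x_def z_def mult.assoc[symmetric] mfps_const_mult[symmetric] by simp
  qed
  have tz: "mfps_const (q powi (- int (\<nu> j)) * q / (q / t)) * x_ratio i j = mfps_const t * z"
    using q_nz by (simp add: z_def mfps_const_mult mult_ac)
  have cancel: "(qpoch_inf (mfps_const (q / t) * y) q / qpoch_inf (mfps_const q * y) q) *
      (qpoch_inf (mfps_const q * y) q / qpoch_inf (mfps_const (q / t) * y) q) = 1"
    unfolding mfps_mult_divide_cancel[OF y0] using mfps_unit[OF y0] by (simp add: divide_mfps_def)
  have "(qpoch_inf (mfps_const t * z) q / qpoch_inf z q) * (qpoch_inf y q / qpoch_inf (mfps_const t * y) q) =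
      qpoch (mfps_const t * z) q (\<nu> i) / qpoch z q (\<nu> i)"
    unfolding yz(2) unfolding yz(1) by (rule qpoch_ratio'[OF conv(2,1)])
  moreover have "u * (v * r) * r' = (u * v) * (r * r')" for u v r r' :: series by (simp only: mult_ac)
  ultimately show ?thesis
    unfolding y_def[symmetric] num den tz z_def[symmetric] by (simp only: cancel mult_1_right)
qed

lemma kernel_term:
  assumes t: "\<And>k :: nat. t \<noteq> q ^ (k + 1)"
  shows "(qpoch_inf (mfps_const (q / t)) q / (mfps_const (1 - q) * qpoch_inf (mfps_const q) q)) ^ n * mfps_const (1 - q) ^ n *
      K_kernel q t n (jpoint \<nu>) * phi_factor q t n (y_ratio (jpoint \<nu>)) =
    phi_factor q t (Suc n) x_ratio * step_coeff q (q / t) n \<nu> x_ratio * last_monom n \<nu>"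
proof -
  define p where "p = qpoch_inf (mfps_const (q / t)) q / (mfps_const (1 - q) * qpoch_inf (mfps_const q) q)"
  define A where "A i = qpoch_inf (mfps_const t * x_over_y (jpoint \<nu>) i i) q / qpoch_inf (x_over_y (jpoint \<nu>) i i) q" for i
  define B where "B i j = qpoch_inf (mfps_const t * x_over_y (jpoint \<nu>) j i) q / qpoch_inf (x_over_y (jpoint \<nu>) j i) q" for i j
  define C where "C i j = qpoch_inf (mfps_const q * y_over_x (jpoint \<nu>) j i) q / qpoch_inf (mfps_const (q / t) * y_over_x (jpoint \<nu>) j i) q" for i j
  define D where "D i j = (qpoch_inf (y_ratio (jpoint \<nu>) i j) q / qpoch_inf (mfps_const t * y_ratio (jpoint \<nu>) i j) q) *
        (qpoch_inf (mfps_const (q / t) * y_ratio (jpoint \<nu>) i j) q / qpoch_inf (mfps_const q * y_ratio (jpoint \<nu>) i j) q)" for i j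
  define w where "w i j = qpoch_inf (mfps_const q * y_ratio (jpoint \<nu>) i j) q / qpoch_inf (mfps_const (q / t) * y_ratio (jpoint \<nu>) i j) q" for i j
  define w' where "w' i j = qpoch_inf (mfps_const q * x_ratio i j) q / qpoch_inf (mfps_const (q / t) * x_ratio i j) q" for i j
  define p1 where "p1 i j = qpoch (mfps_const (q / t) * x_ratio i j) q (\<nu> i) / qpoch (mfps_const q * x_ratio i j) q (\<nu> i)" for i j
  define p2 where "p2 i j = qpoch (mfps_const (q powi (- int (\<nu> j)) * q / (q / t)) * x_ratio i j) q (\<nu> i) /
      qpoch (mfps_const (q powi (- int (\<nu> j))) * x_ratio i j) q (\<nu> i)" for i j
  have diagonal: "p * mfps_const (1 - q) * A i * mfps_const t ^ \<nu> i = p2 i i" for i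
    unfolding p_def A_def p2_def by (rule kernel_diagonal[OF t])
  have pair: "B i j = w' i j * p1 i j" if "(i, j) \<in> index_pairs m" for i j m
    unfolding B_def w'_def p1_def by (rule kernel_pair) (use that in \<open>simp add: index_pairs_def\<close>)
  have inner: "C i j * D i j * w i j = p2 i j" if "(i, j) \<in> index_pairs m" for i j m
    unfolding C_def D_def w_def p2_def by (rule kernel_inner) (use that in \<open>simp add: index_pairs_def\<close>)
  have kernel: "K_kernel q t n (jpoint \<nu>) = (\<Prod>i = 1..n. A i) * (\<Prod>(i, j)\<in>index_pairs (Suc n). B i j) *
      (\<Prod>(i, j)\<in>index_pairs n. C i j) * (\<Prod>(i, j)\<in>index_pairs n. D i j) *
      (\<Prod>i = 1..n. (mfps_const t * s_ratio i (Suc n)) ^ \<nu> i)"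
    unfolding K_kernel_def lambda_power_jpoint A_def B_def C_def D_def index_pairs_def Suc_eq_plus1 ..
  have step: "step_coeff q (q / t) n \<nu> x_ratio = (\<Prod>(i, j)\<in>index_pairs (Suc n). p1 i j) *
      ((\<Prod>(i, j)\<in>index_pairs n. p2 i j) * (\<Prod>i = 1..n. p2 i i))"
    unfolding step_coeff_def p1_def[symmetric] p2_def[symmetric] prod_weak_index_pairs index_pairs_def[of "Suc n", symmetric] ..
  have "p ^ n * mfps_const (1 - q) ^ n * K_kernel q t n (jpoint \<nu>) * phi_factor q t n (y_ratio (jpoint \<nu>)) =
      (\<Prod>i = 1..n. p * mfps_const (1 - q) * A i * mfps_const t ^ \<nu> i) *
      (\<Prod>(i, j)\<in>index_pairs (Suc n). B i j) *
      (\<Prod>(i, j)\<in>index_pairs n. C i j * D i j * w i j) * last_monom n \<nu>"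
    unfolding kernel phi_factor_def w_def[symmetric] last_monom_def
    by (simp only: prod.distrib prod_constant card_atLeastAtMost diff_Suc_1 power_mult_distrib case_prod_unfold mult_ac)
  also have "(\<Prod>(i, j)\<in>index_pairs (Suc n). B i j) = (\<Prod>(i, j)\<in>index_pairs (Suc n). w' i j * p1 i j)"
    by (rule prod.cong) (use pair in auto)
  also have "(\<Prod>(i, j)\<in>index_pairs n. C i j * D i j * w i j) = (\<Prod>(i, j)\<in>index_pairs n. p2 i j)"
    by (rule prod.cong) (use inner in auto)
  also have "(\<Prod>i = 1..n. p * mfps_const (1 - q) * A i * mfps_const t ^ \<nu> i) = (\<Prod>i = 1..n. p2 i i)"
    by (simp only: diagonal)
  also have "(\<Prod>i = 1..n. p2 i i) * (\<Prod>(i, j)\<in>index_pairs (Suc n). w' i j * p1 i j) *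
      (\<Prod>(i, j)\<in>index_pairs n. p2 i j) * last_monom n \<nu> = phi_factor q t (Suc n) x_ratio * step_coeff q (q / t) n \<nu> x_ratio * last_monom n \<nu>"
    unfolding step phi_factor_def w'_def[symmetric]
    by (simp only: prod.distrib case_prod_unfold mult_ac)
  finally show ?thesis unfolding p_def .
qed

text \<open>The duality is used twice: inside the integral it passes from t to q / t, so that the
  sum becomes the recurrence for q / t, and for n + 1 it passes back. The product over s_(n+1) / s_i
  in front is the quotient of the two dual ratios.\<close>

theorem recurrence:
  assumes t: "\<And>k :: nat. t \<noteq> q ^ (k + 1)"
  shows "phi (n + 1) s_ratio x_ratio q t =
    (qpoch_inf (mfps_const (q / t)) q / (mfps_const (1 - q) * qpoch_inf (mfps_const q) q)) ^ n *
    (\<Prod>i = 1..n. qpoch_inf (mfps_const t * s_ratio i (n + 1)) q /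
                 qpoch_inf (mfps_const (q / t) * s_ratio i (n + 1)) q) *
    jackson_integral q n (\<lambda>_. t) (\<lambda>c. K_kernel q t n c * phi n s_ratio (y_ratio c) q t)"
proof -
  interpret dual: qt_series q "q / t" by (rule dual)
  define p where "p = qpoch_inf (mfps_const (q / t)) q / (mfps_const (1 - q) * qpoch_inf (mfps_const q) q)"
  define P where "P = (\<Prod>i = 1..n. qpoch_inf (mfps_const t * s_ratio i (Suc n)) q / qpoch_inf (mfps_const (q / t) * s_ratio i (Suc n)) q)"
  define V where "V \<nu> = psum q (q / t) n (y_ratio (qshift \<nu> (\<lambda>_. 1)))" for \<nu>
  define W where "W = phi_factor q t (Suc n) x_ratio"
  define K where "K \<nu> = K_kernel q t n (jpoint \<nu>) * phi_factor q t n (y_ratio (jpoint \<nu>))" for \<nu>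
  have G: "dual_ratio (Suc n) = dual_ratio n * P"
    unfolding dual_ratio_def P_def prod_index_pairs_Suc ..
  define u where "u = p ^ n * mfps_const (1 - q) ^ n"
  have term_eq: "u * K \<nu> = W * step_coeff q (q / t) n \<nu> x_ratio * last_monom n \<nu>" for \<nu>
    using kernel_term[OF t, of n \<nu>] by (simp only: K_def W_def p_def u_def mult.assoc)
  have unit_u: "mfps_coeff u 0 \<noteq> 0"
    using qpoch_conv.mfps_coeff_0_qpoch_inf[OF qpoch_conv_q] q_power_ne_1[of 0]
      qpoch_conv.mfps_coeff_0_qpoch_inf[OF qpoch_conv_q_over_t[OF t]]
    by (simp add: u_def p_def mfps_coeff_0_mult mfps_coeff_0_power mfps_coeff_0_divide mfps_coeff_const)
  \<comment> \<open>Dividing by the unit \<open>u\<close> exposes the factor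
    \<open>last_monom\<close> in \<open>K\<close>, from which the local finiteness of the integral
    follows.\<close>
  have K_eq: "K \<nu> = inverse u * (W * step_coeff q (q / t) n \<nu> x_ratio * last_monom n \<nu>)" for \<nu>
  proof -
    have "inverse u * (u * K \<nu>) = (u * inverse u) * K \<nu>" by (simp only: mult_ac)
    then show ?thesis unfolding term_eq using mfps_unit[OF unit_u] by simp
  qed
  have lf: "locally_finite (tuples n) (\<lambda>\<nu>. K \<nu> * (dual_ratio n * V \<nu>))"
    using locally_finite_last_monom[of n "\<lambda>\<nu>. inverse u * W * step_coeff q (q / t) n \<nu> x_ratio * (dual_ratio n * V \<nu>)"]
    by (rule locally_finite_cong[THEN iffD1, rotated]) (simp only: K_eq mult_ac)
  have J: "jackson_integral q n (\<lambda>_. t) (\<lambda>c. K_kernel q t n c * phi n s_ratio (y_ratio c) q t) =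
      mfps_const (1 - q) ^ n * infsum (\<lambda>\<nu>. K \<nu> * (dual_ratio n * V \<nu>)) (tuples n)"
  proof -
    have "phi n s_ratio (y_ratio (jpoint \<nu>)) q t = phi_factor q t n (y_ratio (jpoint \<nu>)) * (dual_ratio n * V \<nu>)" for \<nu>
      unfolding phi_eq V_def y_ratio_jpoint[symmetric] using psum_dual[of "jpoint \<nu>" n] jpoint_nonzero by simp
    moreover have "(\<lambda>i. q powi (- int (\<nu> i) - 1) * t) = jpoint \<nu>" for \<nu>
      by (simp add: jpoint_def fun_eq_iff)
    ultimately show ?thesis
      unfolding jackson_integral_def tuples_def K_def by (simp only: mult.assoc)
  qed
  have "p ^ n * P * (mfps_const (1 - q) ^ n * infsum (\<lambda>\<nu>. K \<nu> * (dual_ratio n * V \<nu>)) (tuples n)) =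
      P * (u * infsum (\<lambda>\<nu>. K \<nu> * (dual_ratio n * V \<nu>)) (tuples n))"
    by (simp only: u_def mult_ac)
  also have "u * infsum (\<lambda>\<nu>. K \<nu> * (dual_ratio n * V \<nu>)) (tuples n) = infsum (\<lambda>\<nu>. u * (K \<nu> * (dual_ratio n * V \<nu>))) (tuples n)"
    by (rule infsum_mfps_cmult[OF lf, symmetric])
  also have "\<dots> = infsum (\<lambda>\<nu>. (W * dual_ratio n) * (step_coeff q (q / t) n \<nu> x_ratio * V \<nu> * last_monom n \<nu>)) (tuples n)"
    by (rule infsum_cong) (simp only: mult.assoc[symmetric] term_eq, simp only: mult_ac)
  also have "\<dots> = (W * dual_ratio n) * infsum (\<lambda>\<nu>. step_coeff q (q / t) n \<nu> x_ratio * V \<nu> * last_monom n \<nu>) (tuples n)"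
    by (rule infsum_mfps_cmult[OF locally_finite_last_monom])
  also have "infsum (\<lambda>\<nu>. step_coeff q (q / t) n \<nu> x_ratio * V \<nu> * last_monom n \<nu>) (tuples n) = psum q (q / t) (Suc n) x_ratio"
    using dual.F_Suc[of n "\<lambda>_. 1"] by (simp only: y_ratio_1 last_sum_def V_def)
  also have "P * (W * dual_ratio n * psum q (q / t) (Suc n) x_ratio) = W * psum q t (Suc n) x_ratio"
    using psum_dual[of "\<lambda>_. 1" "Suc n"] unfolding G y_ratio_1 by (simp only: mult_ac) simp
  finally have "W * psum q t (Suc n) x_ratio =
      p ^ n * P * (mfps_const (1 - q) ^ n * infsum (\<lambda>\<nu>. K \<nu> * (dual_ratio n * V \<nu>)) (tuples n))" by (rule sym)
  then show ?thesis unfolding J unfolding Suc_eq_plus1[symmetric] phi_eq W_def P_def p_def .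
qed

end

theorem theorem4p2:
  fixes q t :: complex and n :: nat
  assumes "q \<noteq> 0" and "norm q < 1" and "t \<noteq> 0"
    and "\<And>k :: nat. t \<noteq> q ^ (k + 1)"
    and "n \<ge> 1"
  shows "phi (n + 1) s_ratio x_ratio q t =
    (qpoch_inf (mfps_const (q / t)) q / (mfps_const (1 - q) * qpoch_inf (mfps_const q) q)) ^ n *
    (\<Prod>i = 1..n. qpoch_inf (mfps_const t * s_ratio i (n + 1)) q /
                 qpoch_inf (mfps_const (q / t) * s_ratio i (n + 1)) q) *
    jackson_integral q n (\<lambda>_. t) (\<lambda>c. K_kernel q t n c * phi n s_ratio (y_ratio c) q t)"
proof -
  interpret qt_series q t by standard (use assms in auto)
  show ?thesis by (rule recurrence[OF assms(4)])
qed

end
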